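(* Let $d\in\mathbb{N}$, $d\ge 1$, and let $X\subseteq \mathrm{Lip}_0(\mathbb{Z}^d)$ be a translation-invariant pointwise closed linear subspace. Then the following dichotomy holds: either $X$ is finite-dimensional, or $X$ is non-separable (in the norm $\mathrm{Lip}(\cdot)$). In particular, either $\mathcal{F}_X(\mathbb{Z}^d)$ is finite-dimensional, or $\mathcal{F}_X(\mathbb{Z}^d)$ is not reflexive.
   Context: Scalars are real. $\mathbb{Z}^d$ is viewed as the Cayley graph with respect to the canonical generators $\pm e_1,\dots,\pm e_d$, so its graph metric is $d(v,w)=\|v-w\|_{1}$, with distinguished vertex $0$. $\mathrm{Lip}_0(\mathbb{Z}^d)$ is the Banach space of all Lipschitz functions $f:\mathbb{Z}^d\to\mathbb{R}$ with $f(0)=0$, normed by the optimal Lipschitz constant $\mathrm{Lip}(f)=\sup_{v\ne w}\frac{f(v)-f(w)}{d(v,w)}$. For $h\in\mathbb{Z}^d$ and $f\in\mathrm{Lip}_0(\mathbb{Z}^d)$ set $(h\cdot f)(x)=f(x-h)-f(-h)$. A linear subspace $X\subseteq\mathrm{Lip}_0(\mathbb{Z}^d)$ is translation-invariant if $h\cdot X=X$ for all $h\in\mathbb{Z}^d$. It is pointwise closed if it is closed in $\mathrm{Lip}_0(\mathbb{Z}^d)$ for the topology of pointwise convergence on $\mathbb{Z}^d$. $\mathcal{F}(\mathbb{Z}^d)$ denotes the Lipschitz-free space (Arens–Eells space) over the pointed metric space $(\mathbb{Z}^d,d,0)$, the canonical predual of $\mathrm{Lip}_0(\mathbb{Z}^d)$: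 there is an isometric embedding $\delta:\mathbb{Z}^d\to\mathcal{F}(\mathbb{Z}^d)$ with $\delta(0)=0$, with linearly dense range, such that each $f\in\mathrm{Lip}_0(\mathbb{Z}^d)$ extends uniquely to a bounded functional with $\langle f,\delta(v)\rangle=f(v)$, and this identifies $\mathcal{F}(\mathbb{Z}^d)^*$ isometrically with $\mathrm{Lip}_0(\mathbb{Z}^d)$. For $X$ pointwise closed (hence weak$^*$-closed), $\mathcal{F}_X(\mathbb{Z}^d):=\mathcal{F}(\mathbb{Z}^d)/X_\perp$, where $X_\perp=\{z\in\mathcal{F}(\mathbb{Z}^d): f(z)=0\ \forall f\in X\}$; it is the canonical isometric predual of $X$. *)

theory Defs
  imports "HOL-Analysis.Analysis"
begin

section \<open>The space of Lipschitz functions on the integer lattice\<close>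

text \<open>The graph metric of the integer lattice with its canonical generators.  The library's
  \<^const>\<open>dist\<close> on vectors is the Euclidean one, which is why it is not used here.\<close>

definition zdist :: "int ^ 'd::finite \<Rightarrow> int ^ 'd \<Rightarrow> real" where
  "zdist v w = real_of_int (\<Sum>i\<in>UNIV. \<bar>v $ i - w $ i\<bar>)"

lemma zdist_self [simp]: "zdist v v = 0"
  by (simp add: zdist_def)

lemma zdist_nonneg [simp]: "0 \<le> zdist v w"
  by (simp add: zdist_def sum_nonneg)

lemma zdist_commute: "zdist v w = zdist w v"
  by (simp add: zdist_def abs_minus_commute)

lemma zdist_pos: "v \<noteq> w \<Longrightarrow> 0 < zdist v w"
proof -
  assume "v \<noteq> w"
  then obtain i where "v $ i \<noteq> w $ i" by (auto simp: vec_eq_iff)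
  then have "0 < (\<Sum>i\<in>UNIV. \<bar>v $ i - w $ i\<bar>)"
    by (intro sum_pos2[of _ i]) auto
  then show ?thesis by (simp only: zdist_def of_int_0_less_iff)
qed

lemma zdist_triangle: "zdist u w \<le> zdist u v + zdist v w"
proof -
  have "(\<Sum>i\<in>UNIV. \<bar>u $ i - w $ i\<bar>) \<le> (\<Sum>i\<in>UNIV. \<bar>u $ i - v $ i\<bar> + \<bar>v $ i - w $ i\<bar>)"
    by (intro sum_mono) auto
  then show ?thesis
    unfolding zdist_def sum.distrib by linarith
qed

lemma zdist_translate [simp]: "zdist (v - h) (w - h) = zdist v w"
  by (simp add: zdist_def)

definition lip0_functions :: "(int ^ 'd::finite \<Rightarrow> real) set" where
  "lip0_functions = {f. f 0 = 0 \<and> (\<exists>C. \<forall>v w. \<bar>f v - f w\<bar> \<le> C * zdist v w)}"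

lemma lip0_functionsI:
  "f 0 = 0 \<Longrightarrow> (\<And>v w. \<bar>f v - f w\<bar> \<le> C * zdist v w) \<Longrightarrow> f \<in> lip0_functions"
  by (auto simp: lip0_functions_def)

lemma lip0_functionsE:
  assumes "f \<in> lip0_functions"
  obtains C where "f 0 = 0" "\<And>v w. \<bar>f v - f w\<bar> \<le> C * zdist v w"
  using assms by (auto simp: lip0_functions_def)

typedef (overloaded) ('d::finite) lip0 = "lip0_functions :: (int ^ 'd \<Rightarrow> real) set"
  morphisms lip0_apply Lip0
  by (rule exI[of _ "\<lambda>_. 0"]) (auto simp: lip0_functions_def intro: exI[of _ 0])

setup_lifting type_definition_lip0

lemma lip0_eqI: "(\<And>v. lip0_apply f v = lip0_apply g v) \<Longrightarrow> f = g"
  by (simp add: lip0_apply_inject[symmetric] fun_eq_iff)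

lemma lip0_apply_at_0 [simp]: "lip0_apply f 0 = 0"
  using lip0_apply[of f] by (auto simp: lip0_functions_def)

lemma lip0_add_mem:
  assumes "f \<in> lip0_functions" "g \<in> lip0_functions"
  shows "(\<lambda>v. f v + g v) \<in> lip0_functions"
proof -
  obtain C where C: "f 0 = 0" "\<And>v w. \<bar>f v - f w\<bar> \<le> C * zdist v w"
    using assms(1) by (rule lip0_functionsE) (rule that)
  obtain D where D: "g 0 = 0" "\<And>v w. \<bar>g v - g w\<bar> \<le> D * zdist v w"
    using assms(2) by (rule lip0_functionsE) (rule that)
  show ?thesis
  proof (rule lip0_functionsI)
    fix v w
    show "\<bar>f v + g v - (f w + g w)\<bar> \<le> (C + D) * zdist v w"
      using C(2)[of v w] D(2)[of v w] by (simp add: algebra_simps)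
  qed (simp add: C D)
qed

lemma lip0_scale_mem:
  assumes "f \<in> lip0_functions"
  shows "(\<lambda>v. c * f v) \<in> lip0_functions"
proof -
  obtain C where C: "f 0 = 0" "\<And>v w. \<bar>f v - f w\<bar> \<le> C * zdist v w"
    using assms by (rule lip0_functionsE) (rule that)
  show ?thesis
  proof (rule lip0_functionsI)
    fix v w
    show "\<bar>c * f v - c * f w\<bar> \<le> (\<bar>c\<bar> * C) * zdist v w"
      using mult_left_mono[OF C(2)[of v w], of "\<bar>c\<bar>"]
      by (simp add: right_diff_distrib[symmetric] abs_mult mult.assoc)
  qed (simp add: C)
qed

lemma lip0_diff_mem:
  "f \<in> lip0_functions \<Longrightarrow> g \<in> lip0_functions \<Longrightarrow> (\<lambda>v. f v - g v) \<in> lip0_functions"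
  using lip0_add_mem[OF _ lip0_scale_mem[of g "-1"], of f] by simp

instantiation lip0 :: (finite) real_vector
begin

lift_definition zero_lip0 :: "'a lip0" is "\<lambda>_. 0"
  by (rule lip0_functionsI[where C = 0]) auto

lift_definition plus_lip0 :: "'a lip0 \<Rightarrow> 'a lip0 \<Rightarrow> 'a lip0" is "\<lambda>f g v. f v + g v"
  by (rule lip0_add_mem)

lift_definition minus_lip0 :: "'a lip0 \<Rightarrow> 'a lip0 \<Rightarrow> 'a lip0" is "\<lambda>f g v. f v - g v"
  by (rule lip0_diff_mem)

lift_definition uminus_lip0 :: "'a lip0 \<Rightarrow> 'a lip0" is "\<lambda>f v. - f v"
  using lip0_scale_mem[where c = "-1"] by simp

lift_definition scaleR_lip0 :: "real \<Rightarrow> 'a lip0 \<Rightarrow> 'a lip0" is "\<lambda>c f v. c * f v"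
  by (rule lip0_scale_mem)

instance
  by standard (transfer; simp add: algebra_simps)+

end

lemma lip0_apply_simps [simp]:
  "lip0_apply 0 v = 0"
  "lip0_apply (f + g) v = lip0_apply f v + lip0_apply g v"
  "lip0_apply (f - g) v = lip0_apply f v - lip0_apply g v"
  "lip0_apply (- f) v = - lip0_apply f v"
  "lip0_apply (c *\<^sub>R f) v = c * lip0_apply f v"
  by (transfer, simp)+

definition lip_const :: "(int ^ 'd::finite \<Rightarrow> real) \<Rightarrow> real" where
  "lip_const f = (SUP (v, w) \<in> {(v, w). v \<noteq> w}. (f v - f w) / zdist v w)"

lemma zlattice_nontrivial: "{(v, w). v \<noteq> (w :: int ^ 'd::finite)} \<noteq> {}"
proof -
  have "(1 :: int ^ 'd) \<noteq> 0" by (simp add: vec_eq_iff)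
  then show ?thesis by blast
qed

lemma lip_const_least:
  fixes f :: "int ^ 'd::finite \<Rightarrow> real"
  assumes "\<And>v w. f v - f w \<le> C * zdist v w"
  shows "lip_const f \<le> C"
  unfolding lip_const_def
proof (rule cSUP_least[OF zlattice_nontrivial], clarify)
  fix v w :: "int ^ 'd" assume "v \<noteq> w"
  then show "(f v - f w) / zdist v w \<le> C"
    using assms[of v w] zdist_pos[of v w] by (simp add: pos_divide_le_eq)
qed

lemma lip_const_bound:
  assumes "f \<in> lip0_functions"
  shows "\<bar>f v - f w\<bar> \<le> lip_const f * zdist v w"
proof (cases "v = w")
  case False
  obtain C where C: "\<And>v w. \<bar>f v - f w\<bar> \<le> C * zdist v w"
    using assms by (rule lip0_functionsE) auto
  have C': "f v - f w \<le> C * zdist v w" for v w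
    using C[of v w] by linarith
  have bdd: "bdd_above ((\<lambda>(v, w). (f v - f w) / zdist v w) ` {(v, w). v \<noteq> w})"
    by (rule bdd_aboveI2[where M = C])
       (auto simp: pos_divide_le_eq zdist_pos C')
  have *: "f v - f w \<le> lip_const f * zdist v w" if "v \<noteq> w" for v w
  proof -
    have "(f v - f w) / zdist v w \<le> lip_const f"
      unfolding lip_const_def using cSUP_upper[OF _ bdd, of "(v, w)"] that by auto
    then show ?thesis
      using zdist_pos[OF that] by (simp add: pos_divide_le_eq)
  qed
  show ?thesis
    using *[OF False] *[of w v] False by (auto simp: zdist_commute[of w v] abs_le_iff)
qed simp

instantiation lip0 :: (finite) real_normed_vector
begin

lift_definition norm_lip0 :: "'a lip0 \<Rightarrow> real" is lip_const .

definition sgn_lip0 :: "'a lip0 \<Rightarrow> 'a lip0" where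
  "sgn_lip0 f = f /\<^sub>R norm f"

definition dist_lip0 :: "'a lip0 \<Rightarrow> 'a lip0 \<Rightarrow> real" where
  "dist_lip0 f g = norm (f - g)"

definition uniformity_lip0 :: "('a lip0 \<times> 'a lip0) filter" where
  "uniformity_lip0 = (INF e\<in>{0<..}. principal {(f, g). dist f g < e})"

definition open_lip0 :: "'a lip0 set \<Rightarrow> bool" where
  "open_lip0 U = (\<forall>f\<in>U. \<forall>\<^sub>F (f', g) in uniformity. f' = f \<longrightarrow> g \<in> U)"

lemma lip0_bound: "\<bar>lip0_apply f v - lip0_apply f w\<bar> \<le> norm f * zdist v w"
  for f :: "'a lip0"
  by transfer (rule lip_const_bound)

lemma lip0_norm_le:
  "(\<And>v w. \<bar>lip0_apply f v - lip0_apply f w\<bar> \<le> C * zdist v w) \<Longrightarrow> norm f \<le> C"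
  for f :: "'a lip0"
  unfolding norm_lip0.rep_eq by (rule lip_const_least) (simp add: abs_le_iff)

lemma lip0_norm_nonneg: "0 \<le> norm f" for f :: "'a lip0"
proof -
  obtain v w :: "int ^ 'a" where "v \<noteq> w"
    using zlattice_nontrivial by blast
  then show ?thesis
    using lip0_bound[of f v w] zdist_pos[of v w]
    by (smt (verit) mult_nonneg_nonneg zero_less_mult_iff mult_neg_pos)
qed

lemma lip0_norm_scale_le: "norm (c *\<^sub>R f) \<le> \<bar>c\<bar> * norm f" for f :: "'a lip0"
proof (rule lip0_norm_le)
  fix v w
  show "\<bar>lip0_apply (c *\<^sub>R f) v - lip0_apply (c *\<^sub>R f) w\<bar> \<le> \<bar>c\<bar> * norm f * zdist v w"
    using mult_left_mono[OF lip0_bound[of f v w], of "\<bar>c\<bar>"]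
    by (simp add: right_diff_distrib[symmetric] abs_mult mult.assoc)
qed

instance
proof
  fix f g :: "'a lip0" and c :: real
  show "norm f = 0 \<longleftrightarrow> f = 0"
  proof
    assume "norm f = 0"
    then have "lip0_apply f v = 0" for v
      using lip0_bound[of f v 0] by simp
    then show "f = 0" by (intro lip0_eqI) simp
  next
    assume "f = 0"
    then have "norm f \<le> 0" by (intro lip0_norm_le) simp
    then show "norm f = 0" using lip0_norm_nonneg[of f] by simp
  qed
  show "norm (f + g) \<le> norm f + norm g"
  proof (rule lip0_norm_le)
    fix v w
    show "\<bar>lip0_apply (f + g) v - lip0_apply (f + g) w\<bar> \<le> (norm f + norm g) * zdist v w"
      using lip0_bound[of f v w] lip0_bound[of g v w] by (simp add: algebra_simps)
  qed
  show "norm (c *\<^sub>R f) = \<bar>c\<bar> * norm f"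
  proof (cases "c = 0")
    case True
    then have "norm (c *\<^sub>R f) \<le> 0" by (intro lip0_norm_le) simp
    then show ?thesis using True lip0_norm_nonneg[of "c *\<^sub>R f"] by simp
  next
    case False
    have "norm f \<le> \<bar>inverse c\<bar> * norm (c *\<^sub>R f)"
      using lip0_norm_scale_le[of "inverse c" "c *\<^sub>R f"] False by simp
    then have "\<bar>c\<bar> * norm f \<le> norm (c *\<^sub>R f)"
      using False by (simp add: field_simps)
    then show ?thesis using lip0_norm_scale_le[of c f] by simp
  qed
qed (rule sgn_lip0_def dist_lip0_def uniformity_lip0_def open_lip0_def)+

end

lift_definition translate :: "int ^ 'd::finite \<Rightarrow> 'd lip0 \<Rightarrow> 'd lip0"
  is "\<lambda>h f x. f (x - h) - f (- h)"
proof -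
  fix h :: "int ^ 'd" and f :: "int ^ 'd \<Rightarrow> real"
  assume "f \<in> lip0_functions"
  then obtain C where "\<And>v w. \<bar>f v - f w\<bar> \<le> C * zdist v w"
    by (rule lip0_functionsE) auto
  from this[of "_ - h" "_ - h"]
  show "(\<lambda>x. f (x - h) - f (- h)) \<in> lip0_functions"
    by (intro lip0_functionsI[where C = C]) auto
qed

definition translation_invariant :: "'d::finite lip0 set \<Rightarrow> bool" where
  "translation_invariant X \<longleftrightarrow> (\<forall>h. translate h ` X = X)"

text \<open>The topology that the library puts on a function type is that of pointwise convergence.
  Closedness is relative to the set of all Lipschitz functions vanishing at the origin.\<close>

definition pointwise_closed :: "'d::finite lip0 set \<Rightarrow> bool" where
  "pointwise_closed X \<longleftrightarrow> closedin (top_of_set lip0_functions) (lip0_apply ` X)"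


section \<open>Normed spaces given by a carrier, their duals, and quotients\<close>

text \<open>A quotient by a subspace that is itself a variable cannot be a type, so the normed space
  structure is recorded explicitly.\<close>

record 'a normed_structure =
  carrier :: "'a set"
  zero_of :: 'a
  add_of :: "'a \<Rightarrow> 'a \<Rightarrow> 'a"
  scale_of :: "real \<Rightarrow> 'a \<Rightarrow> 'a"
  norm_of :: "'a \<Rightarrow> real"

definition subspace_of :: "('a, 'm) normed_structure_scheme \<Rightarrow> 'a set \<Rightarrow> bool" where
  "subspace_of E S \<longleftrightarrow> S \<subseteq> carrier E \<and> zero_of E \<in> S \<and>
     (\<forall>x\<in>S. \<forall>y\<in>S. add_of E x y \<in> S) \<and> (\<forall>c. \<forall>x\<in>S. scale_of E c x \<in> S)"

definition finite_dimensional :: "('a, 'm) normed_structure_scheme \<Rightarrow> bool" where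
  "finite_dimensional E \<longleftrightarrow>
     (\<exists>B. finite B \<and> B \<subseteq> carrier E \<and> subspace_of E hull B = carrier E)"

text \<open>Functionals take the value \<^const>\<open>undefined\<close> outside the carrier, so that equality of
  functions is equality of functionals.\<close>

definition dual :: "('a, 'm) normed_structure_scheme \<Rightarrow> ('a \<Rightarrow> real) normed_structure" where
  "dual E = \<lparr>
     carrier = {\<phi> \<in> extensional (carrier E).
       (\<forall>x\<in>carrier E. \<forall>y\<in>carrier E. \<phi> (add_of E x y) = \<phi> x + \<phi> y) \<and>
       (\<forall>c. \<forall>x\<in>carrier E. \<phi> (scale_of E c x) = c * \<phi> x) \<and>
       (\<exists>C. \<forall>x\<in>carrier E. \<bar>\<phi> x\<bar> \<le> C * norm_of E x)},
     zero_of = (\<lambda>x\<in>carrier E. 0),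
     add_of = (\<lambda>\<phi> \<psi>. \<lambda>x\<in>carrier E. \<phi> x + \<psi> x),
     scale_of = (\<lambda>c \<phi>. \<lambda>x\<in>carrier E. c * \<phi> x),
     norm_of = (\<lambda>\<phi>. SUP x\<in>{x\<in>carrier E. norm_of E x \<le> 1}. \<bar>\<phi> x\<bar>) \<rparr>"

definition bidual_embedding ::
    "('a, 'm) normed_structure_scheme \<Rightarrow> 'a \<Rightarrow> ('a \<Rightarrow> real) \<Rightarrow> real" where
  "bidual_embedding E x = (\<lambda>\<phi>\<in>carrier (dual E). \<phi> x)"

definition reflexive :: "('a, 'm) normed_structure_scheme \<Rightarrow> bool" where
  "reflexive E \<longleftrightarrow> bidual_embedding E ` carrier E = carrier (dual (dual E))"

text \<open>The quotient of a subspace \<open>V\<close> by a closed subspace \<open>N \<subseteq> V\<close>: its points are the cosets of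
  \<open>N\<close> in \<open>V\<close>.  The summand from \<open>N\<close> in the scalar multiplication only matters for the scalar
  zero, where \<open>{c *\<^sub>R a | a. a \<in> A}\<close> would be \<open>{0}\<close> instead of \<open>N\<close>.\<close>

definition quotient_space ::
    "'a::real_normed_vector set \<Rightarrow> 'a set \<Rightarrow> 'a set normed_structure" where
  "quotient_space V N = \<lparr>
     carrier = {{z + n | n. n \<in> N} | z. z \<in> V},
     zero_of = N,
     add_of = (\<lambda>A B. {a + b | a b. a \<in> A \<and> b \<in> B}),
     scale_of = (\<lambda>c A. {c *\<^sub>R a + n | a n. a \<in> A \<and> n \<in> N}),
     norm_of = (\<lambda>A. INF a\<in>A. norm a) \<rparr>"

lemma quotient_space_coset_simps:
  assumes "subspace N"
  shows "add_of (quotient_space V N) {z + n | n. n \<in> N} {w + n | n. n \<in> N} =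
           {(z + w) + n | n. n \<in> N}"
    and "scale_of (quotient_space V N) c {z + n | n. n \<in> N} = {c *\<^sub>R z + n | n. n \<in> N}"
    and "zero_of (quotient_space V N) = {0 + n | n. n \<in> N}"
proof -
  show "add_of (quotient_space V N) {z + n | n. n \<in> N} {w + n | n. n \<in> N} =
          {(z + w) + n | n. n \<in> N}" (is "?L = ?R")
  proof
    show "?L \<subseteq> ?R"
    proof
      fix x assume "x \<in> ?L"
      then obtain m n where "m \<in> N" "n \<in> N" "x = (z + m) + (w + n)"
        by (auto simp: quotient_space_def)
      then have "x = (z + w) + (m + n)" "m + n \<in> N"
        using assms by (auto intro: subspace_add)
      then show "x \<in> ?R" by blast
    qed
    show "?R \<subseteq> ?L"
    proof
      fix x assume "x \<in> ?R"
      then obtain n where "n \<in> N" "x = (z + 0) + (w + n)" by auto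
      moreover have "0 \<in> N" using assms by (rule subspace_0)
      ultimately show "x \<in> ?L"
        by (simp only: quotient_space_def normed_structure.simps mem_Collect_eq) blast
    qed
  qed
  show "scale_of (quotient_space V N) c {z + n | n. n \<in> N} = {c *\<^sub>R z + n | n. n \<in> N}"
    (is "?L = ?R")
  proof
    show "?L \<subseteq> ?R"
    proof
      fix x assume "x \<in> ?L"
      then obtain m n where "m \<in> N" "n \<in> N" "x = c *\<^sub>R (z + m) + n"
        by (auto simp: quotient_space_def)
      then have "x = c *\<^sub>R z + (c *\<^sub>R m + n)" "c *\<^sub>R m + n \<in> N"
        using assms by (auto intro: subspace_add subspace_scale simp: scaleR_add_right)
      then show "x \<in> ?R" by blast
    qed
    show "?R \<subseteq> ?L"
    proof
      fix x assume "x \<in> ?R"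
      then obtain n where "n \<in> N" "x = c *\<^sub>R (z + 0) + n" by auto
      moreover have "0 \<in> N" using assms by (rule subspace_0)
      ultimately show "x \<in> ?L"
        by (simp only: quotient_space_def normed_structure.simps mem_Collect_eq) blast
    qed
  qed
qed (simp add: quotient_space_def)


section \<open>The Lipschitz-free space\<close>

lift_definition delta :: "int ^ 'd::finite \<Rightarrow> 'd lip0 \<Rightarrow>\<^sub>L real"
  is "\<lambda>v f. lip0_apply f v"
proof -
  fix v :: "int ^ 'd"
  show "bounded_linear (\<lambda>f. lip0_apply f v)"
    by (rule bounded_linear_intro[where K = "zdist v 0"])
       (use lip0_bound[of _ v 0] in auto)
qed

text \<open>The Arens--Eells space, realized as the closed linear span of the point evaluations in the
  dual of the space of Lipschitz functions.\<close>

definition lipschitz_free :: "('d::finite lip0 \<Rightarrow>\<^sub>L real) set" where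
  "lipschitz_free = closure (span (range delta))"

lemma delta_0: "delta 0 = 0"
  by (rule blinfun_eqI) (simp add: delta.rep_eq)

lemma delta_isometric: "norm (delta v - delta w) = zdist v w"
proof (rule antisym)
  show "norm (delta v - delta w) \<le> zdist v w"
    by (rule norm_blinfun_bound)
       (use lip0_bound[of _ v w] in \<open>auto simp: blinfun.diff_left delta.rep_eq mult.commute\<close>)
  define f where "f = (\<lambda>u. zdist u w - zdist 0 w)"
  have lip: "\<bar>f u - f u'\<bar> \<le> 1 * zdist u u'" for u u'
    using zdist_triangle[of u w u'] zdist_triangle[of u' w u] zdist_commute[of u u']
    by (simp add: f_def abs_le_iff)
  then have "f \<in> lip0_functions"
    by (intro lip0_functionsI[where C = 1]) (auto simp: f_def)
  then have ap: "lip0_apply (Lip0 f) = f" by (rule Lip0_inverse)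
  then have "norm (Lip0 f) \<le> 1" using lip by (intro lip0_norm_le) simp
  then have "norm (delta v - delta w) * norm (Lip0 f) \<le> norm (delta v - delta w)"
    by (intro mult_left_le) auto
  moreover have "blinfun_apply (delta v - delta w) (Lip0 f) = zdist v w"
    unfolding blinfun.diff_left delta.rep_eq ap by (simp add: f_def)
  ultimately show "zdist v w \<le> norm (delta v - delta w)"
    using norm_blinfun[of "delta v - delta w" "Lip0 f"] by simp
qed

definition preannihilator :: "'d::finite lip0 set \<Rightarrow> ('d lip0 \<Rightarrow>\<^sub>L real) set" where
  "preannihilator X = {z \<in> lipschitz_free. \<forall>f\<in>X. blinfun_apply z f = 0}"

definition lipschitz_free_quotient ::
    "'d::finite lip0 set \<Rightarrow> ('d lip0 \<Rightarrow>\<^sub>L real) set normed_structure" where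
  "lipschitz_free_quotient X = quotient_space lipschitz_free (preannihilator X)"

end

theory Submission
  imports Defs "HOL-Complex_Analysis.Complex_Analysis"
begin

text \<open>Let \<open>Y\<close> be the space of bounded complex functions on the lattice whose real and imaginary
  parts lie in \<open>X\<close> up to constants; it contains the differences \<open>f (x + h) - f x\<close> of every \<open>f \<in> X\<close>.
  Since \<open>X\<close> is closed under pointwise limits within the Lipschitz functions, membership in \<open>Y\<close> is
  decided by finitely supported annihilators, so the set \<open>E\<close> of unitary characters in \<open>Y\<close> is a real
  algebraic subset of the torus.

  If \<open>E\<close> is finite, then \<open>Y\<close> is spanned by the characters in \<open>E\<close>: every approximate eigenvalue
  of a coordinate shift is an eigenvalue, by translating approximate eigenvectors and passing to a
  pointwise limit, and writing a function as a sum of residues of its resolvent decomposes it into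
  eigenvectors.  Hence \<open>X\<close> is determined by its values on a finite set.

  If \<open>E\<close> is infinite, then it is uncountable, because a real algebraic set with infinitely many
  points contains a nonconstant analytic curve.  Uncountably many of its points are uniformly separated in the
  Lipschitz norm, so \<open>X\<close> is not separable.  Moreover, for a convergent sequence of distinct
  characters in \<open>E\<close>, the mean that extracts the Fourier coefficient at the limit character is a bounded
  functional on \<open>X\<close> that is not weak-star continuous, so the predual is not reflexive.\<close>

section \<open>Hilbert's basis theorem for rings of functions\<close>

text \<open>An infinite spectrum might a priori be a sequence converging to the trivial character. A
  step along axis \<open>i\<close> changes the character of \<open>z\<close> by the factor
  \<open>z $ i\<close>, so near the trivial one the characters, as members of \<open>X\<close>, have
  small Lipschitz norm, and neither separation nor means yield anything. Uncountability excludes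
  this: uncountably many points then satisfy \<open>c \<le> cmod (z $ i - 1)\<close> for one
  \<open>i\<close> and one \<open>c > 0\<close>. The separation is proportional to \<open>c\<close>,
  and the mean takes the value \<open>w $ i - 1\<close> at a limit point \<open>w\<close> of that
  slice. The analytic curve is found without dimension theory. The chain condition yields an
  infinite set \<open>F\<close> of points of the algebraic set whose vanishing ideal is prime. A
  polynomial vector field that preserves this ideal and moves a coordinate taking infinitely many
  values on \<open>F\<close> is built coordinate by coordinate, and its flow through a point of
  \<open>F\<close> satisfies all the equations, since their iterated derivatives vanish at that
  point. \<open>F\<close> may be countable and far from algebraic; it enters only through its
  ideal.\<close>

definition function_ring :: "('a \<Rightarrow> real) set \<Rightarrow> bool" where
  "function_ring A \<longleftrightarrow> (\<forall>c. (\<lambda>_. c) \<in> A) \<and>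
     (\<forall>f\<in>A. \<forall>g\<in>A. (\<lambda>p. f p + g p) \<in> A \<and> (\<lambda>p. f p * g p) \<in> A)"

definition function_ideal :: "('a \<Rightarrow> real) set \<Rightarrow> ('a \<Rightarrow> real) set \<Rightarrow> bool" where
  "function_ideal A I \<longleftrightarrow> I \<subseteq> A \<and> (\<lambda>_. 0) \<in> I \<and>
     (\<forall>f\<in>I. \<forall>g\<in>I. (\<lambda>p. f p + g p) \<in> I) \<and> (\<forall>a\<in>A. \<forall>f\<in>I. (\<lambda>p. a p * f p) \<in> I)"

text \<open>The Noetherian property, stated by chains so that the stages at which several chains
  settle can be compared.\<close>

definition ideal_acc :: "('a \<Rightarrow> real) set \<Rightarrow> bool" where
  "ideal_acc A \<longleftrightarrow> (\<forall>I :: nat \<Rightarrow> _. (\<forall>n. function_ideal A (I n)) \<longrightarrow> (\<forall>n. I n \<subseteq> I (Suc n)) \<longrightarrow>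
     (\<exists>N. \<forall>n\<ge>N. I n = I N))"

text \<open>Elements that are polynomials in \<open>x\<close> of degree less than \<open>n\<close> with coefficients in \<open>A\<close>.  Since \<open>x\<close>
  may be algebraic over \<open>A\<close>, the coefficients need not be unique.\<close>

fun adjoin_below :: "('a \<Rightarrow> real) set \<Rightarrow> ('a \<Rightarrow> real) \<Rightarrow> nat \<Rightarrow> ('a \<Rightarrow> real) set" where
  "adjoin_below A x 0 = {\<lambda>_. 0}"
| "adjoin_below A x (Suc n) = {\<lambda>p. g p + a p * x p ^ n | g a. g \<in> adjoin_below A x n \<and> a \<in> A}"

definition adjoin :: "('a \<Rightarrow> real) set \<Rightarrow> ('a \<Rightarrow> real) \<Rightarrow> ('a \<Rightarrow> real) set" where
  "adjoin A x = (\<Union>n. adjoin_below A x n)"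

lemma function_ring_const: "function_ring A \<Longrightarrow> (\<lambda>_. c) \<in> A"
  and function_ring_add: "function_ring A \<Longrightarrow> f \<in> A \<Longrightarrow> g \<in> A \<Longrightarrow> (\<lambda>p. f p + g p) \<in> A"
  and function_ring_mult: "function_ring A \<Longrightarrow> f \<in> A \<Longrightarrow> g \<in> A \<Longrightarrow> (\<lambda>p. f p * g p) \<in> A"
  by (simp_all add: function_ring_def)

lemma function_ring_diff:
  "function_ring A \<Longrightarrow> f \<in> A \<Longrightarrow> g \<in> A \<Longrightarrow> (\<lambda>p. f p - g p) \<in> A"
  using function_ring_add[of A f "\<lambda>p. (-1) * g p"] function_ring_mult[of A "\<lambda>_. -1" g]
    function_ring_const[of A "-1"] by simp

lemma function_idealD:
  assumes "function_ideal A I"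
  shows "f \<in> I \<Longrightarrow> f \<in> A" "(\<lambda>_. 0) \<in> I"
    "f \<in> I \<Longrightarrow> g \<in> I \<Longrightarrow> (\<lambda>p. f p + g p) \<in> I"
    "a \<in> A \<Longrightarrow> f \<in> I \<Longrightarrow> (\<lambda>p. a p * f p) \<in> I"
  using assms by (auto simp: function_ideal_def)

lemma function_ideal_diff:
  "function_ring A \<Longrightarrow> function_ideal A I \<Longrightarrow> f \<in> I \<Longrightarrow> g \<in> I \<Longrightarrow> (\<lambda>p. f p - g p) \<in> I"
  using function_idealD(3)[of A I f "\<lambda>p. (-1) * g p"] function_idealD(4)[of A I "\<lambda>_. -1" g]
    function_ring_const[of A "-1"] by simp

lemma adjoin_below_SucI:
  "g \<in> adjoin_below A x n \<Longrightarrow> a \<in> A \<Longrightarrow> (\<lambda>p. g p + a p * x p ^ n) \<in> adjoin_below A x (Suc n)"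
  by auto

lemma adjoin_below_SucE:
  assumes "f \<in> adjoin_below A x (Suc n)"
  obtains g a where "g \<in> adjoin_below A x n" "a \<in> A" "f = (\<lambda>p. g p + a p * x p ^ n)"
  using assms by auto

lemma adjoin_below_mono:
  assumes A: "(\<lambda>_. 0) \<in> A" and "m \<le> n" "f \<in> adjoin_below A x m"
  shows "f \<in> adjoin_below A x n"
  using assms(2,3)
proof (induction rule: dec_induct)
  case (step k)
  from adjoin_below_SucI[OF step.IH[OF step.prems] A] show ?case by simp
qed

context
  fixes A :: "('a \<Rightarrow> real) set" and x :: "'a \<Rightarrow> real"
  assumes A: "function_ring A"
begin

lemma adjoin_below_le: "m \<le> n \<Longrightarrow> f \<in> adjoin_below A x m \<Longrightarrow> f \<in> adjoin_below A x n"
  by (rule adjoin_below_mono[OF function_ring_const[OF A]])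

lemma adjoin_below_zero: "(\<lambda>_. 0) \<in> adjoin_below A x n"
  by (rule adjoin_below_le[of 0]) auto

lemma adjoin_below_add:
  "f \<in> adjoin_below A x n \<Longrightarrow> g \<in> adjoin_below A x n \<Longrightarrow> (\<lambda>p. f p + g p) \<in> adjoin_below A x n"
proof (induction n arbitrary: f g)
  case (Suc n)
  obtain f1 a where f: "f1 \<in> adjoin_below A x n" "a \<in> A" "f = (\<lambda>p. f1 p + a p * x p ^ n)"
    using Suc.prems(1) by (rule adjoin_below_SucE)
  obtain g1 b where g: "g1 \<in> adjoin_below A x n" "b \<in> A" "g = (\<lambda>p. g1 p + b p * x p ^ n)"
    using Suc.prems(2) by (rule adjoin_below_SucE)
  have "(\<lambda>p. (f1 p + g1 p) + (a p + b p) * x p ^ n) \<in> adjoin_below A x (Suc n)"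
    using f g Suc.IH function_ring_add[OF A] by (intro adjoin_below_SucI) auto
  then show ?case by (simp add: f g algebra_simps)
qed auto

lemma adjoin_below_scale:
  "c \<in> A \<Longrightarrow> f \<in> adjoin_below A x n \<Longrightarrow> (\<lambda>p. c p * f p) \<in> adjoin_below A x n"
proof (induction n arbitrary: f)
  case (Suc n)
  obtain f1 a where f: "f1 \<in> adjoin_below A x n" "a \<in> A" "f = (\<lambda>p. f1 p + a p * x p ^ n)"
    using Suc.prems(2) by (rule adjoin_below_SucE)
  have "(\<lambda>p. (c p * f1 p) + (c p * a p) * x p ^ n) \<in> adjoin_below A x (Suc n)"
    using f Suc function_ring_mult[OF A] by (intro adjoin_below_SucI) auto
  then show ?case by (simp add: f algebra_simps)
qed auto

lemma adjoin_below_diff: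
  "f \<in> adjoin_below A x n \<Longrightarrow> g \<in> adjoin_below A x n \<Longrightarrow> (\<lambda>p. f p - g p) \<in> adjoin_below A x n"
  using adjoin_below_add[of f n "\<lambda>p. (-1) * g p"] adjoin_below_scale[of "\<lambda>_. -1" g n]
    function_ring_const[OF A, of "-1"] by simp

lemma adjoin_below_shift:
  "f \<in> adjoin_below A x n \<Longrightarrow> (\<lambda>p. x p ^ k * f p) \<in> adjoin_below A x (n + k)"
proof (induction n arbitrary: f)
  case 0
  then show ?case using adjoin_below_zero by simp
next
  case (Suc n)
  obtain f1 a where f: "f1 \<in> adjoin_below A x n" "a \<in> A" "f = (\<lambda>p. f1 p + a p * x p ^ n)"
    using Suc.prems(1) by (rule adjoin_below_SucE)
  have "(\<lambda>p. (x p ^ k * f1 p) + a p * x p ^ (n + k)) \<in> adjoin_below A x (Suc (n + k))"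
    using f Suc by (intro adjoin_below_SucI) auto
  then show ?case by (simp add: f algebra_simps power_add)
qed

lemma adjoin_below_1: "a \<in> A \<Longrightarrow> a \<in> adjoin_below A x 1"
  by (auto intro!: exI[of _ a])

lemma adjoin_add:
  assumes "f \<in> adjoin A x" "g \<in> adjoin A x"
  shows "(\<lambda>p. f p + g p) \<in> adjoin A x"
proof -
  obtain m n where "f \<in> adjoin_below A x m" "g \<in> adjoin_below A x n"
    using assms by (auto simp: adjoin_def)
  then have "f \<in> adjoin_below A x (max m n)" "g \<in> adjoin_below A x (max m n)"
    by (auto intro: adjoin_below_le[rotated])
  then show ?thesis using adjoin_below_add by (auto simp: adjoin_def)
qed

lemma adjoin_scale: "c \<in> A \<Longrightarrow> f \<in> adjoin A x \<Longrightarrow> (\<lambda>p. c p * f p) \<in> adjoin A x"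
  using adjoin_below_scale by (auto simp: adjoin_def)

lemma adjoin_shift: "f \<in> adjoin A x \<Longrightarrow> (\<lambda>p. x p ^ k * f p) \<in> adjoin A x"
  using adjoin_below_shift by (auto simp: adjoin_def)

lemma adjoin_base: "a \<in> A \<Longrightarrow> a \<in> adjoin A x"
  using adjoin_below_1 unfolding adjoin_def by blast

lemma adjoin_generator: "x \<in> adjoin A x"
  using adjoin_shift[OF adjoin_base[OF function_ring_const[OF A, of 1]], of 1] by simp

lemma adjoin_mult:
  assumes "f \<in> adjoin A x" "g \<in> adjoin A x"
  shows "(\<lambda>p. f p * g p) \<in> adjoin A x"
proof -
  obtain n where "f \<in> adjoin_below A x n" using assms by (auto simp: adjoin_def)
  then show ?thesis
  proof (induction n arbitrary: f)
    case 0
    then show ?case using adjoin_base[OF function_ring_const[OF A, of 0]] by simp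
  next
    case (Suc n)
    obtain f1 a where f: "f1 \<in> adjoin_below A x n" "a \<in> A" "f = (\<lambda>p. f1 p + a p * x p ^ n)"
      using Suc.prems(1) by (rule adjoin_below_SucE)
    have "(\<lambda>p. f1 p * g p + a p * (x p ^ n * g p)) \<in> adjoin A x"
      by (intro adjoin_add adjoin_scale adjoin_shift Suc.IH f assms)
    then show ?case by (simp add: f algebra_simps)
  qed
qed

lemma function_ring_adjoin: "function_ring (adjoin A x)"
  unfolding function_ring_def
  using adjoin_add adjoin_mult adjoin_base[OF function_ring_const[OF A]] by blast

text \<open>A function may have several expansions in \<open>x\<close>, so a leading coefficient
  belongs to an expansion and not to the function. Admitting the coefficient of degree
  \<open>m\<close> of any expansion of a member of \<open>I\<close>, zero included, makes the set an
  ideal.\<close>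

definition lead_ideal :: "('a \<Rightarrow> real) set \<Rightarrow> nat \<Rightarrow> ('a \<Rightarrow> real) set" where
  "lead_ideal I m = {a \<in> A. \<exists>g\<in>adjoin_below A x m. (\<lambda>p. g p + a p * x p ^ m) \<in> I}"

lemma function_ideal_lead_ideal:
  assumes I: "function_ideal (adjoin A x) I"
  shows "function_ideal A (lead_ideal I m)"
  unfolding function_ideal_def
proof (intro conjI ballI)
  show "lead_ideal I m \<subseteq> A" by (auto simp: lead_ideal_def)
  show "(\<lambda>_. 0) \<in> lead_ideal I m"
    using function_ring_const[OF A] adjoin_below_zero function_idealD(2)[OF I]
    by (auto simp: lead_ideal_def intro!: bexI[of _ "\<lambda>_. 0"])
next
  fix f g assume "f \<in> lead_ideal I m" "g \<in> lead_ideal I m"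
  then obtain f1 g1 where fg: "f \<in> A" "f1 \<in> adjoin_below A x m" "(\<lambda>p. f1 p + f p * x p ^ m) \<in> I"
    "g \<in> A" "g1 \<in> adjoin_below A x m" "(\<lambda>p. g1 p + g p * x p ^ m) \<in> I"
    by (auto simp: lead_ideal_def)
  have "(\<lambda>p. (f1 p + g1 p) + (f p + g p) * x p ^ m) \<in> I"
    using function_idealD(3)[OF I fg(3,6)] by (simp add: algebra_simps)
  then show "(\<lambda>p. f p + g p) \<in> lead_ideal I m"
    unfolding lead_ideal_def using fg function_ring_add[OF A] adjoin_below_add
    by (intro CollectI conjI bexI[of _ "\<lambda>p. f1 p + g1 p"]) auto
next
  fix a f assume a: "a \<in> A" and "f \<in> lead_ideal I m"
  then obtain f1 where f: "f \<in> A" "f1 \<in> adjoin_below A x m" "(\<lambda>p. f1 p + f p * x p ^ m) \<in> I"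
    by (auto simp: lead_ideal_def)
  have "(\<lambda>p. a p * f1 p + (a p * f p) * x p ^ m) \<in> I"
    using function_idealD(4)[OF I adjoin_base[OF a] f(3)] by (simp add: algebra_simps)
  then show "(\<lambda>p. a p * f p) \<in> lead_ideal I m"
    unfolding lead_ideal_def using f a function_ring_mult[OF A] adjoin_below_scale
    by (intro CollectI conjI bexI[of _ "\<lambda>p. a p * f1 p"]) auto
qed

lemma lead_ideal_mono: "I \<subseteq> I' \<Longrightarrow> lead_ideal I m \<subseteq> lead_ideal I' m"
  by (auto simp: lead_ideal_def)

lemma lead_ideal_Suc:
  assumes I: "function_ideal (adjoin A x) I"
  shows "lead_ideal I m \<subseteq> lead_ideal I (Suc m)"
proof
  fix f assume "f \<in> lead_ideal I m"
  then obtain f1 where f: "f \<in> A" "f1 \<in> adjoin_below A x m" "(\<lambda>p. f1 p + f p * x p ^ m) \<in> I"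
    by (auto simp: lead_ideal_def)
  have "(\<lambda>p. x p * f1 p + f p * x p ^ Suc m) \<in> I"
    using function_idealD(4)[OF I adjoin_generator f(3)] by (simp add: algebra_simps)
  moreover have "(\<lambda>p. x p * f1 p) \<in> adjoin_below A x (Suc m)"
    using adjoin_below_shift[OF f(2), of 1] by simp
  ultimately show "f \<in> lead_ideal I (Suc m)"
    unfolding lead_ideal_def using f(1) by auto
qed

text \<open>Induction on the degree bound: from a member of \<open>I'\<close> subtract a member of
  \<open>I\<close> with the same top coefficient. The difference is still in \<open>I'\<close> and
  has a smaller degree bound.\<close>

lemma lead_ideal_eq_imp_eq:
  assumes I: "function_ideal (adjoin A x) I" and I': "function_ideal (adjoin A x) I'"
    and "I \<subseteq> I'" and lead: "\<And>m. lead_ideal I m = lead_ideal I' m"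
  shows "I = I'"
proof -
  have "f \<in> I" if "f \<in> I'" "f \<in> adjoin_below A x n" for f n
    using that
  proof (induction n arbitrary: f)
    case 0
    then show ?case using function_idealD(2)[OF I] by simp
  next
    case (Suc n)
    obtain f1 a where f: "f1 \<in> adjoin_below A x n" "a \<in> A" "f = (\<lambda>p. f1 p + a p * x p ^ n)"
      using Suc.prems(2) by (rule adjoin_below_SucE)
    have "a \<in> lead_ideal I n"
      using f Suc.prems(1) unfolding lead by (auto simp: lead_ideal_def)
    then obtain g where g: "g \<in> adjoin_below A x n" "(\<lambda>p. g p + a p * x p ^ n) \<in> I"
      by (auto simp: lead_ideal_def)
    have "(\<lambda>p. f p - (g p + a p * x p ^ n)) \<in> I'"
      using function_ideal_diff[OF function_ring_adjoin I' Suc.prems(1)] g(2) \<open>I \<subseteq> I'\<close> by blast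
    moreover have eq: "(\<lambda>p. f p - (g p + a p * x p ^ n)) = (\<lambda>p. f1 p - g p)"
      by (simp add: f)
    ultimately have "(\<lambda>p. f p - (g p + a p * x p ^ n)) \<in> I"
      unfolding eq using Suc.IH adjoin_below_diff[OF f(1) g(1)] by simp
    from function_idealD(3)[OF I this g(2)] show ?case by simp
  qed
  then show ?thesis
    using \<open>I \<subseteq> I'\<close> function_idealD(1)[OF I'] unfolding adjoin_def by blast
qed

text \<open>Leading ideals grow in both the stage and the degree. The diagonal chain settles at some
  \<open>N\<close>, which controls all degrees above \<open>N\<close>; the finitely many degrees up
  to \<open>N\<close> settle one by one, and \<open>K\<close> is late enough for all of
  them.\<close>

theorem ideal_acc_adjoin:
  assumes acc: "ideal_acc A"
  shows "ideal_acc (adjoin A x)"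
  unfolding ideal_acc_def
proof (intro allI impI)
  fix I :: "nat \<Rightarrow> ('a \<Rightarrow> real) set"
  assume I: "\<forall>n. function_ideal (adjoin A x) (I n)" and inc: "\<forall>n. I n \<subseteq> I (Suc n)"
  have I_mono: "m \<le> n \<Longrightarrow> I m \<subseteq> I n" for m n
    by (rule lift_Suc_mono_le[of I]) (use inc in auto)
  have lead_mono: "lead_ideal (I n) m \<subseteq> lead_ideal (I n') m'" if "n \<le> n'" "m \<le> m'" for n n' m m'
  proof -
    have "lead_ideal (I n) m \<subseteq> lead_ideal (I n) m'"
      by (rule lift_Suc_mono_le[of "lead_ideal (I n)"]) (use lead_ideal_Suc I that in auto)
    then show ?thesis using lead_ideal_mono[OF I_mono[OF that(1)]] by blast
  qed
  have "\<exists>N. \<forall>n\<ge>N. lead_ideal (I n) n = lead_ideal (I N) N"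
    using acc[unfolded ideal_acc_def, rule_format, of "\<lambda>n. lead_ideal (I n) n"]
      function_ideal_lead_ideal I lead_mono by simp
  then obtain N where N: "\<And>n. n \<ge> N \<Longrightarrow> lead_ideal (I n) n = lead_ideal (I N) N" by blast
  have "\<exists>M. \<forall>n\<ge>M. lead_ideal (I n) m = lead_ideal (I M) m" for m
    using acc[unfolded ideal_acc_def, rule_format, of "\<lambda>n. lead_ideal (I n) m"]
      function_ideal_lead_ideal I lead_mono by simp
  then obtain M where M: "\<And>m n. n \<ge> M m \<Longrightarrow> lead_ideal (I n) m = lead_ideal (I (M m)) m" by metis
  define K where "K = Max (insert N (M ` {..N}))"
  have K: "K \<ge> N" "m \<le> N \<Longrightarrow> K \<ge> M m" for m
    unfolding K_def by (rule Max_ge; simp)+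
  have "I n = I K" if "n \<ge> K" for n
  proof (rule lead_ideal_eq_imp_eq[symmetric])
    fix m
    show "lead_ideal (I K) m = lead_ideal (I n) m"
    proof (cases "m \<le> N")
      case True
      then show ?thesis using M[of m n] M[of m K] K that by (metis order_trans)
    next
      case False
      \<comment> \<open>Beyond degree \<open>N\<close> the leading ideals are squeezed between two
        equal members of the diagonal chain, those at \<open>N\<close> and at
        \<open>max m n\<close>.\<close>
      have "lead_ideal (I n) m \<subseteq> lead_ideal (I (max m n)) (max m n)"
        by (rule lead_mono) auto
      also have "\<dots> = lead_ideal (I N) N"
        using that K by (intro N) auto
      also have "\<dots> \<subseteq> lead_ideal (I K) m"
        using K False by (intro lead_mono) auto
      finally show ?thesis using lead_ideal_mono[OF I_mono[OF that]] by blast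
    qed
  qed (use I I_mono that in auto)
  then show "\<exists>N. \<forall>n\<ge>N. I n = I N" by blast
qed

end

section \<open>Polynomial functions in selected coordinates\<close>

inductive polynomial_in :: "'a::euclidean_space set \<Rightarrow> ('a \<Rightarrow> real) \<Rightarrow> bool" for S where
  const: "polynomial_in S (\<lambda>_. c)"
| coord: "b \<in> S \<Longrightarrow> polynomial_in S (\<lambda>p. p \<bullet> b)"
| add: "polynomial_in S f \<Longrightarrow> polynomial_in S g \<Longrightarrow> polynomial_in S (\<lambda>p. f p + g p)"
| mult: "polynomial_in S f \<Longrightarrow> polynomial_in S g \<Longrightarrow> polynomial_in S (\<lambda>p. f p * g p)"

lemma function_ring_polynomial_in: "function_ring (Collect (polynomial_in S))"
  by (auto simp: function_ring_def intro: polynomial_in.intros)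

lemma polynomial_in_mono: "polynomial_in S f \<Longrightarrow> S \<subseteq> S' \<Longrightarrow> polynomial_in S' f"
  by (induction rule: polynomial_in.induct) (auto intro: polynomial_in.intros)

lemma polynomial_in_diff:
  "polynomial_in S f \<Longrightarrow> polynomial_in S g \<Longrightarrow> polynomial_in S (\<lambda>p. f p - g p)"
  using function_ring_diff[OF function_ring_polynomial_in] by blast

lemma polynomial_in_power: "polynomial_in S f \<Longrightarrow> polynomial_in S (\<lambda>p. f p ^ n)"
  by (induction n) (auto intro: polynomial_in.intros)

lemma polynomial_in_sum:
  "(\<And>i. i \<in> I \<Longrightarrow> polynomial_in S (f i)) \<Longrightarrow> polynomial_in S (\<lambda>p. \<Sum>i\<in>I. f i p)"
  by (induction I rule: infinite_finite_induct) (auto intro: polynomial_in.intros)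

text \<open>Admitting one more coordinate is adjoining one element, so that both the basis theorem
  and the construction of tangent fields can proceed one coordinate at a time.\<close>

lemma polynomial_in_insert:
  "Collect (polynomial_in (insert b S)) = adjoin (Collect (polynomial_in S)) (\<lambda>p. p \<bullet> b)"
proof (intro equalityI subsetI)
  fix f assume "f \<in> Collect (polynomial_in (insert b S))"
  then have "polynomial_in (insert b S) f" by simp
  then show "f \<in> adjoin (Collect (polynomial_in S)) (\<lambda>p. p \<bullet> b)"
  proof (induction rule: polynomial_in.induct)
    case (coord b')
    then show ?case
      using adjoin_generator[OF function_ring_polynomial_in[of S], of "\<lambda>p. p \<bullet> b"]
        adjoin_base[OF function_ring_polynomial_in[of S], of "\<lambda>p. p \<bullet> b'"]
      by (auto intro: polynomial_in.intros)
  next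
    case (const c)
    then show ?case
      by (auto intro: polynomial_in.intros adjoin_base[OF function_ring_polynomial_in])
  qed (auto intro: adjoin_add adjoin_mult function_ring_polynomial_in)
next
  fix f assume "f \<in> adjoin (Collect (polynomial_in S)) (\<lambda>p. p \<bullet> b)"
  then obtain n where "f \<in> adjoin_below (Collect (polynomial_in S)) (\<lambda>p. p \<bullet> b) n"
    by (auto simp: adjoin_def)
  then show "f \<in> Collect (polynomial_in (insert b S))"
  proof (induction n arbitrary: f)
    case (Suc n)
    then show ?case
      by (auto intro!: polynomial_in.add polynomial_in.mult polynomial_in_power polynomial_in.coord
          intro: polynomial_in_mono)
  qed (auto intro: polynomial_in.const)
qed

text \<open>The constants form a field: a nonzero member generates everything, so a chain of ideals
  can grow only once.\<close>

lemma ideal_acc_constants: "ideal_acc (range (\<lambda>c _. c))"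
  unfolding ideal_acc_def
proof (intro allI impI)
  fix I :: "nat \<Rightarrow> ('a \<Rightarrow> real) set"
  assume I: "\<forall>n. function_ideal (range (\<lambda>c _. c)) (I n)" and inc: "\<forall>n. I n \<subseteq> I (Suc n)"
  have mono: "m \<le> n \<Longrightarrow> I m \<subseteq> I n" for m n
    by (rule lift_Suc_mono_le[of I]) (use inc in auto)
  have full: "I n = range (\<lambda>c _. c)" if c: "(\<lambda>_. c) \<in> I n" "c \<noteq> 0" for n c
  proof -
    have In: "function_ideal (range (\<lambda>c _. c)) (I n)" using I by blast
    have "(\<lambda>_. e) \<in> I n" for e
      using function_idealD(4)[OF In _ c(1), of "\<lambda>_. e / c"] c(2) by simp
    then show ?thesis using function_idealD(1)[OF In] by blast
  qed
  show "\<exists>N. \<forall>n\<ge>N. I n = I N"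
  proof (cases "\<exists>N c. (\<lambda>_. c) \<in> I N \<and> c \<noteq> 0")
    case True
    then obtain N c where c: "(\<lambda>_. c) \<in> I N" "c \<noteq> 0" by blast
    have "I n = I N" if "n \<ge> N" for n
      using full[OF c] full[OF _ c(2), of n] mono[OF that] c(1) by blast
    then show ?thesis by blast
  next
    case False
    have "I n = {\<lambda>_. 0}" for n
    proof -
      have In: "function_ideal (range (\<lambda>c _. c)) (I n)" using I by blast
      have "f = (\<lambda>_. 0)" if "f \<in> I n" for f
      proof -
        have "f \<in> range (\<lambda>c _. c)" using In that by (rule function_idealD(1))
        then show ?thesis using False that by blast
      qed
      then show ?thesis using function_idealD(2)[OF In] by blast
    qed
    then show ?thesis by simp
  qed
qed

theorem ideal_acc_polynomials: "finite S \<Longrightarrow> ideal_acc (Collect (polynomial_in S))"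
proof (induction rule: finite_induct)
  case empty
  have "polynomial_in {} f \<Longrightarrow> \<exists>c. f = (\<lambda>_. c)" for f :: "'a \<Rightarrow> real"
    by (induction rule: polynomial_in.induct) auto
  then have "Collect (polynomial_in ({} :: 'a set)) = range (\<lambda>c _. c)"
    by (auto intro: polynomial_in.const)
  then show ?case using ideal_acc_constants by simp
next
  case (insert b S)
  then show ?case
    unfolding polynomial_in_insert by (intro ideal_acc_adjoin function_ring_polynomial_in)
qed

section \<open>Vector fields tangent to an irreducible set\<close>

text \<open>Differentiating the function itself makes the product rule available without choosing a
  representation as a polynomial.\<close>

definition deriv_along :: "('a \<Rightarrow> 'a::euclidean_space) \<Rightarrow> ('a \<Rightarrow> real) \<Rightarrow> 'a \<Rightarrow> real" where
  "deriv_along v f p = frechet_derivative f (at p) (v p)"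

lemma polynomial_in_differentiable: "polynomial_in S f \<Longrightarrow> f differentiable (at p)"
proof (induction rule: polynomial_in.induct)
  case (coord b)
  have "bounded_linear (\<lambda>p. p \<bullet> b)" by (rule bounded_linear_inner_left)
  then show ?case by (rule bounded_linear_imp_differentiable)
qed auto

lemma deriv_along_eq: "(f has_derivative f') (at p) \<Longrightarrow> deriv_along v f p = f' (v p)"
  unfolding deriv_along_def by (metis frechet_derivative_at)

lemma polynomial_in_has_derivative:
  "polynomial_in S f \<Longrightarrow> (f has_derivative frechet_derivative f (at p)) (at p)"
  using polynomial_in_differentiable frechet_derivative_works by blast

lemma deriv_along_const: "deriv_along v (\<lambda>_. c) = (\<lambda>_. 0)"
  by (rule ext, subst deriv_along_eq[OF has_derivative_const]) simp

lemma deriv_along_coord: "deriv_along v (\<lambda>p. p \<bullet> b) = (\<lambda>p. v p \<bullet> b)"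
proof
  fix p
  have "((\<lambda>p. p \<bullet> b) has_derivative (\<lambda>h. h \<bullet> b)) (at p)"
    by (auto intro!: derivative_eq_intros)
  from deriv_along_eq[OF this] show "deriv_along v (\<lambda>p. p \<bullet> b) p = v p \<bullet> b" .
qed

lemma deriv_along_add:
  assumes "polynomial_in S f" "polynomial_in S g"
  shows "deriv_along v (\<lambda>p. f p + g p) = (\<lambda>p. deriv_along v f p + deriv_along v g p)"
proof
  fix p
  show "deriv_along v (\<lambda>p. f p + g p) p = deriv_along v f p + deriv_along v g p"
    by (subst deriv_along_eq[OF has_derivative_add[OF assms[THEN polynomial_in_has_derivative]]])
       (simp add: deriv_along_def)
qed

lemma deriv_along_mult:
  assumes "polynomial_in S f" "polynomial_in S g"
  shows "deriv_along v (\<lambda>p. f p * g p) = (\<lambda>p. deriv_along v f p * g p + f p * deriv_along v g p)"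
proof
  fix p
  show "deriv_along v (\<lambda>p. f p * g p) p = deriv_along v f p * g p + f p * deriv_along v g p"
    by (subst deriv_along_eq[OF has_derivative_mult[OF assms[THEN polynomial_in_has_derivative]]])
       (simp add: deriv_along_def)
qed

lemma deriv_along_lincomb:
  assumes f: "polynomial_in S f"
  shows "deriv_along (\<lambda>p. c p *\<^sub>R v p - e p *\<^sub>R w p) f p = c p * deriv_along v f p - e p * deriv_along w f p"
proof -
  have "bounded_linear (frechet_derivative f (at p))"
    using polynomial_in_has_derivative[OF f] has_derivative_bounded_linear by blast
  then interpret bounded_linear "frechet_derivative f (at p)" .
  show ?thesis by (simp add: deriv_along_def diff scaleR)
qed

lemma deriv_along_power:
  assumes "polynomial_in S f"
  shows "deriv_along v (\<lambda>p. f p ^ n) = (\<lambda>p. of_nat n * f p ^ (n - 1) * deriv_along v f p)"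
proof (induction n)
  case 0
  then show ?case by (simp add: deriv_along_const)
next
  case (Suc n)
  have "deriv_along v (\<lambda>p. f p * f p ^ n) p = of_nat (Suc n) * f p ^ n * deriv_along v f p" for p
    unfolding deriv_along_mult[OF assms polynomial_in_power[OF assms]] Suc
    by (cases n) (simp_all add: algebra_simps)
  then show ?case by (simp add: fun_eq_iff)
qed

definition polynomial_field :: "('a \<Rightarrow> 'a::euclidean_space) \<Rightarrow> bool" where
  "polynomial_field v \<longleftrightarrow> (\<forall>b\<in>Basis. polynomial_in Basis (\<lambda>p. v p \<bullet> b))"

lemma polynomial_in_deriv_along:
  assumes "polynomial_in Basis f" and v: "polynomial_field v"
  shows "polynomial_in Basis (deriv_along v f)"
  using assms(1)
proof (induction rule: polynomial_in.induct)
  case (const c)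
  then show ?case by (simp add: deriv_along_const polynomial_in.const)
next
  case (coord b)
  then show ?case using v by (simp add: deriv_along_coord polynomial_field_def)
qed (auto simp: deriv_along_add deriv_along_mult intro: polynomial_in.intros)

lemma polynomial_field_lincomb:
  assumes "polynomial_in Basis c" "polynomial_field v" "polynomial_in Basis e" "polynomial_field w"
  shows "polynomial_field (\<lambda>p. c p *\<^sub>R v p - e p *\<^sub>R w p)"
  using assms unfolding polynomial_field_def
  by (auto simp: inner_diff_left intro!: polynomial_in_diff polynomial_in.mult)

lemma polynomial_field_const: "polynomial_field (\<lambda>_. u)"
  by (auto simp: polynomial_field_def intro: polynomial_in.const)

lemma deriv_along_other_coordinate:
  assumes "polynomial_in S f" "S \<subseteq> Basis" "b \<in> Basis - S"
  shows "deriv_along (\<lambda>_. b) f = (\<lambda>_. 0)"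
  using assms(1)
proof (induction rule: polynomial_in.induct)
  case (coord b')
  then show ?case using assms(2,3) by (auto simp: deriv_along_coord inner_Basis)
qed (auto simp: deriv_along_const deriv_along_add deriv_along_mult)

definition vanishes :: "'a set \<Rightarrow> ('a \<Rightarrow> real) \<Rightarrow> bool" where
  "vanishes F f \<longleftrightarrow> (\<forall>p\<in>F. f p = 0)"

text \<open>The primeness condition for the ideal of polynomials vanishing on \<open>F\<close>,
  where \<open>F\<close> is an arbitrary set of points. The empty set qualifies, so nonemptiness is
  assumed separately below.\<close>

definition irreducible_set :: "'a::euclidean_space set \<Rightarrow> bool" where
  "irreducible_set F \<longleftrightarrow> (\<forall>f g. polynomial_in Basis f \<longrightarrow> polynomial_in Basis g \<longrightarrow>
     vanishes F (\<lambda>p. f p * g p) \<longrightarrow> vanishes F f \<or> vanishes F g)"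

text \<open>If some relation on \<open>F\<close> involves the coordinate \<open>b\<close>, take one, \<open>G\<close>, of least degree in \<open>b\<close>.  The
  field \<open>c v - e b\<close> is chosen to annihilate \<open>G\<close>, with \<open>c\<close> the partial derivative of \<open>G\<close>.  Pseudo-division
  by \<open>G\<close> reduces every other relation to one whose coefficients as a polynomial in \<open>b\<close> vanish on \<open>F\<close>.\<close>

lemma tangent_field_step:
  fixes F :: "'a::euclidean_space set"
  assumes irr: "irreducible_set F" and F: "F \<noteq> {}"
    and S: "S \<subseteq> Basis" and b: "b \<in> Basis - S"
    and v: "polynomial_field v" and v_tan: "\<And>f. polynomial_in S f \<Longrightarrow> vanishes F f \<Longrightarrow> vanishes F (deriv_along v f)"
  obtains c e where "polynomial_in Basis c" "polynomial_in Basis e" "\<not> vanishes F c"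
    "\<And>f. polynomial_in (insert b S) f \<Longrightarrow> vanishes F f \<Longrightarrow>
        vanishes F (deriv_along (\<lambda>p. c p *\<^sub>R v p - e p *\<^sub>R b) f)"
proof -
  define A where "A = Collect (polynomial_in S)"
  define x where "x = (\<lambda>p :: 'a. p \<bullet> b)"
  define J where "J = A \<inter> Collect (vanishes F)"
  \<comment> \<open>\<open>w\<close> is \<open>v\<close> without its \<open>b\<close>-component, so
    \<open>x\<close> is constant along \<open>w\<close>, while the coefficients in \<open>A\<close>
    are constant along \<open>b\<close>. The two derivatives thus act separately on coefficients and
    on powers of \<open>x\<close>.\<close>
  define w where "w = (\<lambda>p. 1 *\<^sub>R v p - (v p \<bullet> b) *\<^sub>R b)"
  let ?Db = "deriv_along (\<lambda>_. b)" and ?Dw = "deriv_along w"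
  have A: "function_ring A" unfolding A_def by (rule function_ring_polynomial_in)
  have A_poly: "polynomial_in Basis f" if "f \<in> A" for f
    using that S by (auto simp: A_def intro: polynomial_in_mono)
  have x_poly: "polynomial_in Basis x" unfolding x_def using b by (auto intro: polynomial_in.coord)
  have below_poly: "f \<in> adjoin_below A x n \<Longrightarrow> polynomial_in Basis f" for f n
  proof (induction n arbitrary: f)
    case (Suc n)
    obtain g a where f: "g \<in> adjoin_below A x n" "a \<in> A" "f = (\<lambda>p. g p + a p * x p ^ n)"
      using Suc.prems by (rule adjoin_below_SucE)
    show ?case
      unfolding f(3)
      by (intro polynomial_in.add polynomial_in.mult polynomial_in_power A_poly x_poly f Suc.IH)
  qed (auto intro: polynomial_in.const)
  have adj: "Collect (polynomial_in (insert b S)) = adjoin A x"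
    unfolding A_def x_def by (rule polynomial_in_insert)
  have Db_A: "?Db f = (\<lambda>_. 0)" if "f \<in> A" for f
    using deriv_along_other_coordinate[of S f b] that S b by (simp add: A_def)
  have Db_x: "?Db x = (\<lambda>_. 1)"
    using b by (simp add: x_def deriv_along_coord)
  have Dw: "?Dw f p = deriv_along v f p - (v p \<bullet> b) * ?Db f p" if "polynomial_in Basis f" for f p
    unfolding w_def using deriv_along_lincomb[OF that, of "\<lambda>_. 1" v "\<lambda>p. v p \<bullet> b" "\<lambda>_. b"] by simp
  have Dw_x: "?Dw x = (\<lambda>_. 0)"
    using b by (simp add: w_def x_def deriv_along_coord inner_diff_left)
  have w: "polynomial_field w"
    unfolding w_def using v b
    by (intro polynomial_field_lincomb polynomial_in.const polynomial_field_const)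
       (auto simp: polynomial_field_def)
  have prime: "vanishes F f \<or> vanishes F g"
    if "vanishes F (\<lambda>p. f p * g p)" "polynomial_in Basis f" "polynomial_in Basis g" for f g
    using irr that unfolding irreducible_set_def by blast
  \<comment> \<open>Every term of either derivative carries a factor \<open>c\<close> or
    \<open>deriv_along v c\<close> with \<open>c\<close> a coefficient in \<open>J\<close>, and both
    factors vanish on \<open>F\<close>.\<close>
  have J_derivs: "vanishes F (?Dw h) \<and> vanishes F (?Db h)" if "h \<in> adjoin_below J x n" for h n
    using that
  proof (induction n arbitrary: h)
    case 0
    then show ?case by (simp add: deriv_along_const vanishes_def)
  next
    case (Suc n)
    obtain g c where h: "g \<in> adjoin_below J x n" "c \<in> J" "h = (\<lambda>p. g p + c p * x p ^ n)"
      using Suc.prems by (rule adjoin_below_SucE)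
    have polys: "polynomial_in Basis g" "polynomial_in Basis c"
    proof -
      have "g \<in> adjoin_below A x n"
        using h(1) by (induction n arbitrary: g) (auto simp: J_def)
      then show "polynomial_in Basis g" by (rule below_poly)
      show "polynomial_in Basis c" using h(2) A_poly by (auto simp: J_def)
    qed
    have D: "deriv_along u h = (\<lambda>p. deriv_along u g p +
        (deriv_along u c p * x p ^ n + c p * (of_nat n * x p ^ (n - 1) * deriv_along u x p)))" for u
      unfolding h(3)
      by (simp add: deriv_along_add[OF polys(1) polynomial_in.mult[OF polys(2) polynomial_in_power[OF x_poly]]]
          deriv_along_mult[OF polys(2) polynomial_in_power[OF x_poly]] deriv_along_power[OF x_poly])
    have "vanishes F (deriv_along v c)" "vanishes F c" "?Db c = (\<lambda>_. 0)"
      using h(2) v_tan Db_A by (auto simp: J_def A_def)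
    then show ?case
      using Suc.IH[OF h(1)] Dw[OF polys(2)] by (auto simp: D vanishes_def Dw_x Db_x)
  qed
  show ?thesis
  \<comment> \<open>The question is whether \<open>x\<close> is algebraic over the coefficients
    modulo the relations on \<open>F\<close>. If it is not, every relation in \<open>x\<close> has
    all its coefficients vanishing on \<open>F\<close>, and \<open>w\<close> itself is
    tangent.\<close>
  proof (cases "\<exists>m g a. g \<in> adjoin_below A x m \<and> a \<in> A \<and> \<not> vanishes F a \<and> vanishes F (\<lambda>p. g p + a p * x p ^ m)")
    case False
    have below_J: "f \<in> adjoin_below J x n" if "f \<in> adjoin_below A x n" "vanishes F f" for f n
      using that
    proof (induction n arbitrary: f)
      case (Suc n)
      obtain g c where f: "g \<in> adjoin_below A x n" "c \<in> A" "f = (\<lambda>p. g p + c p * x p ^ n)"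
        using Suc.prems(1) by (rule adjoin_below_SucE)
      have "vanishes F c" using False f Suc.prems(2) by blast
      then have "vanishes F g" "c \<in> J" using Suc.prems(2) f by (auto simp: vanishes_def J_def)
      then show ?case using Suc.IH f by (auto simp: intro!: exI)
    qed auto
    show ?thesis
    proof (rule that[of "\<lambda>_. 1" "\<lambda>p. v p \<bullet> b"])
      show "polynomial_in Basis (\<lambda>p. v p \<bullet> b)" using v b by (auto simp: polynomial_field_def)
      show "\<not> vanishes F (\<lambda>_. 1)" using F by (auto simp: vanishes_def)
      fix f assume f: "polynomial_in (insert b S) f" "vanishes F f"
      then obtain n where "f \<in> adjoin_below A x n" using adj by (auto simp: adjoin_def)
      then show "vanishes F (deriv_along (\<lambda>p. 1 *\<^sub>R v p - (v p \<bullet> b) *\<^sub>R b) f)"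
        using J_derivs below_J f(2) unfolding w_def by blast
    qed (rule polynomial_in.const)
  next
    case True
    define Q where "Q = (\<lambda>m. \<exists>g a. g \<in> adjoin_below A x m \<and> a \<in> A \<and> \<not> vanishes F a \<and>
      vanishes F (\<lambda>p. g p + a p * x p ^ m))"
    define m where "m = (LEAST m. Q m)"
    have "\<exists>m. Q m" using True unfolding Q_def .
    then have "Q m" unfolding m_def by (rule LeastI_ex)
    then obtain g a where ga: "g \<in> adjoin_below A x m" "a \<in> A" "\<not> vanishes F a"
      "vanishes F (\<lambda>p. g p + a p * x p ^ m)"
      unfolding Q_def by blast
    have minimal: "\<not> Q k" if "k < m" for k
      using that not_less_Least unfolding m_def by blast
    define G where "G = (\<lambda>p. g p + a p * x p ^ m)"
    have G_poly: "polynomial_in Basis G"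
      unfolding G_def using ga A_poly x_poly below_poly
      by (intro polynomial_in.add polynomial_in.mult polynomial_in_power) auto
    have G_van: "vanishes F G" using ga by (simp add: G_def)
    have "m \<noteq> 0"
    proof
      assume "m = 0"
      then have "g = (\<lambda>_. 0)" using ga(1) by simp
      then show False using ga(3,4) \<open>m = 0\<close> by simp
    qed
    have below_J: "f \<in> adjoin_below J x n" if "f \<in> adjoin_below A x n" "vanishes F f" "n \<le> m" for f n
      using that
    proof (induction n arbitrary: f)
      case (Suc n)
      obtain h c where f: "h \<in> adjoin_below A x n" "c \<in> A" "f = (\<lambda>p. h p + c p * x p ^ n)"
        using Suc.prems(1) by (rule adjoin_below_SucE)
      have "\<not> Q n" using minimal Suc.prems(3) by simp
      then have "vanishes F c" using f Suc.prems(2) unfolding Q_def by blast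
      then have "vanishes F h" "c \<in> J" using Suc.prems(2) f by (auto simp: vanishes_def J_def)
      then show ?case using Suc f by (auto simp: intro!: exI)
    qed auto
    have Db_below: "?Db h \<in> adjoin_below A x (n - 1)" if "h \<in> adjoin_below A x n" for h n
      using that
    proof (induction n arbitrary: h)
      case 0
      then show ?case by (simp add: deriv_along_const)
    next
      case (Suc n)
      obtain f c where h: "f \<in> adjoin_below A x n" "c \<in> A" "h = (\<lambda>p. f p + c p * x p ^ n)"
        using Suc.prems by (rule adjoin_below_SucE)
      have D: "?Db h = (\<lambda>p. ?Db f p + (of_nat n * c p) * x p ^ (n - 1))"
        unfolding h(3)
        by (simp add: deriv_along_add[OF below_poly[OF h(1)] polynomial_in.mult[OF A_poly[OF h(2)] polynomial_in_power[OF x_poly]]]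
            deriv_along_mult[OF A_poly[OF h(2)] polynomial_in_power[OF x_poly]] deriv_along_power[OF x_poly]
            Db_x Db_A[OF h(2)] algebra_simps)
      show ?case
      proof (cases n)
        case 0
        then have "h = c" using h by simp
        then show ?thesis using Db_A[OF h(2)] 0 by simp
      next
        case (Suc k)
        have "(\<lambda>p. of_nat n * c p) \<in> A"
          using function_ring_mult[OF A function_ring_const[OF A] h(2)] .
        then show ?thesis using Suc.IH[OF h(1)] Suc adjoin_below_SucI unfolding D by auto
      qed
    qed
    \<comment> \<open>\<open>?Db G\<close> has top term \<open>of_nat m * a p\<close> in degree
      \<open>m - 1\<close>, so its vanishing on \<open>F\<close> would contradict the minimality of
      \<open>m\<close>.\<close>
    have c_nv: "\<not> vanishes F (?Db G)"
    proof
      assume v: "vanishes F (?Db G)"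
      have D: "?Db G = (\<lambda>p. ?Db g p + (of_nat m * a p) * x p ^ (m - 1))"
        unfolding G_def
        by (simp add: deriv_along_add[OF below_poly[OF ga(1)] polynomial_in.mult[OF A_poly[OF ga(2)] polynomial_in_power[OF x_poly]]]
            deriv_along_mult[OF A_poly[OF ga(2)] polynomial_in_power[OF x_poly]] deriv_along_power[OF x_poly]
            Db_x Db_A[OF ga(2)] algebra_simps)
      have "(\<lambda>p. of_nat m * a p) \<in> A"
        using function_ring_mult[OF A function_ring_const[OF A] ga(2)] .
      moreover have "\<not> vanishes F (\<lambda>p. of_nat m * a p)"
        using ga(3) \<open>m \<noteq> 0\<close> by (auto simp: vanishes_def)
      ultimately have "Q (m - 1)"
        unfolding Q_def using Db_below[OF ga(1)] v unfolding D by blast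
      then show False using minimal \<open>m \<noteq> 0\<close> by auto
    qed
    \<comment> \<open>With these choices the field \<open>c v - e b\<close> is \<open>?Db G\<close>
      times \<open>w\<close> minus \<open>?Dw G\<close> times \<open>b\<close>, so its two
      contributions to the derivative of \<open>G\<close> cancel, on the whole space and not only on
      \<open>F\<close>.\<close>
    define c e where "c = ?Db G" and "e = (\<lambda>p. ?Db G p * (v p \<bullet> b) + ?Dw G p)"
    have c_poly: "polynomial_in Basis c"
      unfolding c_def by (intro polynomial_in_deriv_along G_poly polynomial_field_const)
    have e_poly: "polynomial_in Basis e"
      unfolding e_def using c_poly v b polynomial_in_deriv_along[OF G_poly w]
      by (auto simp: c_def polynomial_field_def intro!: polynomial_in.intros)
    define u where "u = (\<lambda>p. c p *\<^sub>R v p - e p *\<^sub>R b)"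
    have Du: "deriv_along u f p = ?Db G p * ?Dw f p - ?Dw G p * ?Db f p" if "polynomial_in Basis f" for f p
      unfolding u_def deriv_along_lincomb[OF that, of c v e "\<lambda>_. b"] Dw[OF that]
      by (simp add: c_def e_def algebra_simps)
    \<comment> \<open>The coefficient \<open>a\<close> need not be invertible, so each elimination
      of a top term multiplies \<open>f\<close> by a further factor \<open>a\<close>.\<close>
    have pseudo_division: "\<exists>k q h. polynomial_in Basis q \<and> h \<in> adjoin_below A x m \<and>
        (\<lambda>p. a p ^ k * f p) = (\<lambda>p. q p * G p + h p)" if "f \<in> adjoin_below A x n" for f n
      using that
    proof (induction n arbitrary: f)
      case 0
      then show ?case
        using adjoin_below_zero[OF A] polynomial_in.const[of Basis 0]
        by (intro exI[of _ 0] exI[of _ "\<lambda>_. 0"]) auto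
    next
      case (Suc n)
      show ?case
      proof (cases "Suc n \<le> m")
        case True
        then show ?thesis
          using adjoin_below_le[OF A True Suc.prems] polynomial_in.const[of Basis 0]
          by (intro exI[of _ 0] exI[of _ "\<lambda>_. 0"] exI[of _ f]) auto
      next
        case False
        obtain f1 s where f: "f1 \<in> adjoin_below A x n" "s \<in> A" "f = (\<lambda>p. f1 p + s p * x p ^ n)"
          using Suc.prems by (rule adjoin_below_SucE)
        define f2 where "f2 = (\<lambda>p. a p * f1 p - s p * (x p ^ (n - m) * g p))"
        have xg: "(\<lambda>p. x p ^ (n - m) * g p) \<in> adjoin_below A x n"
          using adjoin_below_shift[OF A ga(1), of "n - m"] False by simp
        have "f2 \<in> adjoin_below A x n"
          unfolding f2_def
          by (rule adjoin_below_diff[OF A adjoin_below_scale[OF A ga(2) f(1)] adjoin_below_scale[OF A f(2) xg]])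
        from Suc.IH[OF this] obtain k q h where kqh: "polynomial_in Basis q" "h \<in> adjoin_below A x m"
          "(\<lambda>p. a p ^ k * f2 p) = (\<lambda>p. q p * G p + h p)" by blast
        have "x p ^ n = x p ^ (n - m) * x p ^ m" for p
          using False by (simp flip: power_add)
        then have "a p * f p = f2 p + s p * x p ^ (n - m) * G p" for p
          by (simp add: f f2_def G_def algebra_simps)
        then have "a p ^ Suc k * f p = a p ^ k * f2 p + a p ^ k * (s p * x p ^ (n - m) * G p)" for p
          by (metis distrib_left mult.assoc power_Suc2)
        then have "(\<lambda>p. a p ^ Suc k * f p) = (\<lambda>p. (q p + a p ^ k * (s p * x p ^ (n - m))) * G p + h p)"
          using kqh(3) by (simp add: fun_eq_iff algebra_simps)
        moreover have "polynomial_in Basis (\<lambda>p. q p + a p ^ k * (s p * x p ^ (n - m)))"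
          by (intro polynomial_in.add polynomial_in.mult polynomial_in_power kqh(1) A_poly x_poly f ga)
        ultimately show ?thesis using kqh(2) by (intro exI[of _ "Suc k"] exI conjI) auto
      qed
    qed
    show ?thesis
    proof (rule that[OF c_poly e_poly])
      show "\<not> vanishes F c" using c_nv by (simp add: c_def)
      fix f assume "polynomial_in (insert b S) f" and f_van: "vanishes F f"
      then obtain n where f: "f \<in> adjoin_below A x n" using adj by (auto simp: adjoin_def)
      have f_poly: "polynomial_in Basis f" using f by (rule below_poly)
      obtain k q h where kqh: "polynomial_in Basis q" "h \<in> adjoin_below A x m"
        "(\<lambda>p. a p ^ k * f p) = (\<lambda>p. q p * G p + h p)" using pseudo_division[OF f] by blast
      have h_poly: "polynomial_in Basis h" using kqh(2) by (rule below_poly)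
      have h_eq: "h p = a p ^ k * f p - q p * G p" for p
        using fun_cong[OF kqh(3), of p] by simp
      have "vanishes F h"
        using f_van G_van unfolding vanishes_def h_eq by simp
      then have "h \<in> adjoin_below J x m" using below_J kqh(2) by blast
      then have "vanishes F (?Dw h)" "vanishes F (?Db h)" using J_derivs by blast+
      then have Duh: "vanishes F (deriv_along u h)"
        using Du[OF h_poly] by (auto simp: vanishes_def)
      have ak_poly: "polynomial_in Basis (\<lambda>p. a p ^ k)"
        by (intro polynomial_in_power A_poly ga)
      \<comment> \<open>Differentiate the division identity. On \<open>F\<close> the terms
        containing \<open>f\<close>, \<open>G\<close> or the derivative of \<open>h\<close> vanish,
        and so does the derivative of \<open>G\<close>; primeness then cancels the factor
        \<open>a p ^ k\<close>.\<close>
      have "deriv_along u (\<lambda>p. a p ^ k * f p) = deriv_along u (\<lambda>p. q p * G p + h p)"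
        unfolding kqh(3) ..
      then have "deriv_along u (\<lambda>p. a p ^ k) p * f p + a p ^ k * deriv_along u f p =
          (deriv_along u q p * G p + q p * deriv_along u G p) + deriv_along u h p" for p
        unfolding deriv_along_mult[OF ak_poly f_poly]
          deriv_along_add[OF polynomial_in.mult[OF kqh(1) G_poly] h_poly]
          deriv_along_mult[OF kqh(1) G_poly] by meson
      moreover have "deriv_along u G p = 0" for p by (simp add: Du[OF G_poly])
      ultimately have "vanishes F (\<lambda>p. a p ^ k * deriv_along u f p)"
        using f_van G_van Duh unfolding vanishes_def by (metis add.right_neutral add_0 mult_zero_right)
      moreover have "\<not> vanishes F (\<lambda>p. a p ^ k)"
        using ga(3) by (auto simp: vanishes_def)
      moreover have "polynomial_in Basis (deriv_along u f)"
        unfolding u_def by (intro polynomial_in_deriv_along f_poly polynomial_field_lincomb c_poly e_poly v polynomial_field_const)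
      ultimately have "vanishes F (deriv_along u f)"
        using prime[OF _ ak_poly, of "deriv_along u f"] by blast
      then show "vanishes F (deriv_along (\<lambda>p. c p *\<^sub>R v p - e p *\<^sub>R b) f)" by (simp add: u_def)
    qed
  qed
qed

text \<open>As long as only \<open>b1\<close> occurs there are no relations, and the constant field
  \<open>b1\<close> is tangent. Each further coordinate multiplies the \<open>b1\<close>-component
  by some \<open>c\<close> not vanishing on \<open>F\<close>, and irreducibility keeps the product
  from vanishing on \<open>F\<close>.\<close>

lemma tangent_field:
  fixes F :: "'a::euclidean_space set"
  assumes irr: "irreducible_set F" and F: "F \<noteq> {}"
    and b1: "b1 \<in> Basis"
    and transcendental: "\<And>f. polynomial_in {b1} f \<Longrightarrow> vanishes F f \<Longrightarrow> f = (\<lambda>_. 0)"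
    and "finite S" "S \<subseteq> Basis - {b1}"
  shows "\<exists>v. polynomial_field v \<and> \<not> vanishes F (\<lambda>p. v p \<bullet> b1) \<and>
    (\<forall>f. polynomial_in (insert b1 S) f \<longrightarrow> vanishes F f \<longrightarrow> vanishes F (deriv_along v f))"
  using assms(5,6)
proof (induction rule: finite_induct)
  case empty
  have "vanishes F (deriv_along (\<lambda>_. b1) f)" if "polynomial_in {b1} f" "vanishes F f" for f
    using transcendental[OF that] by (simp add: deriv_along_const vanishes_def)
  moreover have "\<not> vanishes F (\<lambda>p. b1 \<bullet> b1)" using F b1 by (auto simp: vanishes_def)
  ultimately show ?case using polynomial_field_const by blast
next
  case (insert b S)
  then obtain v where v: "polynomial_field v" "\<not> vanishes F (\<lambda>p. v p \<bullet> b1)"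
    "\<And>f. polynomial_in (insert b1 S) f \<Longrightarrow> vanishes F f \<Longrightarrow> vanishes F (deriv_along v f)"
    by blast
  have S: "insert b1 S \<subseteq> Basis" "b \<in> Basis - insert b1 S" "b \<noteq> b1"
    using insert.prems insert.hyps b1 by auto
  obtain c e where ce: "polynomial_in Basis c" "polynomial_in Basis e" "\<not> vanishes F c"
    "\<And>f. polynomial_in (insert b (insert b1 S)) f \<Longrightarrow> vanishes F f \<Longrightarrow>
        vanishes F (deriv_along (\<lambda>p. c p *\<^sub>R v p - e p *\<^sub>R b) f)"
    using tangent_field_step[OF irr F S(1,2) v(1,3)] by blast
  have "(c p *\<^sub>R v p - e p *\<^sub>R b) \<bullet> b1 = c p * (v p \<bullet> b1)" for p
    using S b1 by (simp add: inner_diff_left inner_Basis)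
  moreover have "\<not> vanishes F (\<lambda>p. c p * (v p \<bullet> b1))"
    using irr ce(1,3) v(1,2) b1 unfolding irreducible_set_def polynomial_field_def by blast
  ultimately have "\<not> vanishes F (\<lambda>p. (c p *\<^sub>R v p - e p *\<^sub>R b) \<bullet> b1)" by simp
  moreover have "polynomial_field (\<lambda>p. c p *\<^sub>R v p - e p *\<^sub>R b)"
    by (intro polynomial_field_lincomb ce v polynomial_field_const)
  ultimately show ?case using ce(4) by (auto simp: insert_commute)
qed

text \<open>The flow of \<open>v\<close> through \<open>q\<close> is constructed as a power series instead of by solving a
  differential equation: a polynomial \<open>f\<close> takes the value \<open>\<Sum>k. flow_coeff v k f q * t ^ k\<close> at time \<open>t\<close>,
  and Leibniz' rule makes this multiplicative in \<open>f\<close>.\<close>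

definition flow_coeff :: "('a \<Rightarrow> 'a::euclidean_space) \<Rightarrow> nat \<Rightarrow> ('a \<Rightarrow> real) \<Rightarrow> 'a \<Rightarrow> real" where
  "flow_coeff v k f p = (deriv_along v ^^ k) f p / fact k"

lemma polynomial_in_iterated_deriv:
  "polynomial_in Basis f \<Longrightarrow> polynomial_field v \<Longrightarrow> polynomial_in Basis ((deriv_along v ^^ k) f)"
  by (induction k) (auto intro: polynomial_in_deriv_along)

lemma flow_coeff_0: "flow_coeff v 0 f p = f p"
  by (simp add: flow_coeff_def)

lemma deriv_along_sum:
  assumes "\<And>i. i \<in> I \<Longrightarrow> polynomial_in S (f i)"
  shows "deriv_along v (\<lambda>p. \<Sum>i\<in>I. f i p) = (\<lambda>p. \<Sum>i\<in>I. deriv_along v (f i) p)"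
  using assms
proof (induction I rule: infinite_finite_induct)
  case (insert i I)
  then show ?case
    by (simp add: deriv_along_add[of S "f i"] polynomial_in_sum)
qed (simp_all add: deriv_along_const)

lemma deriv_along_cmult:
  assumes "polynomial_in S f"
  shows "deriv_along v (\<lambda>p. c * f p) = (\<lambda>p. c * deriv_along v f p)"
  using deriv_along_mult[OF polynomial_in.const assms, of v c] by (simp add: deriv_along_const)

lemma flow_coeff_Suc:
  assumes "polynomial_in Basis f" "polynomial_field v"
  shows "of_nat (Suc k) * flow_coeff v (Suc k) f p = deriv_along v (flow_coeff v k f) p"
proof -
  have "deriv_along v (flow_coeff v k f) p = deriv_along v (\<lambda>p. (1 / fact k) * (deriv_along v ^^ k) f p) p"
    by (rule arg_cong[of _ _ "\<lambda>g. deriv_along v g p"]) (simp add: flow_coeff_def fun_eq_iff)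
  also have "\<dots> = (1 / fact k) * (deriv_along v ^^ Suc k) f p"
    by (simp only: deriv_along_cmult[OF polynomial_in_iterated_deriv[OF assms]] funpow.simps o_apply)
  also have "\<dots> = of_nat (Suc k) * flow_coeff v (Suc k) f p"
    by (simp add: flow_coeff_def divide_simps)
  finally show ?thesis ..
qed

lemma polynomial_in_flow_coeff:
  assumes "polynomial_in Basis f" "polynomial_field v"
  shows "polynomial_in Basis (flow_coeff v k f)"
proof -
  have "polynomial_in Basis (\<lambda>p. (1 / fact k) * (deriv_along v ^^ k) f p)"
    by (intro polynomial_in.mult polynomial_in.const polynomial_in_iterated_deriv assms)
  then show ?thesis by (simp add: flow_coeff_def[abs_def])
qed

lemma flow_coeff_const: "flow_coeff v k (\<lambda>_. c) p = (if k = 0 then c else 0)"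
proof -
  have "(deriv_along v ^^ k) (\<lambda>_. c) = (\<lambda>_. if k = 0 then c else 0)"
    by (induction k) (simp_all add: deriv_along_const)
  then show ?thesis by (simp add: flow_coeff_def)
qed

lemma flow_coeff_add:
  assumes "polynomial_in Basis f" "polynomial_in Basis g" "polynomial_field v"
  shows "flow_coeff v k (\<lambda>p. f p + g p) p = flow_coeff v k f p + flow_coeff v k g p"
proof -
  have "(deriv_along v ^^ k) (\<lambda>p. f p + g p) = (\<lambda>p. (deriv_along v ^^ k) f p + (deriv_along v ^^ k) g p)"
    using assms
    by (induction k)
       (simp_all add: deriv_along_add[OF polynomial_in_iterated_deriv polynomial_in_iterated_deriv])
  then show ?thesis by (simp add: flow_coeff_def add_divide_distrib)
qed

lemma flow_coeff_mult:
  assumes f: "polynomial_in Basis f" and g: "polynomial_in Basis g" and v: "polynomial_field v"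
  shows "flow_coeff v k (\<lambda>p. f p * g p) p = (\<Sum>j\<le>k. flow_coeff v j f p * flow_coeff v (k - j) g p)"
proof (induction k arbitrary: p)
  case 0
  then show ?case by (simp add: flow_coeff_0)
next
  case (Suc k)
  let ?a = "\<lambda>j. flow_coeff v j f p" and ?b = "\<lambda>j. flow_coeff v j g p"
  note polys = polynomial_in_flow_coeff[OF f v] polynomial_in_flow_coeff[OF g v]
  have eq: "flow_coeff v k (\<lambda>p. f p * g p) = (\<lambda>p. \<Sum>j\<le>k. flow_coeff v j f p * flow_coeff v (k - j) g p)"
    using Suc by (simp add: fun_eq_iff)
  have "of_nat (Suc k) * flow_coeff v (Suc k) (\<lambda>p. f p * g p) p =
      deriv_along v (flow_coeff v k (\<lambda>p. f p * g p)) p"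
    by (rule flow_coeff_Suc[OF polynomial_in.mult[OF f g] v])
  also have "\<dots> = (\<Sum>j\<le>k. deriv_along v (flow_coeff v j f) p * ?b (k - j) +
      ?a j * deriv_along v (flow_coeff v (k - j) g) p)"
    unfolding eq by (simp add: deriv_along_sum[of _ Basis] polynomial_in.mult polys deriv_along_mult[OF polys])
  also have "\<dots> = (\<Sum>j\<le>k. of_nat (Suc j) * ?a (Suc j) * ?b (k - j)) +
      (\<Sum>j\<le>k. of_nat (Suc (k - j)) * ?a j * ?b (Suc (k - j)))"
    by (simp only: sum.distrib flow_coeff_Suc[OF f v, symmetric] flow_coeff_Suc[OF g v, symmetric] ac_simps)
  also have "(\<Sum>j\<le>k. of_nat (Suc j) * ?a (Suc j) * ?b (k - j)) =
      (\<Sum>j\<le>Suc k. of_nat j * ?a j * ?b (Suc k - j))"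
    by (subst sum.atMost_Suc_shift) simp
  also have "(\<Sum>j\<le>k. of_nat (Suc (k - j)) * ?a j * ?b (Suc (k - j))) =
      (\<Sum>j\<le>Suc k. of_nat (Suc k - j) * ?a j * ?b (Suc k - j))"
    unfolding sum.atMost_Suc by (simp add: Suc_diff_le del: of_nat_Suc of_nat_diff)
  \<comment> \<open>The weights \<open>j\<close> and \<open>Suc k - j\<close> add up to
    \<open>Suc k\<close>, which no longer depends on \<open>j\<close> and is cancelled at the
    end.\<close>
  also have "(\<Sum>j\<le>Suc k. of_nat j * ?a j * ?b (Suc k - j)) +
      (\<Sum>j\<le>Suc k. of_nat (Suc k - j) * ?a j * ?b (Suc k - j)) =
      (\<Sum>j\<le>Suc k. of_nat (Suc k) * (?a j * ?b (Suc k - j)))"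
    unfolding sum.distrib[symmetric]
    by (rule sum.cong) (auto simp: of_nat_diff algebra_simps)
  finally have "of_nat (Suc k) * flow_coeff v (Suc k) (\<lambda>p. f p * g p) p =
      of_nat (Suc k) * (\<Sum>j\<le>Suc k. ?a j * ?b (Suc k - j))"
    by (simp only: sum_distrib_left)
  then show ?case by (rule mult_left_cancel[OF of_nat_neq_0, THEN iffD1])
qed

text \<open>\<open>poly_bound m M f\<close>: the polynomial \<open>f\<close> is written as a sum of monomials of degree at most
  \<open>m\<close> whose coefficients have absolute values of sum at most \<open>M\<close>.\<close>

inductive poly_bound :: "nat \<Rightarrow> real \<Rightarrow> ('a::euclidean_space \<Rightarrow> real) \<Rightarrow> bool" where
  const: "\<bar>c\<bar> \<le> M \<Longrightarrow> poly_bound m M (\<lambda>_. c)"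
| coord: "b \<in> Basis \<Longrightarrow> poly_bound m M f \<Longrightarrow> poly_bound (Suc m) M (\<lambda>p. (p \<bullet> b) * f p)"
| add: "poly_bound m M f \<Longrightarrow> poly_bound m N g \<Longrightarrow> M + N \<le> K \<Longrightarrow> poly_bound m K (\<lambda>p. f p + g p)"

lemma poly_bound_nonneg: "poly_bound m M f \<Longrightarrow> 0 \<le> M"
  by (induction rule: poly_bound.induct) auto

lemma poly_bound_polynomial: "poly_bound m M f \<Longrightarrow> polynomial_in Basis f"
  by (induction rule: poly_bound.induct) (auto intro: polynomial_in.intros)

lemma poly_bound_mono_deg: "poly_bound m M f \<Longrightarrow> m \<le> n \<Longrightarrow> poly_bound n M f"
proof (induction arbitrary: n rule: poly_bound.induct)
  case (coord b m M f)
  then obtain k where "n = Suc k" "m \<le> k" by (cases n) auto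
  then show ?case using coord by (auto intro: poly_bound.intros)
qed (auto intro: poly_bound.intros)

lemma poly_bound_mono:
  assumes "poly_bound m M f" "M \<le> N"
  shows "poly_bound m N f"
  using poly_bound.add[OF assms(1) poly_bound.const[of 0 0 m]] assms(2) by simp

lemma poly_bound_cmult: "poly_bound n N g \<Longrightarrow> poly_bound n (\<bar>c\<bar> * N) (\<lambda>p. c * g p)"
proof (induction rule: poly_bound.induct)
  case (const e M m)
  then show ?case by (intro poly_bound.const) (simp add: abs_mult mult_left_mono)
next
  case (coord b m M f)
  then show ?case using poly_bound.coord[OF coord(1) coord(3)] by (simp add: algebra_simps)
next
  case (add m M f N g K)
  have "\<bar>c\<bar> * M + \<bar>c\<bar> * N \<le> \<bar>c\<bar> * K" using add(3) by (simp add: mult_left_mono flip: distrib_left)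
  then show ?case using poly_bound.add[OF add(4,5)] by (simp add: algebra_simps)
qed

lemma poly_bound_mult:
  assumes "poly_bound m M f" "poly_bound n N g"
  shows "poly_bound (m + n) (M * N) (\<lambda>p. f p * g p)"
  using assms(1)
proof (induction rule: poly_bound.induct)
  case (const c M m)
  have "\<bar>c\<bar> * N \<le> M * N" using const poly_bound_nonneg[OF assms(2)] by (rule mult_right_mono)
  then show ?case
    using poly_bound_mono_deg[OF poly_bound_mono[OF poly_bound_cmult[OF assms(2), of c]]] by simp
next
  case (coord b m M f)
  then show ?case using poly_bound.coord[OF coord(1) coord(3)] by (simp add: algebra_simps)
next
  case (add m M f M' g K)
  have "M * N + M' * N \<le> K * N"
    using mult_right_mono[OF add(3) poly_bound_nonneg[OF assms(2)]] by (simp add: algebra_simps)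
  then show ?case using poly_bound.add[OF add(4,5)] by (simp add: algebra_simps)
qed

lemma poly_bound_exists: "polynomial_in Basis f \<Longrightarrow> \<exists>m M. poly_bound m M f"
proof (induction rule: polynomial_in.induct)
  case (const c)
  then show ?case by (auto intro: poly_bound.const)
next
  case (coord b)
  then show ?case using poly_bound.coord[OF coord poly_bound.const[of 1 1 0]] by auto
next
  case (add f g)
  then obtain m M n N where *: "poly_bound m M f" "poly_bound n N g" by blast
  have "poly_bound (max m n) (M + N) (\<lambda>p. f p + g p)"
    by (rule poly_bound.add[OF poly_bound_mono_deg[OF *(1)] poly_bound_mono_deg[OF *(2)]]) auto
  then show ?case by blast
next
  case (mult f g)
  then show ?case using poly_bound_mult by blast
qed

lemma poly_bound_value:
  assumes "poly_bound m M f" and R: "1 \<le> R" "\<And>b. b \<in> Basis \<Longrightarrow> \<bar>p \<bullet> b\<bar> \<le> R"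
  shows "\<bar>f p\<bar> \<le> M * R ^ m"
  using assms(1)
proof (induction rule: poly_bound.induct)
  case (const c M m)
  have "M * 1 \<le> M * R ^ m" using const R by (intro mult_left_mono) auto
  then show ?case using const by simp
next
  case (coord b m M f)
  have "\<bar>p \<bullet> b\<bar> * \<bar>f p\<bar> \<le> R * (M * R ^ m)"
    using coord R by (intro mult_mono) auto
  then show ?case by (simp add: abs_mult algebra_simps)
next
  case (add m M f N g K)
  have "(M + N) * R ^ m \<le> K * R ^ m" using add(3) R by (intro mult_right_mono) auto
  then show ?case using add(4,5) by (simp add: algebra_simps)
qed

text \<open>A monomial of degree at most \<open>m\<close> yields at most \<open>m\<close> products
  in which one coordinate is replaced by a component of \<open>v\<close>. Iterating the resulting
  factor \<open>real m\<close> produces the factorial by which flow coefficients are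
  divided.\<close>

lemma poly_bound_deriv_along:
  assumes "poly_bound m M f" and v: "\<And>b. b \<in> Basis \<Longrightarrow> poly_bound d A (\<lambda>p. v p \<bullet> b)"
  shows "poly_bound (m + d) (real m * M * A) (deriv_along v f)"
  using assms(1)
proof (induction rule: poly_bound.induct)
  case (const c M m)
  obtain b :: 'a where "b \<in> Basis" using nonempty_Basis by blast
  then have "0 \<le> A" using v poly_bound_nonneg by blast
  then show ?case unfolding deriv_along_const using const by (intro poly_bound.const) auto
next
  case (coord b m M f)
  have D: "deriv_along v (\<lambda>p. (p \<bullet> b) * f p) = (\<lambda>p. (v p \<bullet> b) * f p + (p \<bullet> b) * deriv_along v f p)"
    unfolding deriv_along_mult[OF polynomial_in.coord[OF coord(1)] poly_bound_polynomial[OF coord(2)]]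
    by (simp add: deriv_along_coord)
  have 1: "poly_bound (Suc m + d) (A * M) (\<lambda>p. (v p \<bullet> b) * f p)"
    by (rule poly_bound_mono_deg[OF poly_bound_mult[OF v[OF coord(1)] coord(2)]]) simp
  have 2: "poly_bound (Suc m + d) (real m * M * A) (\<lambda>p. (p \<bullet> b) * deriv_along v f p)"
    using poly_bound.coord[OF coord(1,3)] by simp
  show ?case unfolding D by (rule poly_bound.add[OF 1 2]) (simp add: algebra_simps)
next
  case (add m M f N g K)
  obtain b :: 'a where "b \<in> Basis" using nonempty_Basis by blast
  then have "0 \<le> A" using v poly_bound_nonneg by blast
  then have "real m * A * (M + N) \<le> real m * A * K" using add(3) by (intro mult_left_mono) auto
  then show ?case
    unfolding deriv_along_add[OF add(1,2)[THEN poly_bound_polynomial]]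
    by (intro poly_bound.add[OF add(4,5)]) (simp add: algebra_simps)
qed

lemma flow_coeff_geometric_bound:
  assumes v: "polynomial_field v"
  obtains C R where "0 < C" "0 \<le> R" "\<And>b k. b \<in> Basis \<Longrightarrow> \<bar>flow_coeff v k (\<lambda>p. p \<bullet> b) q\<bar> \<le> R * C ^ k"
proof -
  have "\<forall>b\<in>Basis. \<exists>mM. poly_bound (fst mM) (snd mM) (\<lambda>p. v p \<bullet> b)"
    using poly_bound_exists v unfolding polynomial_field_def by force
  then obtain mM where "\<forall>b\<in>Basis. poly_bound (fst (mM b)) (snd (mM b)) (\<lambda>p. v p \<bullet> b)"
    by (rule bchoice[THEN exE])
  then obtain m0 M0 where mM: "\<And>b. b \<in> Basis \<Longrightarrow> poly_bound (m0 b) (M0 b) (\<lambda>p. v p \<bullet> b)"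
    using that[of "fst \<circ> mM" "snd \<circ> mM"] by simp
  define d where "d = Max (m0 ` Basis)"
  define A where "A = Max (M0 ` Basis)"
  have vb: "poly_bound d A (\<lambda>p. v p \<bullet> b)" if "b \<in> Basis" for b
    using that unfolding d_def A_def
    by (intro poly_bound_mono[OF poly_bound_mono_deg[OF mM[OF that]]] Max_ge) auto
  have "0 \<le> A" using vb poly_bound_nonneg nonempty_Basis by blast
  have it: "poly_bound (1 + k * d) (fact k * ((1 + real d) * A) ^ k) ((deriv_along v ^^ k) (\<lambda>p. p \<bullet> b))"
    if "b \<in> Basis" for b k
  proof (induction k)
    case 0
    then show ?case using poly_bound.coord[OF that poly_bound.const[of 1 1 0]] by simp
  next
    case (Suc k)
    \<comment> \<open>Since \<open>1 + k * d\<close> is at most \<open>Suc k * (1 + d)\<close>,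
      \<open>k\<close> derivatives cost \<open>fact k\<close> times a geometric factor.\<close>
    have "real (1 + k * d) * (fact k * ((1 + real d) * A) ^ k) * A \<le>
        (real (Suc k) * (1 + real d)) * (fact k * ((1 + real d) * A) ^ k) * A"
      using \<open>0 \<le> A\<close> by (intro mult_right_mono) (auto simp: algebra_simps)
    also have "\<dots> = fact (Suc k) * ((1 + real d) * A) ^ Suc k"
      by (simp only: fact_Suc of_nat_mult of_nat_fact power_Suc ac_simps)
    finally have le: "real (1 + k * d) * (fact k * ((1 + real d) * A) ^ k) * A \<le>
        fact (Suc k) * ((1 + real d) * A) ^ Suc k" .
    have "poly_bound (1 + k * d + d) (real (1 + k * d) * (fact k * ((1 + real d) * A) ^ k) * A)
        (deriv_along v ((deriv_along v ^^ k) (\<lambda>p. p \<bullet> b)))"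
      using Suc vb by (rule poly_bound_deriv_along)
    from poly_bound_mono[OF this le] show ?case by (simp add: algebra_simps)
  qed
  define R where "R = 1 + norm q"
  have R: "1 \<le> R" "\<And>b. b \<in> Basis \<Longrightarrow> \<bar>q \<bullet> b\<bar> \<le> R"
    unfolding R_def using Basis_le_norm[of _ q] by (simp, meson add_increasing zero_le_one)
  \<comment> \<open>The added 1 keeps \<open>C\<close> positive even for \<open>A = 0\<close>, so
    that \<open>1 / C\<close> can serve as a radius of convergence.\<close>
  define C where "C = (1 + real d) * A * R ^ d + 1"
  show ?thesis
  proof
    show "0 < C" "0 \<le> R" using \<open>0 \<le> A\<close> R by (auto simp: C_def intro!: add_nonneg_pos)
    fix b :: 'a and k assume "b \<in> Basis"
    have "\<bar>(deriv_along v ^^ k) (\<lambda>p. p \<bullet> b) q\<bar> \<le> (fact k * ((1 + real d) * A) ^ k) * R ^ (1 + k * d)"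
      by (rule poly_bound_value[OF it[OF \<open>b \<in> Basis\<close>] R])
    then have "\<bar>flow_coeff v k (\<lambda>p. p \<bullet> b) q\<bar> \<le> ((1 + real d) * A) ^ k * R ^ (1 + k * d)"
      by (simp add: flow_coeff_def divide_simps mult_ac)
    also have "\<dots> = R * ((1 + real d) * A * R ^ d) ^ k"
      by (simp add: power_add power_mult power_mult_distrib mult.commute[of k d])
    also have "\<dots> \<le> R * C ^ k"
      using R \<open>0 \<le> A\<close> by (intro mult_left_mono power_mono) (auto simp: C_def)
    finally show "\<bar>flow_coeff v k (\<lambda>p. p \<bullet> b) q\<bar> \<le> R * C ^ k" .
  qed
qed

text \<open>The curve is defined by its coordinate series, and the claim spreads to all polynomials
  by induction. Absolute summability is carried along because products need the Cauchy product
  theorem.\<close>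

lemma flow_curve:
  fixes v :: "'a \<Rightarrow> 'a::euclidean_space"
  assumes v: "polynomial_field v"
  obtains r \<gamma> where "0 < r"
    "\<And>f t. polynomial_in Basis f \<Longrightarrow> \<bar>t\<bar> < r \<Longrightarrow> (\<lambda>k. flow_coeff v k f q * t ^ k) sums f (\<gamma> t)"
proof -
  obtain C R where C: "0 < C" "0 \<le> R" "\<And>b k. b \<in> Basis \<Longrightarrow> \<bar>flow_coeff v k (\<lambda>p. p \<bullet> b) q\<bar> \<le> R * C ^ k"
    using flow_coeff_geometric_bound[OF v] by blast
  define \<gamma> where "\<gamma> = (\<lambda>t. \<Sum>b\<in>Basis. (\<Sum>k. flow_coeff v k (\<lambda>p. p \<bullet> b) q * t ^ k) *\<^sub>R b)"
  have "summable (\<lambda>k. norm (flow_coeff v k f q * t ^ k)) \<and> (\<lambda>k. flow_coeff v k f q * t ^ k) sums f (\<gamma> t)"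
    if "polynomial_in Basis f" and t: "\<bar>t\<bar> < 1 / C" for f t
    using that(1)
  proof (induction rule: polynomial_in.induct)
    case (const c)
    have "(\<lambda>k. (if k = 0 then c else 0) * t ^ k) sums (\<Sum>k\<in>{0}. (if k = 0 then c else 0) * t ^ k)"
      by (rule sums_finite) auto
    then have "(\<lambda>k. (if k = 0 then c else 0) * t ^ k) sums c" by simp
    moreover have "summable (\<lambda>k. norm ((if k = 0 then c else 0) * t ^ k))"
      by (rule summable_finite[of "{0}"]) auto
    ultimately show ?case by (simp add: flow_coeff_const)
  next
    case (coord b)
    have "summable (\<lambda>k. R * (C * \<bar>t\<bar>) ^ k)"
      using C t by (intro summable_mult summable_geometric) (simp add: abs_mult divide_simps mult.commute)
    then have s: "summable (\<lambda>k. norm (flow_coeff v k (\<lambda>p. p \<bullet> b) q * t ^ k))"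
    proof (rule summable_comparison_test')
      fix k
      have "\<bar>flow_coeff v k (\<lambda>p. p \<bullet> b) q\<bar> * \<bar>t\<bar> ^ k \<le> R * C ^ k * \<bar>t\<bar> ^ k"
        using C(3)[OF coord] by (intro mult_right_mono) auto
      then show "norm (norm (flow_coeff v k (\<lambda>p. p \<bullet> b) q * t ^ k)) \<le> R * (C * \<bar>t\<bar>) ^ k"
        by (simp add: abs_mult power_mult_distrib power_abs)
    qed
    have "\<gamma> t \<bullet> b = (\<Sum>k. flow_coeff v k (\<lambda>p. p \<bullet> b) q * t ^ k)"
      using coord by (simp add: \<gamma>_def inner_sum_left inner_Basis if_distrib sum.delta cong: if_cong)
    then show ?case using s summable_norm_cancel[OF s] by (simp add: summable_sums)
  next
    case (add f g)
    have eq: "flow_coeff v k (\<lambda>p. f p + g p) q * t ^ k = flow_coeff v k f q * t ^ k + flow_coeff v k g q * t ^ k" for k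
      using flow_coeff_add[OF add(1,2) v] by (simp add: algebra_simps)
    have "summable (\<lambda>k. norm (flow_coeff v k f q * t ^ k) + norm (flow_coeff v k g q * t ^ k))"
      using add by (intro summable_add) auto
    then have "summable (\<lambda>k. norm (flow_coeff v k f q * t ^ k + flow_coeff v k g q * t ^ k))"
      by (rule summable_comparison_test') (simp add: norm_triangle_ineq)
    then show ?case unfolding eq using add by (auto intro: sums_add)
  next
    case (mult f g)
    let ?a = "\<lambda>k. flow_coeff v k f q * t ^ k" and ?b = "\<lambda>k. flow_coeff v k g q * t ^ k"
    have eq: "flow_coeff v k (\<lambda>p. f p * g p) q * t ^ k = (\<Sum>i\<le>k. ?a i * ?b (k - i))" for k
      unfolding flow_coeff_mult[OF mult(1,2) v] sum_distrib_right
      by (rule sum.cong) (auto simp: mult_ac simp flip: power_add)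
    have s: "summable (\<lambda>k. norm (?a k))" "summable (\<lambda>k. norm (?b k))" using mult by auto
    have "summable (\<lambda>k. \<Sum>i\<le>k. norm (?a i) * norm (?b (k - i)))"
      by (rule summable_Cauchy_product) (use s in simp_all)
    then have "summable (\<lambda>k. norm (\<Sum>i\<le>k. ?a i * ?b (k - i)))"
    proof (rule summable_comparison_test')
      fix k
      show "norm (norm (\<Sum>i\<le>k. ?a i * ?b (k - i))) \<le> (\<Sum>i\<le>k. norm (?a i) * norm (?b (k - i)))"
        by (subst real_norm_def, subst abs_norm_cancel) (rule order_trans[OF norm_sum], simp add: abs_mult)
    qed
    moreover have "(\<Sum>k. ?a k) = f (\<gamma> t)" "(\<Sum>k. ?b k) = g (\<gamma> t)"
      using mult by (simp_all add: sums_iff)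
    ultimately show ?case
      unfolding eq using Cauchy_product_sums[OF s] by simp
  qed
  then show ?thesis using that[of "1 / C" \<gamma>] C(1) by simp
qed

section \<open>Infinite real algebraic sets\<close>

lemma function_ideal_vanishes:
  "function_ideal (Collect (polynomial_in S)) {f. polynomial_in S f \<and> vanishes F f}"
  unfolding function_ideal_def vanishes_def by (auto intro: polynomial_in.intros)

text \<open>By the chain condition \<open>F\<close> can be chosen so that passing to an infinite
  subset no longer enlarges the ideal. If a product vanishes on \<open>F\<close>, one factor has an
  infinite zero set in \<open>F\<close>, whose ideal is that of \<open>F\<close>.\<close>

lemma infinite_set_contains_irreducible:
  fixes E :: "'a::euclidean_space set"
  assumes "infinite E"
  obtains F where "F \<subseteq> E" "infinite F" "irreducible_set F"
proof -
  define I where "I = (\<lambda>F :: 'a set. {f. polynomial_in Basis f \<and> vanishes F f})"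
  have "\<exists>F. F \<subseteq> E \<and> infinite F \<and> (\<forall>F'\<subseteq>F. infinite F' \<longrightarrow> I F' = I F)"
  proof (rule ccontr)
    assume no: "\<not> ?thesis"
    define bad where "bad = {F. F \<subseteq> E \<and> infinite F}"
    have "\<forall>F\<in>bad. \<exists>F'. F' \<in> bad \<and> F' \<subseteq> F \<and> I F' \<noteq> I F"
    proof
      fix F assume F: "F \<in> bad"
      then have "F \<subseteq> E" "infinite F" unfolding bad_def by auto
      have "\<not> (\<forall>F'\<subseteq>F. infinite F' \<longrightarrow> I F' = I F)"
      proof
        assume "\<forall>F'\<subseteq>F. infinite F' \<longrightarrow> I F' = I F"
        with \<open>F \<subseteq> E\<close> \<open>infinite F\<close> have "\<exists>F. F \<subseteq> E \<and> infinite F \<and> (\<forall>F'\<subseteq>F. infinite F' \<longrightarrow> I F' = I F)"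
          by (intro exI conjI)
        with no show False by (rule notE)
      qed
      then obtain F' where "F' \<subseteq> F" "infinite F'" "I F' \<noteq> I F" by auto
      then show "\<exists>F'. F' \<in> bad \<and> F' \<subseteq> F \<and> I F' \<noteq> I F"
        using \<open>F \<subseteq> E\<close> by (intro exI[of _ F']) (auto simp: bad_def)
    qed
    then obtain h where h: "\<forall>F\<in>bad. h F \<in> bad \<and> h F \<subseteq> F \<and> I (h F) \<noteq> I F"
      by (rule bchoice[THEN exE])
    define G where "G = (\<lambda>n. (h ^^ n) E)"
    have G: "G n \<in> bad" for n
      using assms h by (induction n) (auto simp: G_def bad_def)
    have step: "I (G n) \<subseteq> I (G (Suc n))" "I (G (Suc n)) \<noteq> I (G n)" for n
    proof -
      have "h (G n) \<subseteq> G n" "I (h (G n)) \<noteq> I (G n)" "G (Suc n) = h (G n)"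
        using bspec[OF h G[of n]] by (simp_all add: G_def)
      then show "I (G n) \<subseteq> I (G (Suc n))" "I (G (Suc n)) \<noteq> I (G n)"
        unfolding I_def vanishes_def by auto
    qed
    have "\<exists>N. \<forall>n\<ge>N. I (G n) = I (G N)"
      using ideal_acc_polynomials[OF finite_Basis, where 'a = 'a, unfolded ideal_acc_def, rule_format, of "\<lambda>n. I (G n)"]
        step(1) function_ideal_vanishes unfolding I_def by blast
    then show False using step(2) by (metis le_Suc_eq order_refl)
  qed
  then obtain F where F: "F \<subseteq> E" "infinite F" "\<And>F'. F' \<subseteq> F \<Longrightarrow> infinite F' \<Longrightarrow> I F' = I F"
    by blast
  have "irreducible_set F"
    unfolding irreducible_set_def
  proof (intro allI impI)
    fix f g assume fg: "polynomial_in Basis f" "polynomial_in Basis g" "vanishes F (\<lambda>p. f p * g p)"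
    have zero_set: "vanishes F k" if "polynomial_in Basis k" "infinite {p \<in> F. k p = 0}" for k
    proof -
      have "k \<in> I {p \<in> F. k p = 0}" using that by (auto simp: I_def vanishes_def)
      also have "I {p \<in> F. k p = 0} = I F" using that by (intro F) auto
      finally show ?thesis by (simp add: I_def)
    qed
    have "F = {p \<in> F. f p = 0} \<union> {p \<in> F. g p = 0}" using fg(3) by (auto simp: vanishes_def)
    then have "infinite {p \<in> F. f p = 0} \<or> infinite {p \<in> F. g p = 0}"
      using F(2) by (metis finite_UnI)
    then show "vanishes F f \<or> vanishes F g" using zero_set fg by blast
  qed
  then show ?thesis using that F by blast
qed

text \<open>Otherwise \<open>F\<close> would lie in a finite grid.\<close>

lemma infinite_coordinate:
  fixes F :: "'a::euclidean_space set"
  assumes "infinite F"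
  obtains b where "b \<in> Basis" "infinite ((\<lambda>p. p \<bullet> b) ` F)"
proof -
  have "finite F" if fin: "\<forall>b\<in>Basis. finite ((\<lambda>p. p \<bullet> b) ` F)"
  proof (rule finite_surj)
    show "finite (PiE Basis (\<lambda>b. (\<lambda>p. p \<bullet> b) ` F))" using fin by (intro finite_PiE) auto
    show "F \<subseteq> (\<lambda>g. \<Sum>b\<in>Basis. g b *\<^sub>R b) ` PiE Basis (\<lambda>b. (\<lambda>p. p \<bullet> b) ` F)"
    proof
      fix p assume "p \<in> F"
      then have "restrict (\<lambda>b. p \<bullet> b) Basis \<in> PiE Basis (\<lambda>b. (\<lambda>p. p \<bullet> b) ` F)" by auto
      moreover have "p = (\<Sum>b\<in>Basis. restrict (\<lambda>b. p \<bullet> b) Basis b *\<^sub>R b)"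
        by (simp add: euclidean_representation)
      ultimately show "p \<in> (\<lambda>g. \<Sum>b\<in>Basis. g b *\<^sub>R b) ` PiE Basis (\<lambda>b. (\<lambda>p. p \<bullet> b) ` F)" by blast
    qed
  qed
  then show ?thesis using that assms by blast
qed

lemma polynomial_in_singleton:
  assumes "polynomial_in {b} f"
  shows "\<exists>r. f = (\<lambda>p. poly r (p \<bullet> b))"
  using assms
proof (induction rule: polynomial_in.induct)
  case (const c)
  then show ?case by (intro exI[of _ "[:c:]"]) simp
next
  case (coord b')
  then show ?case by (intro exI[of _ "[:0, 1:]"]) simp
next
  case (add f g)
  then obtain r s where "f = (\<lambda>p. poly r (p \<bullet> b))" "g = (\<lambda>p. poly s (p \<bullet> b))" by blast
  then show ?case by (intro exI[of _ "r + s"]) simp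
next
  case (mult f g)
  then obtain r s where "f = (\<lambda>p. poly r (p \<bullet> b))" "g = (\<lambda>p. poly s (p \<bullet> b))" by blast
  then show ?case by (intro exI[of _ "r * s"]) simp
qed

theorem infinite_real_algebraic_set_uncountable:
  fixes P :: "('a::euclidean_space \<Rightarrow> real) set"
  assumes P: "\<And>f. f \<in> P \<Longrightarrow> polynomial_in Basis f"
    and inf: "infinite {p. \<forall>f\<in>P. f p = 0}"
  shows "uncountable {p. \<forall>f\<in>P. f p = 0}"
proof
  define E where "E = {p. \<forall>f\<in>P. f p = 0}"
  assume "countable {p. \<forall>f\<in>P. f p = 0}"
  then have countable: "countable E" by (simp add: E_def)
  obtain F where F: "F \<subseteq> E" "infinite F" "irreducible_set F"
    using infinite_set_contains_irreducible inf unfolding E_def by blast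
  obtain b where b: "b \<in> Basis" "infinite ((\<lambda>p. p \<bullet> b) ` F)"
    using infinite_coordinate[OF F(2)] .
  \<comment> \<open>A coordinate with infinitely many values on \<open>F\<close> satisfies no
    nonzero relation in one variable.\<close>
  have "f = (\<lambda>_. 0)" if "polynomial_in {b} f" and van: "vanishes F f" for f
  proof -
    obtain r where r: "f = (\<lambda>p. poly r (p \<bullet> b))" using polynomial_in_singleton \<open>polynomial_in {b} f\<close> by blast
    have "(\<lambda>p. p \<bullet> b) ` F \<subseteq> {x. poly r x = 0}" using van by (auto simp: vanishes_def r)
    then have "r = 0" using b(2) poly_roots_finite finite_subset by blast
    then show ?thesis by (simp add: r)
  qed
  moreover have "F \<noteq> {}" using F(2) by auto
  ultimately obtain v where v: "polynomial_field v" "\<not> vanishes F (\<lambda>p. v p \<bullet> b)"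
    "\<And>f. polynomial_in Basis f \<Longrightarrow> vanishes F f \<Longrightarrow> vanishes F (deriv_along v f)"
    using tangent_field[OF F(3) _ b(1), of "Basis - {b}"] b(1) by (auto simp: insert_absorb)
  obtain q where q: "q \<in> F" "v q \<bullet> b \<noteq> 0" using v(2) by (auto simp: vanishes_def)
  obtain r \<gamma> where r: "0 < r" and \<gamma>: "\<And>f t. polynomial_in Basis f \<Longrightarrow> \<bar>t\<bar> < r \<Longrightarrow>
      (\<lambda>k. flow_coeff v k f q * t ^ k) sums f (\<gamma> t)"
    using flow_curve[OF v(1), where q = q] by blast
  have \<gamma>_E: "\<gamma> t \<in> E" if t: "\<bar>t\<bar> < r" for t
    unfolding E_def
  proof (intro CollectI ballI)
    fix f assume f: "f \<in> P"
    \<comment> \<open>All iterated derivatives of an equation of \<open>E\<close> vanish on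
      \<open>F\<close>, hence at \<open>q\<close>, so the series of that equation along the curve is
      zero.\<close>
    have "vanishes F f" using F(1) f by (auto simp: vanishes_def E_def)
    then have "vanishes F ((deriv_along v ^^ k) f)" for k
      using v(3)[OF polynomial_in_iterated_deriv[OF P[OF f] v(1)]] by (induction k) simp_all
    then have "flow_coeff v k f q = 0" for k
      using q by (simp add: vanishes_def flow_coeff_def)
    then show "f (\<gamma> t) = 0" using \<gamma>[OF P[OF f] t] by (simp add: sums_iff)
  qed
  define a where "a = (\<lambda>k. flow_coeff v k (\<lambda>p. p \<bullet> b) q)"
  define x where "x = (\<lambda>t. \<Sum>k. a k * t ^ k)"
  have x: "x t = \<gamma> t \<bullet> b" "summable (\<lambda>k. a k * t ^ k)" if "\<bar>t\<bar> < r" for t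
    using \<gamma>[OF polynomial_in.coord[OF b(1)] that] by (auto simp: x_def a_def sums_iff)
  have deriv: "DERIV x t :> (\<Sum>n. diffs a n * t ^ n)" if "\<bar>t\<bar> < r" for t
    unfolding x_def
  proof (rule termdiffs_strong)
    show "summable (\<lambda>k. a k * ((\<bar>t\<bar> + r) / 2) ^ k)" using that by (intro x) auto
    show "norm t < norm ((\<bar>t\<bar> + r) / 2)" using that by auto
  qed
  \<comment> \<open>A countable connected set of reals has at most one point. So the coordinate
    would be constant along the curve, although its derivative at 0 is
    \<open>v q \<bullet> b\<close>.\<close>
  have "continuous_on {-r<..<r} x"
    by (intro continuous_at_imp_continuous_on ballI DERIV_isCont[OF deriv]) auto
  then have "connected (x ` {-r<..<r})" by (intro connected_continuous_image) auto
  moreover have "x ` {-r<..<r} \<subseteq> (\<lambda>p. p \<bullet> b) ` E"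
    using \<gamma>_E x(1) by (auto simp: image_iff intro!: bexI abs_less_iff[THEN iffD2])
  then have "countable (x ` {-r<..<r})" by (rule countable_subset) (intro countable_image countable)
  ultimately have const: "x s = x t" if "s \<in> {-r<..<r}" "t \<in> {-r<..<r}" for s t
    using connected_uncountable[of "x ` {-r<..<r}" "x s" "x t"] that by blast
  have "DERIV x 0 :> 0"
  proof (rule has_field_derivative_transform_within)
    show "((\<lambda>_. x 0) has_field_derivative 0) (at 0)" by simp
    show "0 < r" by fact
    show "x 0 = x t" if "dist t 0 < r" for t using that r by (intro const) auto
  qed simp
  moreover have "DERIV x 0 :> a 1"
    using deriv[of 0] r by (simp add: powser_zero diffs_def)
  ultimately have "a 1 = 0" by (rule DERIV_unique[symmetric])
  moreover have "a 1 = v q \<bullet> b" by (simp add: a_def flow_coeff_def deriv_along_coord)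
  ultimately show False using q by simp
qed

section \<open>Shift-invariant spaces of bounded functions\<close>

text \<open>These closure properties are inherited by eigenspaces of shifts, which the induction
  over coordinates needs. Sequential limits are enough for compactness arguments because the lattice
  is countable.\<close>

locale shift_space =
  fixes Y :: "(int ^ 'd::finite \<Rightarrow> complex) set"
  assumes zero_mem: "(\<lambda>_. 0) \<in> Y"
    and lincomb: "f \<in> Y \<Longrightarrow> g \<in> Y \<Longrightarrow> (\<lambda>x. f x + c * g x) \<in> Y"
    and shift: "f \<in> Y \<Longrightarrow> (\<lambda>x. f (x + h)) \<in> Y"
    and bounded: "f \<in> Y \<Longrightarrow> \<exists>M. \<forall>x. cmod (f x) \<le> M"
    and limit: "(\<And>n. F n \<in> Y) \<Longrightarrow> (\<And>n x. cmod (F n x) \<le> M) \<Longrightarrow> (\<And>x. (\<lambda>n. F n x) \<longlonglongrightarrow> f x) \<Longrightarrow> f \<in> Y"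
begin

lemma scale: "f \<in> Y \<Longrightarrow> (\<lambda>x. c * f x) \<in> Y"
  using lincomb[OF zero_mem, of f c] by simp

lemma add: "f \<in> Y \<Longrightarrow> g \<in> Y \<Longrightarrow> (\<lambda>x. f x + g x) \<in> Y"
  using lincomb[of f g 1] by simp

lemma diff: "f \<in> Y \<Longrightarrow> g \<in> Y \<Longrightarrow> (\<lambda>x. f x - g x) \<in> Y"
  using lincomb[of f g "-1"] by simp

lemma sum: "(\<And>i. i \<in> I \<Longrightarrow> f i \<in> Y) \<Longrightarrow> (\<lambda>x. \<Sum>i\<in>I. f i x) \<in> Y"
  by (induction I rule: infinite_finite_induct) (simp_all add: zero_mem add)

lemma obtain_bound:
  assumes "f \<in> Y"
  obtains M where "0 \<le> M" "\<And>x. cmod (f x) \<le> M"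
  using bounded[OF assms] by (metis norm_ge_zero order_trans)

lemma convergent_subsequence:
  fixes F :: "nat \<Rightarrow> int ^ 'd \<Rightarrow> complex"
  assumes "\<And>n. F n \<in> Y" and M: "\<And>n x. cmod (F n x) \<le> M"
  obtains k f where "strict_mono k" "f \<in> Y" "\<And>x. (\<lambda>n. F (k n) x) \<longlonglongrightarrow> f x"
proof -
  obtain k where k: "strict_mono (k :: nat \<Rightarrow> nat)" "\<And>x. x \<in> UNIV \<Longrightarrow> \<exists>l. (\<lambda>n. F (k n) x) \<longlonglongrightarrow> l"
    by (rule function_convergent_subsequence[of UNIV F M]) (use M in auto)
  then obtain f where f: "\<And>x. (\<lambda>n. F (k n) x) \<longlonglongrightarrow> f x" by (metis UNIV_I)
  have "f \<in> Y" by (rule limit[of "\<lambda>n. F (k n)" M]) (use assms f in auto)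
  then show ?thesis using that k f by blast
qed

text \<open>The convention is reciprocal to the usual one: the shift by \<open>e\<close> multiplies
  \<open>w\<close> by \<open>1 / l\<close>. Thus the resolvent equation
  \<open>u x - l * u (x + e) = y x\<close> is solved at \<open>l = 0\<close> by \<open>y\<close>
  itself.\<close>

definition eigenvalues :: "int ^ 'd \<Rightarrow> complex set" where
  "eigenvalues e = {l. \<exists>w\<in>Y. (\<exists>x. w x \<noteq> 0) \<and> (\<forall>x. w x = l * w (x + e))}"

text \<open>An approximate eigenvector can be translated so that its mass near the origin survives a
  pointwise limit; hence every approximate eigenvalue is an eigenvalue.\<close>

lemma approximate_eigenvector:
  assumes u: "\<And>n. u n \<in> Y" "\<And>n x. cmod (u n x) \<le> 2" "\<And>n. 1 \<le> cmod (u n (p n))"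
    and approx: "\<And>n x. cmod (u n x - l n * u n (x + e)) \<le> \<delta> n"
    and lims: "l \<longlonglongrightarrow> l0" "\<delta> \<longlonglongrightarrow> 0"
  shows "l0 \<in> eigenvalues e"
proof -
  define F where "F = (\<lambda>n x. u n (x + p n))"
  have "F n \<in> Y" for n unfolding F_def using u shift by blast
  moreover have "cmod (F n x) \<le> 2" for n x using u by (simp add: F_def)
  ultimately obtain k w where k: "strict_mono k" "w \<in> Y" "\<And>x. (\<lambda>n. F (k n) x) \<longlonglongrightarrow> w x"
    using convergent_subsequence by blast
  have "1 \<le> cmod (w 0)"
    by (rule LIMSEQ_le_const[OF tendsto_norm[OF k(3)]]) (use u in \<open>auto simp: F_def\<close>)
  then have "w 0 \<noteq> 0" by auto
  moreover have "w x = l0 * w (x + e)" for x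
  proof -
    have "(\<lambda>n. F (k n) x - l (k n) * F (k n) (x + e)) \<longlonglongrightarrow> w x - l0 * w (x + e)"
      by (intro tendsto_intros k LIMSEQ_subseq_LIMSEQ[OF lims(1) k(1), unfolded o_def])
    moreover have "(\<lambda>n. F (k n) x - l (k n) * F (k n) (x + e)) \<longlonglongrightarrow> 0"
    proof (rule Lim_null_comparison)
      show "(\<lambda>n. \<delta> (k n)) \<longlonglongrightarrow> 0" by (rule LIMSEQ_subseq_LIMSEQ[OF lims(2) k(1), unfolded o_def])
      show "\<forall>\<^sub>F n in sequentially. cmod (F (k n) x - l (k n) * F (k n) (x + e)) \<le> \<delta> (k n)"
        using approx[of "k n" "x + p (k n)" for n] by (intro always_eventually) (simp add: F_def algebra_simps)
    qed
    ultimately show ?thesis using LIMSEQ_unique by fastforce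
  qed
  ultimately show ?thesis unfolding eigenvalues_def using k(2) by blast
qed

text \<open>If the bound failed arbitrarily close to \<open>l0\<close>, the normalised
  counterexamples would be approximate eigenvectors for \<open>l0\<close>. Uniformity in
  \<open>l\<close> later gives the continuity of the resolvent and its existence on the unit
  circle.\<close>

lemma bounded_below:
  assumes "l0 \<notin> eigenvalues e"
  obtains \<epsilon> C where "0 < \<epsilon>" "0 \<le> C" "\<And>l u M x. dist l l0 < \<epsilon> \<Longrightarrow> u \<in> Y \<Longrightarrow>
    (\<And>x. cmod (u x - l * u (x + e)) \<le> M) \<Longrightarrow> cmod (u x) \<le> C * M"
proof -
  have "\<exists>n. \<forall>l u M x. dist l l0 < 1 / real (Suc n) \<longrightarrow> u \<in> Y \<longrightarrow>
      (\<forall>x. cmod (u x - l * u (x + e)) \<le> M) \<longrightarrow> cmod (u x) \<le> real (Suc n) * M"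
  proof (rule ccontr)
    assume "\<not> ?thesis"
    then have "\<forall>n. \<exists>l u M x. dist l l0 < 1 / real (Suc n) \<and> u \<in> Y \<and>
      (\<forall>x. cmod (u x - l * u (x + e)) \<le> M) \<and> real (Suc n) * M < cmod (u x)"
      by (meson not_le)
    then obtain l u M x where *: "\<And>n. dist (l n) l0 < 1 / real (Suc n)" "\<And>n. u n \<in> Y"
      "\<And>n z. cmod (u n z - l n * u n (z + e)) \<le> M n" "\<And>n. real (Suc n) * M n < cmod (u n (x n))"
      by metis
    define S where "S = (\<lambda>n. SUP z. cmod (u n z))"
    have bdd: "bdd_above (range (\<lambda>z. cmod (u n z)))" for n
      using bounded[OF *(2)[of n]] by (auto simp: bdd_above_def)
    have le_S: "cmod (u n z) \<le> S n" for n z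
      unfolding S_def by (intro cSUP_upper bdd) auto
    have M0: "0 \<le> M n" for n using *(3)[of n 0] norm_ge_zero order_trans by blast
    have S_pos: "0 < S n" "real (Suc n) * M n < S n" for n
    proof -
      show "real (Suc n) * M n < S n" using *(4)[of n] le_S[of n "x n"] by linarith
      moreover have "0 \<le> real (Suc n) * M n" using M0[of n] by simp
      ultimately show "0 < S n" by linarith
    qed
    have "\<exists>z. S n / 2 < cmod (u n z)" for n
    proof -
      have "S n / 2 < S n" using S_pos(1)[of n] by simp
      then show ?thesis using less_cSUP_iff[OF _ bdd, of "S n / 2" n] unfolding S_def by auto
    qed
    then obtain p where p: "\<And>n. S n / 2 < cmod (u n (p n))" by metis
    \<comment> \<open>The factor \<open>2 / S n\<close> turns the supremum into 2 and the value at
      \<open>p n\<close>, which exceeds half the supremum, into at least 1.\<close>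
    have "l0 \<in> eigenvalues e"
    proof (rule approximate_eigenvector[where u = "\<lambda>n z. of_real (2 / S n) * u n z" and p = p and l = l
          and \<delta> = "\<lambda>n. 2 / real (Suc n)"])
      fix n z
      show "(\<lambda>z. of_real (2 / S n) * u n z) \<in> Y" using * scale by blast
      show "cmod (of_real (2 / S n) * u n z) \<le> 2"
        using le_S[of n z] S_pos(1)[of n] by (simp add: norm_mult norm_divide divide_simps)
      show "1 \<le> cmod (of_real (2 / S n) * u n (p n))"
        using p[of n] S_pos(1)[of n] by (simp add: norm_mult norm_divide divide_simps)
      have "of_real (2 / S n) * u n z - l n * (of_real (2 / S n) * u n (z + e)) =
          of_real (2 / S n) * (u n z - l n * u n (z + e))"
        by (simp add: algebra_simps)
      then have "cmod (of_real (2 / S n) * u n z - l n * (of_real (2 / S n) * u n (z + e))) =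
          2 / S n * cmod (u n z - l n * u n (z + e))"
        using S_pos(1)[of n] by (simp only: norm_mult norm_of_real) simp
      also have "\<dots> \<le> 2 / S n * M n" using *(3) S_pos(1)[of n] by (intro mult_left_mono) auto
      also have "\<dots> \<le> 2 / real (Suc n)" using S_pos[of n] by (simp add: divide_simps mult.commute)
      finally show "cmod (of_real (2 / S n) * u n z - l n * (of_real (2 / S n) * u n (z + e))) \<le> 2 / real (Suc n)" .
    next
      show "l \<longlonglongrightarrow> l0"
        by (rule metric_tendsto_imp_tendsto[OF LIMSEQ_inverse_real_of_nat])
           (use * in \<open>auto simp: divide_simps intro!: always_eventually less_imp_le\<close>)
      show "(\<lambda>n. 2 / real (Suc n)) \<longlonglongrightarrow> 0"
        using tendsto_mult_right_zero[OF LIMSEQ_inverse_real_of_nat, of 2] by (simp add: divide_inverse)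
    qed
    then show False using assms by simp
  qed
  then obtain n where n: "\<And>l u M x. dist l l0 < 1 / real (Suc n) \<Longrightarrow> u \<in> Y \<Longrightarrow>
      (\<And>x. cmod (u x - l * u (x + e)) \<le> M) \<Longrightarrow> cmod (u x) \<le> real (Suc n) * M" by blast
  show ?thesis by (rule that[of "1 / real (Suc n)" "real (Suc n)"]) (use n in auto)
qed

text \<open>The shift is an isometry for the supremum norm, so subtracting \<open>l\<close> times
  the shifted function can shrink the norm at most by the factor
  \<open>\<bar>cmod l - 1\<bar>\<close>.\<close>

lemma resolvent_growth:
  assumes u: "u \<in> Y" and M: "\<And>x. cmod (u x - l * u (x + e)) \<le> M"
  shows "cmod (u x) * \<bar>cmod l - 1\<bar> \<le> M"
proof -
  define S where "S = (SUP z. cmod (u z))"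
  have bdd: "bdd_above (range (\<lambda>z. cmod (u z)))"
    using bounded[OF u] by (auto simp: bdd_above_def)
  have le_S: "cmod (u z) \<le> S" for z unfolding S_def by (intro cSUP_upper bdd) auto
  have "S * \<bar>cmod l - 1\<bar> \<le> M"
  proof (cases "cmod l \<le> 1")
    case True
    have "cmod (u z) \<le> M + cmod l * S" for z
    proof -
      have "cmod (u z) \<le> cmod (u z - l * u (z + e)) + cmod (l * u (z + e))"
        by (metis norm_triangle_sub add.commute)
      also have "\<dots> \<le> M + cmod l * S"
        using M[of z] le_S[of "z + e"] by (auto simp: norm_mult intro!: add_mono mult_left_mono)
      finally show ?thesis .
    qed
    then have "S \<le> M + cmod l * S" unfolding S_def by (intro cSUP_least) (auto simp: S_def)
    then show ?thesis using True by (simp add: algebra_simps)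
  next
    case False
    have "cmod (u z) \<le> (M + S) / cmod l" for z
    proof -
      have "cmod l * cmod (u z) \<le> cmod (u (z - e) - l * u z) + cmod (u (z - e))"
        by (metis norm_mult norm_minus_commute norm_triangle_sub add.commute)
      also have "\<dots> \<le> M + S" using M[of "z - e"] le_S[of "z - e"] by simp
      finally show ?thesis using False by (subst pos_le_divide_eq) (auto simp: mult.commute)
    qed
    then have "S \<le> (M + S) / cmod l" unfolding S_def by (intro cSUP_least) (auto simp: S_def)
    then show ?thesis using False by (simp add: divide_simps algebra_simps split: if_splits)
  qed
  moreover have "cmod (u x) * \<bar>cmod l - 1\<bar> \<le> S * \<bar>cmod l - 1\<bar>"
    using le_S by (intro mult_right_mono) auto
  ultimately show ?thesis by linarith
qed

lemma eigenvalue_norm: "l \<in> eigenvalues e \<Longrightarrow> cmod l = 1"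
proof (rule ccontr)
  assume "l \<in> eigenvalues e" and ne: "cmod l \<noteq> 1"
  then obtain w x where w: "w \<in> Y" "w x \<noteq> 0" "\<And>x. w x = l * w (x + e)"
    unfolding eigenvalues_def by blast
  have "cmod (w z - l * w (z + e)) \<le> 0" for z using w(3)[of z] by simp
  then have "cmod (w x) * \<bar>cmod l - 1\<bar> \<le> 0" by (rule resolvent_growth[OF w(1)])
  then show False using ne w(2) by (simp add: mult_le_0_iff)
qed

lemma resolvent_unique:
  assumes "l \<notin> eigenvalues e" "u \<in> Y" "u' \<in> Y" "\<And>x. u x - l * u (x + e) = u' x - l * u' (x + e)"
  shows "u = u'"
proof -
  have "u x - u' x = l * (u (x + e) - u' (x + e))" for x
    using assms(4)[of x] by (simp add: algebra_simps)
  then have "l \<in> eigenvalues e" if "\<exists>x. u x - u' x \<noteq> 0"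
    unfolding eigenvalues_def
    by (intro CollectI bexI[of _ "\<lambda>x. u x - u' x"] conjI allI that diff assms(2,3))
  then have "u x - u' x = 0" for x using assms(1) by blast
  then show ?thesis by (simp add: fun_eq_iff)
qed

text \<open>The partial sums of the Neumann series lie in \<open>Y\<close> and are uniformly
  bounded, so the axiom \<open>limit\<close> applies.\<close>

lemma resolvent_exists_inside:
  assumes y: "y \<in> Y" and l: "cmod l < 1"
  shows "\<exists>u\<in>Y. \<forall>x. u x - l * u (x + e) = y x"
proof -
  obtain M where M: "0 \<le> M" "\<And>x. cmod (y x) \<le> M" using obtain_bound[OF y] by blast
  \<comment> \<open>The product \<open>of_nat k * e\<close> is componentwise, hence the sum of
    \<open>k\<close> copies of \<open>e\<close>.\<close>
  define F where "F = (\<lambda>n x. \<Sum>k<n. l ^ k * y (x + of_nat k * e))"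
  have F: "F n \<in> Y" for n unfolding F_def by (intro sum scale shift y)
  have F_bound: "cmod (F n x) \<le> M / (1 - cmod l)" for n x
  proof -
    have "cmod (F n x) \<le> (\<Sum>k<n. cmod l ^ k * M)"
      unfolding F_def by (rule sum_norm_le) (auto simp: norm_mult norm_power intro!: mult_left_mono M)
    also have "\<dots> = (\<Sum>k<n. cmod l ^ k) * M" by (simp add: sum_distrib_right)
    also have "\<dots> \<le> (1 / (1 - cmod l)) * M"
    proof (intro mult_right_mono M(1))
      have "(\<Sum>k<n. cmod l ^ k) \<le> (\<Sum>k. cmod l ^ k)"
        using l by (intro sum_le_suminf summable_geometric) auto
      then show "(\<Sum>k<n. cmod l ^ k) \<le> 1 / (1 - cmod l)" using l by (simp add: suminf_geometric)
    qed
    finally show ?thesis by simp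
  qed
  have "summable (\<lambda>k. l ^ k * y (x + of_nat k * e))" for x
  proof (rule summable_comparison_test')
    show "summable (\<lambda>k. cmod l ^ k * M)" using l by (intro summable_mult2 summable_geometric) auto
    show "cmod (l ^ k * y (x + of_nat k * e)) \<le> cmod l ^ k * M" for k
      by (auto simp: norm_mult norm_power intro!: mult_left_mono M)
  qed
  then have lim: "(\<lambda>n. F n x) \<longlonglongrightarrow> (\<Sum>k. l ^ k * y (x + of_nat k * e))" for x
    unfolding F_def by (rule summable_LIMSEQ)
  define u where "u = (\<lambda>x. \<Sum>k. l ^ k * y (x + of_nat k * e))"
  have "u \<in> Y" unfolding u_def by (rule limit[OF F F_bound lim])
  moreover have "u x - l * u (x + e) = y x" for x
  proof -
    have "F (Suc n) x = y x + l * F n (x + e)" for n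
      unfolding F_def sum.lessThan_Suc_shift sum_distrib_left
      by (simp add: algebra_simps)
    then have "(\<lambda>n. y x + l * F n (x + e)) \<longlonglongrightarrow> u x"
      using LIMSEQ_Suc[OF lim[of x]] by (simp add: u_def)
    moreover have "(\<lambda>n. y x + l * F n (x + e)) \<longlonglongrightarrow> y x + l * u (x + e)"
      unfolding u_def by (intro tendsto_intros lim)
    ultimately show ?thesis using LIMSEQ_unique by fastforce
  qed
  ultimately show ?thesis by blast
qed

text \<open>Outside the unit disc the inverse shift has a convergent Neumann series. On the unit
  circle the solutions at points approaching \<open>l\<close> radially from inside are uniformly
  bounded by \<open>bounded_below\<close>, and a pointwise limit of them solves the
  equation.\<close>

lemma resolvent_exists:
  assumes y: "y \<in> Y" and l: "l \<notin> eigenvalues e"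
  shows "\<exists>u\<in>Y. \<forall>x. u x - l * u (x + e) = y x"
proof -
  consider "cmod l < 1" | "cmod l > 1" | "cmod l = 1" by linarith
  then show ?thesis
  proof cases
    case 1
    then show ?thesis using resolvent_exists_inside y by blast
  next
    case 2
    have "(\<lambda>x. (- 1 / l) * y (x + - e)) \<in> Y" by (intro scale shift y)
    moreover have "cmod (1 / l) < 1"
    proof -
      have "0 < cmod l" using 2 by linarith
      then show ?thesis using 2 by (simp add: norm_divide divide_less_eq)
    qed
    ultimately obtain u where u: "u \<in> Y" "\<And>x. u x - (1 / l) * u (x + - e) = (- 1 / l) * y (x + - e)"
      using resolvent_exists_inside by blast
    have "u x - l * u (x + e) = y x" for x
    proof -
      have "l * (u (x + e) - (1 / l) * u x) = l * ((- 1 / l) * y x)"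
        using u(2)[of "x + e"] by simp
      moreover have "l \<noteq> 0" using 2 by auto
      ultimately show ?thesis by (simp add: algebra_simps)
    qed
    then show ?thesis using u by blast
  next
    case 3
    obtain M where M: "0 \<le> M" "\<And>x. cmod (y x) \<le> M" using obtain_bound[OF y] by blast
    obtain \<epsilon> C where C: "0 < \<epsilon>" "0 \<le> C" "\<And>m u M x. dist m l < \<epsilon> \<Longrightarrow> u \<in> Y \<Longrightarrow>
        (\<And>x. cmod (u x - m * u (x + e)) \<le> M) \<Longrightarrow> cmod (u x) \<le> C * M"
      using bounded_below[OF l] by metis
    \<comment> \<open>\<open>t n\<close> increases to 1; the minimum with 1 keeps it nonnegative,
      and the bound \<open>\<epsilon> / 2\<close> keeps \<open>m n\<close> within
      \<open>\<epsilon>\<close> of \<open>l\<close>.\<close>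
    define t where "t = (\<lambda>n. 1 - min (\<epsilon> / 2) 1 / real (Suc n))"
    define m where "m = (\<lambda>n. of_real (t n) * l)"
    have t: "0 \<le> t n" "t n < 1" "1 - t n < \<epsilon>" for n
    proof -
      have "min (\<epsilon> / 2) 1 / real (Suc n) \<le> min (\<epsilon> / 2) 1 / 1"
        using C(1) by (intro divide_left_mono) auto
      moreover have "0 < min (\<epsilon> / 2) 1 / real (Suc n)" using C(1) by (intro divide_pos_pos) auto
      ultimately show "0 \<le> t n" "t n < 1" "1 - t n < \<epsilon>" using C(1) by (auto simp: t_def)
    qed
    have "t \<longlonglongrightarrow> 1 - min (\<epsilon> / 2) 1 * 0"
      unfolding t_def divide_inverse by (intro tendsto_intros LIMSEQ_inverse_real_of_nat)
    then have m_lim: "m \<longlonglongrightarrow> of_real 1 * l" unfolding m_def by (intro tendsto_intros) simp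
    have "\<exists>u\<in>Y. \<forall>x. u x - m n * u (x + e) = y x" for n
      using 3 t[of n] by (intro resolvent_exists_inside y) (simp add: m_def norm_mult)
    then obtain u where u: "\<And>n. u n \<in> Y" "\<And>n x. u n x - m n * u n (x + e) = y x" by metis
    have "dist (m n) l < \<epsilon>" for n
    proof -
      have "m n - l = of_real (t n - 1) * l" by (simp add: m_def algebra_simps)
      then have "dist (m n) l = \<bar>t n - 1\<bar>" using 3 by (simp add: dist_norm norm_mult flip: of_real_diff)
      then show ?thesis using t[of n] by simp
    qed
    then have bd: "cmod (u n x) \<le> C * M" for n x
      by (rule C(3)[of "m n", OF _ u(1)]) (simp add: u(2) M)
    obtain k w where k: "strict_mono k" "w \<in> Y" "\<And>x. (\<lambda>n. u (k n) x) \<longlonglongrightarrow> w x"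
      by (rule convergent_subsequence[of u "C * M", OF u(1) bd]) (rule that)
    have "w x - l * w (x + e) = y x" for x
    proof -
      have "(\<lambda>n. u (k n) x - m (k n) * u (k n) (x + e)) \<longlonglongrightarrow> w x - (of_real 1 * l) * w (x + e)"
        by (intro tendsto_intros k LIMSEQ_subseq_LIMSEQ[OF m_lim k(1), unfolded o_def])
      then have "(\<lambda>_. y x) \<longlonglongrightarrow> w x - l * w (x + e)" using u(2) by simp
      then show ?thesis by (simp add: LIMSEQ_const_iff)
    qed
    then show ?thesis using k(2) by blast
  qed
qed

definition resolvent :: "int ^ 'd \<Rightarrow> complex \<Rightarrow> (int ^ 'd \<Rightarrow> complex) \<Rightarrow> int ^ 'd \<Rightarrow> complex" where
  "resolvent e l y = (SOME u. u \<in> Y \<and> (\<forall>x. u x - l * u (x + e) = y x))"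

lemma resolvent:
  assumes "y \<in> Y" "l \<notin> eigenvalues e"
  shows "resolvent e l y \<in> Y" "resolvent e l y x - l * resolvent e l y (x + e) = y x"
proof -
  have "\<exists>u. u \<in> Y \<and> (\<forall>x. u x - l * u (x + e) = y x)" using resolvent_exists[OF assms] by blast
  from someI_ex[OF this]
  show "resolvent e l y \<in> Y" "resolvent e l y x - l * resolvent e l y (x + e) = y x"
    unfolding resolvent_def by blast+
qed

text \<open>By \<open>resolvent_unique\<close> it suffices that both sides, as functions in
  \<open>Y\<close>, have the same image under the operator inverted by the resolvent at
  \<open>l\<close>.\<close>

lemma resolvent_identity:
  assumes y: "y \<in> Y" and l: "l \<notin> eigenvalues e" and m: "m \<notin> eigenvalues e"
  shows "resolvent e l y x - resolvent e m y x =
    (l - m) * resolvent e l (\<lambda>x. resolvent e m y (x + e)) x"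
proof -
  let ?u = "resolvent e m y"
  have T: "(\<lambda>x. ?u (x + e)) \<in> Y" by (intro shift resolvent y m)
  have "(\<lambda>x. resolvent e l y x - ?u x) = (\<lambda>x. (l - m) * resolvent e l (\<lambda>x. ?u (x + e)) x)"
  proof (rule resolvent_unique[OF l])
    fix x
    have 1: "resolvent e l y x = y x + l * resolvent e l y (x + e)"
      using resolvent(2)[OF y l, of x] by (simp add: algebra_simps)
    have 2: "?u x = y x + m * ?u (x + e)"
      using resolvent(2)[OF y m, of x] by (simp add: algebra_simps)
    have 3: "resolvent e l (\<lambda>x. ?u (x + e)) x = ?u (x + e) + l * resolvent e l (\<lambda>x. ?u (x + e)) (x + e)"
      using resolvent(2)[OF T l, of x] by (simp add: algebra_simps)
    show "resolvent e l y x - ?u x - l * (resolvent e l y (x + e) - ?u (x + e)) =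
        (l - m) * resolvent e l (\<lambda>x. ?u (x + e)) x - l * ((l - m) * resolvent e l (\<lambda>x. ?u (x + e)) (x + e))"
      unfolding 1 2 3 by (simp add: algebra_simps)
  qed (intro diff scale resolvent y l m T)+
  then show ?thesis by (simp add: fun_eq_iff)
qed

lemma resolvent_continuous:
  assumes y: "y \<in> Y" and m: "m \<notin> eigenvalues e"
  shows "((\<lambda>l. resolvent e l y x) \<longlongrightarrow> resolvent e m y x) (at m within - eigenvalues e)"
proof -
  let ?u = "resolvent e m y"
  have T: "(\<lambda>x. ?u (x + e)) \<in> Y" by (intro shift resolvent y m)
  obtain M where M: "0 \<le> M" "\<And>x. cmod (?u (x + e)) \<le> M" using obtain_bound[OF T] by blast
  obtain \<epsilon> C where C: "0 < \<epsilon>" "0 \<le> C" "\<And>l u M x. dist l m < \<epsilon> \<Longrightarrow> u \<in> Y \<Longrightarrow>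
      (\<And>x. cmod (u x - l * u (x + e)) \<le> M) \<Longrightarrow> cmod (u x) \<le> C * M"
    using bounded_below[OF m] by metis
  have "((\<lambda>l. resolvent e l y x - ?u x) \<longlongrightarrow> 0) (at m within - eigenvalues e)"
  proof (rule Lim_null_comparison)
    show "\<forall>\<^sub>F l in at m within - eigenvalues e. cmod (resolvent e l y x - ?u x) \<le> cmod (l - m) * (C * M)"
      unfolding eventually_at
    proof (intro exI[of _ \<epsilon>] conjI ballI impI)
      fix l assume l: "l \<in> - eigenvalues e" "l \<noteq> m \<and> dist l m < \<epsilon>"
      have "cmod (resolvent e l (\<lambda>x. ?u (x + e)) x) \<le> C * M"
        by (rule C(3)) (use l resolvent[OF T] M in auto)
      then show "cmod (resolvent e l y x - ?u x) \<le> cmod (l - m) * (C * M)"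
        using l m by (subst resolvent_identity[OF y]) (auto simp: norm_mult intro!: mult_left_mono)
    qed (use C in auto)
    have "((\<lambda>l. cmod (l - m) * (C * M)) \<longlongrightarrow> cmod (m - m) * (C * M)) (at m within - eigenvalues e)"
      by (intro tendsto_intros)
    then show "((\<lambda>l. cmod (l - m) * (C * M)) \<longlongrightarrow> 0) (at m within - eigenvalues e)" by simp
  qed
  then show ?thesis using Lim_null by blast
qed

text \<open>The resolvent identity turns the difference quotient at \<open>m\<close> into the
  resolvent at \<open>l\<close> of the fixed function \<open>?w\<close>, which is continuous in
  \<open>l\<close>.\<close>

lemma resolvent_holomorphic:
  assumes y: "y \<in> Y"
  shows "(\<lambda>l. resolvent e l y x) holomorphic_on - eigenvalues e"
  unfolding holomorphic_on_def field_differentiable_def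
proof (intro ballI exI)
  fix m assume "m \<in> - eigenvalues e"
  then have m: "m \<notin> eigenvalues e" by simp
  let ?w = "\<lambda>x. resolvent e m y (x + e)"
  have w: "?w \<in> Y" by (intro shift resolvent y m)
  have "((\<lambda>l. (resolvent e l y x - resolvent e m y x) / (l - m)) \<longlongrightarrow> resolvent e m ?w x) (at m within - eigenvalues e)"
  proof (rule Lim_transform_within[OF resolvent_continuous[OF w m], of 1])
    fix l assume "l \<in> - eigenvalues e" "0 < dist l m"
    then show "resolvent e l ?w x = (resolvent e l y x - resolvent e m y x) / (l - m)"
      using m by (subst resolvent_identity[OF y]) auto
  qed simp
  then show "((\<lambda>l. resolvent e l y x) has_field_derivative resolvent e m ?w x) (at m within - eigenvalues e)"
    by (simp add: has_field_derivative_iff)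
qed

end

text \<open>On the circle of radius \<open>r\<close> around \<open>l0\<close> we have
  \<open>(l - l0)\<^sup>2 + r\<^sup>2 l0 (l - l0) + r\<^sup>2 l0\<^sup>2 = l0 (l - l0) (\<bar>l\<bar>\<^sup>2 - 1)\<close>, which compensates the growth
  of \<open>G\<close> where the circle meets the unit circle.\<close>

lemma residue_eq_0_of_circle_growth:
  assumes l0: "cmod l0 = 1" and \<rho>: "0 < \<rho>"
    and G: "G holomorphic_on ball l0 \<rho> - {l0}" and h: "h holomorphic_on ball l0 \<rho>"
    and growth: "\<And>l. l \<in> ball l0 \<rho> - {l0} \<Longrightarrow> cmod (G l) * \<bar>cmod l - 1\<bar> \<le> C"
  shows "residue (\<lambda>l. G l * (l - l0) * h l) l0 = 0"
proof -
  \<comment> \<open>Radii below 1 give \<open>cmod l \<le> 2\<close> on the circles, hence the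
    factor 3 as a bound for \<open>cmod l + 1\<close>.\<close>
  define \<rho>' where "\<rho>' = min (\<rho> / 2) 1"
  have \<rho>': "0 < \<rho>'" "\<rho>' < \<rho>" "\<rho>' \<le> 1" using \<rho> by (auto simp: \<rho>'_def)
  have "continuous_on (cball l0 \<rho>') h"
    by (rule holomorphic_on_imp_continuous_on, rule holomorphic_on_subset[OF h]) (use \<rho>' in auto)
  then have "bounded (h ` cball l0 \<rho>')" by (intro compact_imp_bounded compact_continuous_image) auto
  then obtain H where H: "0 < H" "\<And>l. l \<in> cball l0 \<rho>' \<Longrightarrow> cmod (h l) \<le> H"
    by (auto simp: bounded_pos)
  define f1 f0 fm where "f1 = (\<lambda>l. G l * (l - l0) * h l)" and "f0 = (\<lambda>l. G l * h l)"
    and "fm = (\<lambda>l. G l * h l / (l - l0))"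
  have h': "h holomorphic_on ball l0 \<rho> - {l0}" by (rule holomorphic_on_subset[OF h]) auto
  have hol: "f1 holomorphic_on ball l0 \<rho> - {l0}" "f0 holomorphic_on ball l0 \<rho> - {l0}"
    "fm holomorphic_on ball l0 \<rho> - {l0}"
    unfolding f1_def f0_def fm_def using G h' by (auto intro!: holomorphic_intros)
  define R1 R0 Rm where "R1 = residue f1 l0" and "R0 = residue f0 l0" and "Rm = residue fm l0"
  \<comment> \<open>The three residues do not depend on \<open>r\<close>. Integrating over a circle
    of length \<open>2 * pi * r\<close> bounds their weighted sum by a multiple of \<open>r\<close>,
    and for \<open>r\<close> tending to 0 only \<open>R1\<close> remains.\<close>
  have bound: "cmod (R1 + of_real (r\<^sup>2) * l0 * R0 + of_real (r\<^sup>2) * l0\<^sup>2 * Rm) \<le> 3 * C * H * r"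
    if r: "0 < r" "r < \<rho>'" for r
  proof -
    define W where "W = R1 + of_real (r\<^sup>2) * l0 * R0 + of_real (r\<^sup>2) * l0\<^sup>2 * Rm"
    let ?f = "\<lambda>l. f1 l + of_real (r\<^sup>2) * l0 * f0 l + of_real (r\<^sup>2) * l0\<^sup>2 * fm l"
    have res: "(f has_contour_integral 2 * pi * \<i> * residue f l0) (circlepath l0 r)"
      if "f holomorphic_on ball l0 \<rho> - {l0}" for f
      using r \<rho>' that \<rho> by (intro base_residue[of "ball l0 \<rho>"]) auto
    have int: "(?f has_contour_integral (2 * pi * \<i> * R1 + of_real (r\<^sup>2) * l0 * (2 * pi * \<i> * R0) +
        of_real (r\<^sup>2) * l0\<^sup>2 * (2 * pi * \<i> * Rm))) (circlepath l0 r)"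
      unfolding R1_def R0_def Rm_def
      by (intro has_contour_integral_add has_contour_integral_lmul res hol)
    have "cmod (2 * pi * \<i> * R1 + of_real (r\<^sup>2) * l0 * (2 * pi * \<i> * R0) +
        of_real (r\<^sup>2) * l0\<^sup>2 * (2 * pi * \<i> * Rm)) \<le> (3 * C * H) * (2 * pi * r)"
    proof (rule has_contour_integral_bound_circlepath[OF int])
      have "l0 + of_real r \<in> ball l0 \<rho> - {l0}" using r \<rho>' by (auto simp: dist_norm)
      then have "0 \<le> C" using growth by (meson abs_ge_zero mult_nonneg_nonneg norm_ge_zero order_trans)
      then show "0 \<le> 3 * C * H" using H by simp
      fix l assume l: "cmod (l - l0) = r"
      have l_in: "l \<in> ball l0 \<rho> - {l0}" "l \<in> cball l0 \<rho>'"
        using l r \<rho>' by (auto simp: dist_norm norm_minus_commute)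
      have "of_real (r\<^sup>2) = (l - l0) * cnj (l - l0)"
        using l by (simp add: complex_norm_square[symmetric] del: complex_cnj_diff)
      moreover have "l0 * cnj l0 = 1" using l0 by (metis complex_norm_square of_real_1 power_one)
      moreover have "of_real ((cmod l)\<^sup>2) = l * cnj l" by (rule complex_norm_square)
      ultimately have "(l - l0)\<^sup>2 + of_real (r\<^sup>2) * l0 * (l - l0) + of_real (r\<^sup>2) * l0\<^sup>2 =
          l0 * (l - l0) * of_real ((cmod l)\<^sup>2 - 1)"
        unfolding of_real_diff complex_cnj_diff of_real_1 by algebra
      moreover have "?f l * (l - l0) = G l * h l * ((l - l0)\<^sup>2 + of_real (r\<^sup>2) * l0 * (l - l0) + of_real (r\<^sup>2) * l0\<^sup>2)"
        using l_in by (simp add: f1_def f0_def fm_def field_simps power2_eq_square)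
      ultimately have "?f l * (l - l0) = G l * h l * (l0 * (l - l0) * of_real ((cmod l)\<^sup>2 - 1))"
        by (simp only:)
      then have "?f l * (l - l0) = (G l * h l * l0 * of_real ((cmod l)\<^sup>2 - 1)) * (l - l0)"
        by (simp only: mult_ac)
      moreover have "l - l0 \<noteq> 0" using l_in by auto
      ultimately have eq: "?f l = G l * h l * l0 * of_real ((cmod l)\<^sup>2 - 1)"
        using mult_right_cancel by blast
      have "cmod l \<le> cmod l0 + cmod (l - l0)" by (metis norm_triangle_sub)
      then have l2: "cmod l + 1 \<le> 3" using l l0 r \<rho>' by simp
      have "cmod (?f l) = (cmod (G l) * \<bar>cmod l - 1\<bar>) * cmod (h l) * (cmod l + 1)"
      proof -
        have "\<bar>(cmod l)\<^sup>2 - 1\<bar> = \<bar>cmod l - 1\<bar> * (cmod l + 1)"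
          by (simp add: power2_eq_square square_diff_one_factored abs_mult)
        then show ?thesis unfolding eq norm_mult norm_of_real l0 by simp
      qed
      also have "\<dots> \<le> C * H * 3"
        using growth[OF l_in(1)] H(2)[OF l_in(2)] l2 \<open>0 \<le> C\<close> H(1) by (intro mult_mono) auto
      finally show "cmod (?f l) \<le> 3 * C * H" by simp
    qed (use r in auto)
    moreover have "2 * pi * \<i> * R1 + of_real (r\<^sup>2) * l0 * (2 * pi * \<i> * R0) +
        of_real (r\<^sup>2) * l0\<^sup>2 * (2 * pi * \<i> * Rm) =
        of_real (2 * pi) * (\<i> * (R1 + of_real (r\<^sup>2) * l0 * R0 + of_real (r\<^sup>2) * l0\<^sup>2 * Rm))"
      by (simp add: algebra_simps)
    ultimately have "cmod (of_real (2 * pi) * (\<i> * W)) \<le> (3 * C * H) * (2 * pi * r)"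
      by (simp only: W_def)
    then have "2 * pi * cmod W \<le> 2 * pi * (3 * C * H * r)"
      by (simp add: norm_mult mult_ac)
    then have "cmod W \<le> 3 * C * H * r" by (rule mult_left_le_imp_le) simp
    then show ?thesis by (simp only: W_def)
  qed
  have "((\<lambda>r. cmod (R1 + of_real (r\<^sup>2) * l0 * R0 + of_real (r\<^sup>2) * l0\<^sup>2 * Rm)) \<longlongrightarrow>
      cmod (R1 + of_real (0\<^sup>2) * l0 * R0 + of_real (0\<^sup>2) * l0\<^sup>2 * Rm)) (at_right 0)"
    by (intro tendsto_intros)
  moreover have "((\<lambda>r. 3 * C * H * r) \<longlongrightarrow> 3 * C * H * 0) (at_right 0)" by (intro tendsto_intros)
  moreover have "\<forall>\<^sub>F r in at_right 0. cmod (R1 + of_real (r\<^sup>2) * l0 * R0 + of_real (r\<^sup>2) * l0\<^sup>2 * Rm) \<le> 3 * C * H * r"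
    using bound \<rho>'(1) by (auto simp: eventually_at_right_field)
  ultimately have "cmod (R1 + of_real (0\<^sup>2) * l0 * R0 + of_real (0\<^sup>2) * l0\<^sup>2 * Rm) \<le> 3 * C * H * 0"
    by (intro tendsto_le[OF trivial_limit_at_right_real])
  then show ?thesis by (simp add: R1_def f1_def)
qed

section \<open>Decomposition into eigenvectors of one shift\<close>

context shift_space
begin

lemma resolvent_shift:
  assumes "y \<in> Y" "l \<notin> eigenvalues e" "l \<noteq> 0"
  shows "resolvent e l y (x + e) = (resolvent e l y x - y x) / l"
  using resolvent(2)[OF assms(1,2), of x] assms(3) by (simp add: field_simps)

text \<open>The summand at \<open>l\<close> is minus the residue of \<open>G x m / m\<close> there.
  The residue at 0 is \<open>y x\<close>, and all residues together add up to 0 because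
  \<open>G x m\<close> tends to 0 as \<open>m\<close> grows.\<close>

lemma eigenvector_sum:
  assumes y: "y \<in> Y" and fin: "finite (eigenvalues e)"
  shows "\<exists>v. (\<forall>l\<in>eigenvalues e. \<forall>x. v l x = l * v l (x + e)) \<and> (\<forall>x. y x = (\<Sum>l\<in>eigenvalues e. v l x))"
proof -
  define \<Lambda> where "\<Lambda> = eigenvalues e"
  define G where "G = (\<lambda>x l. resolvent e l y x)"
  define v where "v = (\<lambda>l x. - residue (\<lambda>m. G x m / m) l)"
  have G_hol: "G x holomorphic_on - \<Lambda>" for x
    unfolding G_def \<Lambda>_def by (rule resolvent_holomorphic[OF y])
  have norm1: "cmod l = 1" if "l \<in> \<Lambda>" for l using that eigenvalue_norm by (simp add: \<Lambda>_def)
  have zero: "0 \<notin> \<Lambda>" using norm1 by force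
  obtain M where M: "0 \<le> M" "\<And>x. cmod (y x) \<le> M" using obtain_bound[OF y] by blast
  have growth: "cmod (G x l) * \<bar>cmod l - 1\<bar> \<le> M" if "l \<notin> \<Lambda>" for x l
    unfolding G_def using that M resolvent[OF y, of l e]
    by (intro resolvent_growth[where e = e]) (auto simp: \<Lambda>_def)
  have eigen: "v l x = l * v l (x + e)" if l: "l \<in> \<Lambda>" for l x
  proof -
    have "open (- (\<Lambda> - {l} \<union> {0}))" using fin by (intro open_Compl finite_imp_closed) (auto simp: \<Lambda>_def)
    moreover have "l \<in> - (\<Lambda> - {l} \<union> {0})" using l zero by auto
    ultimately obtain \<rho> where \<rho>: "0 < \<rho>" "ball l \<rho> \<subseteq> - (\<Lambda> - {l} \<union> {0})"
      using open_contains_ball by blast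
    then have in1: "ball l \<rho> - {l} \<subseteq> - \<Lambda>" and in2: "\<And>m. m \<in> ball l \<rho> \<Longrightarrow> m \<noteq> 0" by blast+
    have hol: "G z holomorphic_on ball l \<rho> - {l}" for z by (rule holomorphic_on_subset[OF G_hol in1])
    have hol1: "(\<lambda>m. G z m / m) holomorphic_on ball l \<rho> - {l}" for z
      using in2 by (intro holomorphic_intros hol) auto
    have hol2: "(\<lambda>m. G z m * (m - l) * (1 / m\<^sup>2)) holomorphic_on ball l \<rho> - {l}" for z
      using in2 by (intro holomorphic_intros hol) auto
    have hol3: "(\<lambda>m. 1 / m\<^sup>2) holomorphic_on ball l \<rho>" "(\<lambda>m. l * y x * (1 / m\<^sup>2)) holomorphic_on ball l \<rho>"
      using in2 by (auto intro!: holomorphic_intros)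
    have l_in: "l \<in> ball l \<rho>" using \<rho> by simp
    \<comment> \<open>Moving \<open>x\<close> by \<open>e\<close> replaces \<open>G x m\<close> by
      \<open>(G x m - y x) / m\<close>. The defect from being an eigenvector is therefore the sum of
      two residues: the first vanishes by the growth bound at \<open>l\<close>, the second by
      holomorphy.\<close>
    have "residue (\<lambda>m. G x m / m) l - l * residue (\<lambda>m. G (x + e) m / m) l =
        residue (\<lambda>m. G x m / m - l * (G (x + e) m / m)) l"
      using residue_diff[OF open_ball l_in hol1 holomorphic_on_mult[OF holomorphic_on_const hol1], of x l "x + e"]
        residue_lmul[OF open_ball l_in hol1, of l "x + e"] by simp
    also have "\<dots> = residue (\<lambda>m. G x m * (m - l) * (1 / m\<^sup>2) + l * y x * (1 / m\<^sup>2)) l"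
    proof (rule residue_cong)
      have "\<forall>\<^sub>F m in at l. m \<in> ball l \<rho> - {l}"
        using \<rho>(1) eventually_at_ball'[of \<rho> l UNIV] by (auto elim: eventually_mono)
      then show "\<forall>\<^sub>F m in at l. G x m / m - l * (G (x + e) m / m) = G x m * (m - l) * (1 / m\<^sup>2) + l * y x * (1 / m\<^sup>2)"
      proof (rule eventually_mono)
        fix m assume m: "m \<in> ball l \<rho> - {l}"
        then have "m \<noteq> 0" "m \<notin> eigenvalues e" using in1 in2 by (auto simp: \<Lambda>_def)
        then have eq: "G (x + e) m = (G x m - y x) / m" unfolding G_def by (intro resolvent_shift y)
        show "G x m / m - l * (G (x + e) m / m) = G x m * (m - l) * (1 / m\<^sup>2) + l * y x * (1 / m\<^sup>2)"
          unfolding eq using \<open>m \<noteq> 0\<close> by (simp add: field_simps power2_eq_square)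
      qed
    qed simp
    also have "\<dots> = residue (\<lambda>m. G x m * (m - l) * (1 / m\<^sup>2)) l + residue (\<lambda>m. l * y x * (1 / m\<^sup>2)) l"
      by (rule residue_add[OF open_ball l_in hol2 holomorphic_on_subset[OF hol3(2)]]) auto
    also have "residue (\<lambda>m. l * y x * (1 / m\<^sup>2)) l = 0"
      by (rule residue_holo[OF open_ball l_in hol3(2)])
    also have "residue (\<lambda>m. G x m * (m - l) * (1 / m\<^sup>2)) l = 0"
      by (rule residue_eq_0_of_circle_growth[OF norm1[OF l] \<rho>(1) hol hol3(1), of x M])
         (use growth in1 in blast)
    finally show ?thesis by (simp add: v_def)
  qed
  have total: "y x = (\<Sum>l\<in>\<Lambda>. v l x)" for x
  proof -
    define R0 where "R0 = residue (\<lambda>m. G x m / m) 0"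
    define c where "c = 2 * pi * \<i> * (R0 - (\<Sum>l\<in>\<Lambda>. v l x))"
    \<comment> \<open>Every circle of radius \<open>R > 1\<close> encloses 0 and all eigenvalues,
      which have modulus 1, so \<open>c\<close> is independent of \<open>R\<close>.\<close>
    have "cmod c \<le> 2 * pi * M / (R - 1)" if R: "1 < R" for R
    proof -
      have hol: "(\<lambda>m. G x m / m) holomorphic_on UNIV - insert 0 \<Lambda>"
        by (intro holomorphic_intros holomorphic_on_subset[OF G_hol]) auto
      have path: "path_image (circlepath 0 R) \<subseteq> UNIV - insert 0 \<Lambda>"
        using R norm1 by (auto simp: sphere_def)
      have "contour_integral (circlepath 0 R) (\<lambda>m. G x m / m) =
          2 * pi * \<i> * (\<Sum>p\<in>insert 0 \<Lambda>. winding_number (circlepath 0 R) p * residue (\<lambda>m. G x m / m) p)"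
        by (rule Residue_theorem[OF _ _ _ hol _ _ path]) (use fin in \<open>auto simp: \<Lambda>_def\<close>)
      also have "(\<Sum>p\<in>insert 0 \<Lambda>. winding_number (circlepath 0 R) p * residue (\<lambda>m. G x m / m) p) =
          (\<Sum>p\<in>insert 0 \<Lambda>. residue (\<lambda>m. G x m / m) p)"
        using R norm1 by (intro sum.cong refl) (auto simp: winding_number_circlepath)
      also have "\<dots> = R0 - (\<Sum>l\<in>\<Lambda>. v l x)"
        using fin zero by (simp add: \<Lambda>_def R0_def v_def sum_negf)
      finally have ci: "contour_integral (circlepath 0 R) (\<lambda>m. G x m / m) = c" by (simp add: c_def)
      have "(\<lambda>m. G x m / m) contour_integrable_on (circlepath 0 R)"
        by (rule contour_integrable_holomorphic_simple[OF hol _ _ path])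
           (use fin in \<open>auto simp: \<Lambda>_def intro!: open_Diff finite_imp_closed\<close>)
      then have "((\<lambda>m. G x m / m) has_contour_integral c) (circlepath 0 R)"
        using ci has_contour_integral_integral by metis
      then have "cmod c \<le> M / ((R - 1) * R) * (2 * pi * R)"
      proof (rule has_contour_integral_bound_circlepath)
        show "0 \<le> M / ((R - 1) * R)" using M R by auto
        fix m assume "cmod (m - 0) = R"
        then have m: "cmod m = R" by simp
        then have "m \<notin> \<Lambda>" using R norm1 by force
        from growth[OF this, of x] have "cmod (G x m) \<le> M / (R - 1)"
          using m R by (simp add: pos_le_divide_eq)
        then have "cmod (G x m) / R \<le> M / (R - 1) / R" using R by (intro divide_right_mono) auto
        then show "cmod (G x m / m) \<le> M / ((R - 1) * R)" using m by (simp add: norm_divide)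
      qed (use R in auto)
      also have "\<dots> = 2 * pi * M / (R - 1)" using R by (simp add: field_simps)
      finally show ?thesis .
    qed
    then have "\<forall>\<^sub>F R in at_top. cmod c \<le> 2 * pi * M / (- 1 + R)"
      by (intro eventually_mono[OF eventually_gt_at_top[of 1]]) simp
    moreover have "((\<lambda>R. 2 * pi * M / (- 1 + R)) \<longlongrightarrow> 0) at_top"
      by (intro tendsto_divide_0[OF tendsto_const] filterlim_at_top_imp_at_infinity
          filterlim_tendsto_add_at_top[OF tendsto_const] filterlim_ident)
    ultimately have "cmod c \<le> 0" by (intro tendsto_lowerbound[of _ 0 at_top]) auto
    then have "R0 = (\<Sum>l\<in>\<Lambda>. v l x)" by (simp add: c_def)
    moreover have "R0 = y x"
    proof -
      have op: "open (- \<Lambda>)" using fin by (auto simp: \<Lambda>_def intro: finite_imp_closed)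
      have "residue (\<lambda>m. G x m / (m - 0)) 0 = G x 0"
        using zero by (intro residue_simple[OF op _ G_hol]) auto
      moreover have "G x 0 = y x"
        using resolvent(2)[OF y, of 0 e x] zero by (simp add: G_def \<Lambda>_def)
      ultimately show ?thesis by (simp add: R0_def)
    qed
    ultimately show ?thesis by simp
  qed
  show ?thesis using eigen total unfolding \<Lambda>_def by blast
qed

text \<open>Subtracting \<open>w\<close> times the shifted sum kills the summand at \<open>w\<close>
  and multiplies each other one by the nonzero number \<open>1 - w / l\<close>, which leaves a
  shorter sum in \<open>Y\<close>.\<close>

lemma eigenvector_summand_mem:
  assumes "finite L" "0 \<notin> L" "(\<lambda>x. \<Sum>l\<in>L. v l x) \<in> Y" "\<And>l x. l \<in> L \<Longrightarrow> v l x = l * v l (x + e)"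
  shows "\<forall>l\<in>L. v l \<in> Y"
  using assms
proof (induction L arbitrary: v rule: finite_induct)
  case (insert w L)
  define y where "y = (\<lambda>x. \<Sum>l\<in>insert w L. v l x)"
  have y: "y \<in> Y" unfolding y_def by (rule insert.prems)
  have v_shift: "v l (x + e) = v l x / l" if "l \<in> insert w L" for l x
  proof -
    have "l \<noteq> 0" using that insert.prems(1) by auto
    then show ?thesis using insert.prems(3)[OF that, of x] by simp
  qed
  have "w \<noteq> 0" using insert.prems(1) by auto
  have "y x - w * y (x + e) = (\<Sum>l\<in>L. (1 - w / l) * v l x)" for x
  proof -
    have "y x - w * y (x + e) = (\<Sum>l\<in>insert w L. v l x - w * (v l x / l))"
      unfolding y_def sum_distrib_left sum_subtractf[symmetric]
      by (rule sum.cong) (simp_all add: v_shift)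
    also have "\<dots> = (\<Sum>l\<in>insert w L. (1 - w / l) * v l x)"
      by (rule sum.cong) (simp_all add: algebra_simps)
    finally show ?thesis using insert.hyps \<open>w \<noteq> 0\<close> by simp
  qed
  moreover have "(\<lambda>x. y x - w * y (x + e)) \<in> Y" by (intro diff scale shift y)
  ultimately have a: "(\<lambda>x. \<Sum>l\<in>L. (1 - w / l) * v l x) \<in> Y" by simp
  have b: "(1 - w / l) * v l x = l * ((1 - w / l) * v l (x + e))" if "l \<in> L" for l x
    using insert.prems(3)[of l x] that by (simp only: insert_iff mult.left_commute simp_thms)
  have "0 \<notin> L" using insert.prems(1) by blast
  then have IH: "\<forall>l\<in>L. (\<lambda>x. (1 - w / l) * v l x) \<in> Y"
    by (rule insert.IH[OF _ a]) (rule b)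
  have L: "v l \<in> Y" if "l \<in> L" for l
  proof -
    have "1 - w / l \<noteq> 0" using that insert.hyps by auto
    then show ?thesis using scale[OF bspec[OF IH that], of "1 / (1 - w / l)"] by simp
  qed
  have "(\<lambda>x. y x - (\<Sum>l\<in>L. v l x)) \<in> Y" by (intro diff y sum L)
  then have "v w \<in> Y" using insert.hyps by (simp add: y_def)
  then show ?case using L by blast
qed blast

definition eigenspace :: "int ^ 'd \<Rightarrow> complex \<Rightarrow> (int ^ 'd \<Rightarrow> complex) set" where
  "eigenspace e l = {f \<in> Y. \<forall>x. f x = l * f (x + e)}"

lemma shift_space_eigenspace: "shift_space (eigenspace e l)"
proof
  show "(\<lambda>_. 0) \<in> eigenspace e l" by (simp add: eigenspace_def zero_mem)
next
  fix f g c assume "f \<in> eigenspace e l" "g \<in> eigenspace e l"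
  then have "f \<in> Y" "g \<in> Y" and *: "\<And>x. f x = l * f (x + e)" "\<And>x. g x = l * g (x + e)"
    unfolding eigenspace_def by blast+
  moreover have "f x + c * g x = l * (f (x + e) + c * g (x + e))" for x
    by (subst *(1), subst *(2)) (simp add: algebra_simps)
  ultimately show "(\<lambda>x. f x + c * g x) \<in> eigenspace e l"
    unfolding eigenspace_def using lincomb by blast
next
  fix f h assume "f \<in> eigenspace e l"
  then have "f \<in> Y" and *: "\<And>x. f x = l * f (x + e)"
    unfolding eigenspace_def by blast+
  moreover have "f (x + h) = l * f (x + e + h)" for x
    by (subst *) (simp add: ac_simps)
  ultimately show "(\<lambda>x. f (x + h)) \<in> eigenspace e l"
    unfolding eigenspace_def using shift by blast
next
  fix f assume "f \<in> eigenspace e l"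
  then show "\<exists>M. \<forall>x. cmod (f x) \<le> M" using bounded unfolding eigenspace_def by blast
next
  fix F M f assume F: "\<And>n. F n \<in> eigenspace e l" "\<And>n x. cmod (F n x) \<le> M" "\<And>x. (\<lambda>n. F n x) \<longlonglongrightarrow> f x"
  have "F n \<in> Y" for n using F(1) unfolding eigenspace_def by blast
  then have "f \<in> Y" by (rule limit[OF _ F(2,3)])
  moreover have "f x = l * f (x + e)" for x
  proof (rule LIMSEQ_unique[OF F(3)])
    have "(\<lambda>n. l * F n (x + e)) \<longlonglongrightarrow> l * f (x + e)" by (intro tendsto_intros F)
    moreover have "F n x = l * F n (x + e)" for n using F(1)[of n] unfolding eigenspace_def by blast
    ultimately show "(\<lambda>n. F n x) \<longlonglongrightarrow> l * f (x + e)" by simp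
  qed
  ultimately show "f \<in> eigenspace e l" unfolding eigenspace_def by blast
qed

theorem spectral_decomposition:
  assumes "y \<in> Y" "finite (eigenvalues e)"
  shows "\<exists>v. (\<forall>l\<in>eigenvalues e. v l \<in> eigenspace e l) \<and> (\<forall>x. y x = (\<Sum>l\<in>eigenvalues e. v l x))"
proof -
  obtain v where v: "\<forall>l\<in>eigenvalues e. \<forall>x. v l x = l * v l (x + e)"
    "\<forall>x. y x = (\<Sum>l\<in>eigenvalues e. v l x)"
    using eigenvector_sum[OF assms] by blast
  have eq: "(\<lambda>x. \<Sum>l\<in>eigenvalues e. v l x) = y" 
    by (rule ext, rule sym) (use v(2) in blast)
  have "\<forall>l\<in>eigenvalues e. v l \<in> Y"
  proof (rule eigenvector_summand_mem[OF assms(2)])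
    show "0 \<notin> eigenvalues e" using eigenvalue_norm by force
    show "(\<lambda>x. \<Sum>l\<in>eigenvalues e. v l x) \<in> Y" unfolding eq by (rule assms(1))
    show "v l x = l * v l (x + e)" if "l \<in> eigenvalues e" for l x using v(1) that by blast
  qed
  then show ?thesis using v unfolding eigenspace_def by blast
qed

end

section \<open>Lattice characters and functions with finite spectrum\<close>

definition lattice_char :: "complex ^ 'd \<Rightarrow> int ^ 'd::finite \<Rightarrow> complex" where
  "lattice_char z x = (\<Prod>i\<in>UNIV. z $ i powi (x $ i))"

lemma lattice_char_0 [simp]: "lattice_char z 0 = 1"
  by (simp add: lattice_char_def)

lemma lattice_char_add:
  fixes z :: "complex ^ 'd::finite"
  shows
  "(\<And>i. z $ i \<noteq> 0) \<Longrightarrow> lattice_char z (x + y) = lattice_char z x * lattice_char z y"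
  by (simp add: lattice_char_def power_int_add prod.distrib)

lemma lattice_char_nonzero:
  fixes z :: "complex ^ 'd::finite"
  shows "(\<And>i. z $ i \<noteq> 0) \<Longrightarrow> lattice_char z x \<noteq> 0"
  by (simp add: lattice_char_def)

lemma lattice_char_axis: "lattice_char z (axis i k) = z $ i powi k"
proof -
  have "lattice_char z (axis i k) = (\<Prod>j\<in>UNIV. if j = i then z $ i powi k else 1)"
    unfolding lattice_char_def by (rule prod.cong) (auto simp: axis_def)
  then show ?thesis by simp
qed

lemma cmod_lattice_char:
  fixes z :: "complex ^ 'd::finite"
  shows "(\<And>i. cmod (z $ i) = 1) \<Longrightarrow> cmod (lattice_char z x) = 1"
  by (simp add: lattice_char_def prod_norm[symmetric] norm_power_int)

lemma axis_invariant_imp_const: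
  fixes g :: "int ^ 'd::finite \<Rightarrow> 'a"
  assumes inv: "\<And>i x. g (x + axis i 1) = g x"
  shows "g x = g 0"
proof -
  have "\<forall>x. g (x + axis i k) = g x" for i k
  proof (induction k rule: int_induct[of _ 0])
    case base
    have eq: "axis i (0 :: int) = 0" by simp
    show ?case unfolding eq by simp
  next
    case (step1 k)
    have "x + axis i (k + 1) = x + axis i k + axis i 1" for x :: "int ^ 'd"
      by (simp add: vec_eq_iff axis_def)
    then show ?case using step1 inv by metis
  next
    case (step2 k)
    have "x + axis i k = x + axis i (k - 1) + axis i 1" for x :: "int ^ 'd"
      by (simp add: vec_eq_iff axis_def)
    then show ?case using step2 inv by metis
  qed
  then have ax: "g (x + axis i k) = g x" for x i k by blast
  have "g (\<chi> j. if j \<in> S then x $ j else 0) = g 0" if "finite S" for S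
    using that
  proof (induction S rule: finite_induct)
    case empty
    have "(\<chi> j. if j \<in> {} then x $ j else 0) = 0" by (simp add: vec_eq_iff)
    then show ?case by simp
  next
    case (insert i S)
    have "(\<chi> j. if j \<in> insert i S then x $ j else 0) = (\<chi> j. if j \<in> S then x $ j else 0) + axis i (x $ i)"
      using insert.hyps by (auto simp: vec_eq_iff axis_def)
    then show ?case using insert.IH ax by simp
  qed
  from this[OF finite[of UNIV]] show ?thesis by simp
qed

lemma eigenfunction_eq_lattice_char:
  fixes f :: "int ^ 'd::finite \<Rightarrow> complex" and z :: "complex ^ 'd"
  assumes "\<And>i. z $ i \<noteq> 0" and f: "\<And>i x. f (x + axis i 1) = z $ i * f x"
  shows "f x = f 0 * lattice_char z x"
proof -
  define g where "g = (\<lambda>x. f x / lattice_char z x)"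
  have "g (x + axis i 1) = g x" for x i
    using assms(1) lattice_char_nonzero[of z x] by (simp add: g_def f lattice_char_add lattice_char_axis)
  then have "g x = g 0" by (rule axis_invariant_imp_const)
  then show ?thesis using lattice_char_nonzero[of z x] assms(1) by (simp add: g_def field_simps)
qed

definition unit_torus :: "(complex ^ 'd::finite) set" where
  "unit_torus = {z. \<forall>i. cmod (z $ i) = 1}"

lemma unit_torus_nonzero: "z \<in> unit_torus \<Longrightarrow> z $ i \<noteq> 0"
  by (auto simp: unit_torus_def dest: spec[of _ i])

definition spectrum :: "(int ^ 'd::finite \<Rightarrow> complex) set \<Rightarrow> (complex ^ 'd) set" where
  "spectrum Y = {z \<in> unit_torus. lattice_char z \<in> Y}"

text \<open>Induction over the set \<open>D\<close> of coordinates whose shifts are not yet known to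
  be scalar: split along the eigenspaces of one such shift, on each of which it becomes scalar.
  Eigenspaces have smaller spectra, so the sums are taken over a fixed superset
  \<open>Z\<close>.\<close>

theorem finite_spectrum_spans:
  fixes Y :: "(int ^ 'd::finite \<Rightarrow> complex) set"
  assumes "shift_space Y" "finite (spectrum Y)" "f \<in> Y"
  shows "\<exists>c. \<forall>x. f x = (\<Sum>z\<in>spectrum Y. c z * lattice_char z x)"
proof -
  have main: "\<exists>c. \<forall>x. f x = (\<Sum>z\<in>Z. c z * lattice_char z x)"
    if "finite D" "shift_space Y" "\<And>i. i \<notin> D \<Longrightarrow> \<exists>l. \<forall>f\<in>Y. \<forall>x. f x = l * f (x + axis i 1)"
      "finite Z" "spectrum Y \<subseteq> Z" "f \<in> Y" for D :: "'d set" and Y Z f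
    using that
  proof (induction D arbitrary: Y Z f rule: finite_induct)
    case empty
    show ?case
    proof (cases "f = (\<lambda>_. 0)")
      case True
      then show ?thesis by (intro exI[of _ "\<lambda>_. 0"]) simp
    next
      case False
      interpret shift_space Y by fact
      obtain l where l: "\<And>i f x. f \<in> Y \<Longrightarrow> f x = l i * f (x + axis i 1)"
        using empty(2) by (metis empty_iff)
      obtain x0 where x0: "f x0 \<noteq> 0" using False by auto
      have "l i \<in> eigenvalues (axis i 1)" for i
        unfolding eigenvalues_def using l[of f] empty.prems(5) x0 by blast
      then have norm1: "cmod (l i) = 1" for i using eigenvalue_norm by blast
      define z :: "complex ^ 'd" where "z = (\<chi> i. 1 / l i)"
      have z: "z \<in> unit_torus" using norm1 by (simp add: unit_torus_def z_def norm_divide)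
      have l_nz: "l i \<noteq> 0" for i using norm1[of i] by auto
      have char: "g x = g 0 * lattice_char z x" if "g \<in> Y" for g x
      proof (rule eigenfunction_eq_lattice_char)
        show "g (x + axis i 1) = z $ i * g x" for i x
          by (subst l[OF that, of x i]) (simp add: z_def l_nz)
      qed (rule unit_torus_nonzero[OF z])
      have "f 0 \<noteq> 0" using char[OF empty.prems(5), of x0] x0 by auto
      then have "lattice_char z = (\<lambda>x. (1 / f 0) * f x)"
        using char[OF empty.prems(5)] by (metis (no_types) mult.assoc mult_1 nonzero_divide_eq_eq times_divide_eq_left)
      then have "lattice_char z \<in> Y" using scale[OF empty.prems(5), of "1 / f 0"] by (simp only:)
      then have "z \<in> Z" using z empty.prems(4) by (auto simp: spectrum_def)
      then have "f x = (\<Sum>w\<in>Z. (if w = z then f 0 else 0) * lattice_char w x)" for x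
        using char[OF empty.prems(5), of x] empty.prems(3) by (simp add: if_distrib[of "\<lambda>a. a * _"] cong: if_cong)
      then show ?thesis by (intro exI[of _ "\<lambda>w. if w = z then f 0 else 0"]) blast
    qed
  next
    case (insert i D)
    interpret shift_space Y by fact
    define e :: "int ^ 'd" where "e = axis i 1"
    have sp: "spectrum (eigenspace e l) \<subseteq> spectrum Y" for l
      unfolding spectrum_def eigenspace_def by blast
    have fin: "finite (spectrum Y)" using insert.prems(3,4) finite_subset by blast
    have IH: "\<exists>c. \<forall>x. g x = (\<Sum>z\<in>Z'. c z * lattice_char z x)"
      if "g \<in> eigenspace e l" "finite Z'" "spectrum (eigenspace e l) \<subseteq> Z'" for g l Z'
    proof (rule insert.IH[OF shift_space_eigenspace])
      fix j assume "j \<notin> D"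
      show "\<exists>l'. \<forall>f\<in>eigenspace e l. \<forall>x. f x = l' * f (x + axis j 1)"
      proof (cases "j = i")
        case True
        then show ?thesis unfolding eigenspace_def e_def by blast
      next
        case False
        then show ?thesis using insert.prems(2)[of j] \<open>j \<notin> D\<close> unfolding eigenspace_def by blast
      qed
    qed (use that in auto)
    \<comment> \<open>A nonzero eigenspace contains a character: with an empty spectrum the
      induction hypothesis would write \<open>w\<close> as an empty sum. Hence the eigenvalues are
      among the \<open>1 / z $ i\<close> with \<open>z\<close> in the finite spectrum.\<close>
    have "l \<in> (\<lambda>z. 1 / z $ i) ` spectrum Y" if l: "l \<in> eigenvalues e" for l
    proof -
      obtain w x where w: "w \<in> eigenspace e l" "w x \<noteq> 0"
        using l unfolding eigenvalues_def eigenspace_def by blast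
      have "finite (spectrum (eigenspace e l))" using fin sp finite_subset by blast
      from IH[OF w(1) this order_refl] w(2) have "spectrum (eigenspace e l) \<noteq> {}" by force
      then obtain z where z: "z \<in> unit_torus" "lattice_char z \<in> eigenspace e l"
        unfolding spectrum_def by blast
      have "lattice_char z 0 = l * lattice_char z (0 + e)"
        using z(2) unfolding eigenspace_def by blast
      then have "l = 1 / z $ i"
        using unit_torus_nonzero[OF z(1), of i] by (simp add: e_def lattice_char_axis field_simps)
      moreover have "z \<in> spectrum Y" using z unfolding spectrum_def eigenspace_def by blast
      ultimately show ?thesis by blast
    qed
    then have fin_e: "finite (eigenvalues e)" using fin finite_surj subsetI by metis
    obtain v where v: "\<And>l. l \<in> eigenvalues e \<Longrightarrow> v l \<in> eigenspace e l"
      "\<And>x. f x = (\<Sum>l\<in>eigenvalues e. v l x)"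
      using spectral_decomposition[OF insert.prems(5) fin_e] by blast
    have "\<forall>l\<in>eigenvalues e. \<exists>c. \<forall>x. v l x = (\<Sum>z\<in>Z. c z * lattice_char z x)"
      using IH[OF v(1) insert.prems(3)] sp insert.prems(4) by blast
    then obtain c where c: "\<And>l x. l \<in> eigenvalues e \<Longrightarrow> v l x = (\<Sum>z\<in>Z. c l z * lattice_char z x)"
      by metis
    have "f x = (\<Sum>z\<in>Z. (\<Sum>l\<in>eigenvalues e. c l z) * lattice_char z x)" for x
      unfolding v(2) sum_distrib_right by (subst sum.swap) (simp add: c)
    then show ?case by (intro exI[of _ "\<lambda>z. \<Sum>l\<in>eigenvalues e. c l z"]) blast
  qed
  show ?thesis by (rule main[of UNIV Y]) (use assms in auto)
qed

section \<open>Characters in an invariant space\<close>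

text \<open>Restricting to pairs with \<open>h p = 0\<close> removes \<open>p\<close> from
  \<open>F\<close>, and one pair with \<open>h0 p \<noteq> 0\<close> fixes the coefficient at
  \<open>p\<close>. The functional is given by its graph \<open>W\<close>, so that it can be applied
  to restrictions to \<open>F\<close>, to bidual elements and to evaluations on \<open>X\<close>
  alike.\<close>

lemma functional_combination:
  fixes W :: "(('b \<Rightarrow> real) \<times> real) set"
  assumes "finite F"
    and "\<And>h s h' s' c. (h, s) \<in> W \<Longrightarrow> (h', s') \<in> W \<Longrightarrow> ((\<lambda>b. h b + c * h' b), s + c * s') \<in> W"
    and "\<And>h s. (h, s) \<in> W \<Longrightarrow> (\<forall>b\<in>F. h b = 0) \<Longrightarrow> s = 0"
  shows "\<exists>a. \<forall>(h, s)\<in>W. s = (\<Sum>b\<in>F. a b * h b)"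
  using assms
proof (induction F arbitrary: W rule: finite_induct)
  case empty
  then show ?case by auto
next
  case (insert p F)
  define W' where "W' = {(h, s) \<in> W. h p = 0}"
  have "\<exists>a. \<forall>(h, s)\<in>W'. s = (\<Sum>b\<in>F. a b * h b)"
  proof (rule insert.IH)
    show "((\<lambda>b. h b + c * h' b), s + c * s') \<in> W'" if "(h, s) \<in> W'" "(h', s') \<in> W'" for h s h' s' c
      using that insert.prems(1)[of h s h' s' c] by (simp add: W'_def)
    show "s = 0" if "(h, s) \<in> W'" "\<forall>b\<in>F. h b = 0" for h s
      using that insert.prems(2)[of h s] by (simp add: W'_def)
  qed
  then obtain a where a: "\<And>h s. (h, s) \<in> W' \<Longrightarrow> s = (\<Sum>b\<in>F. a b * h b)" by blast
  show ?case
  proof (cases "\<exists>(h0, s0)\<in>W. h0 p \<noteq> 0")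
    case True
    then obtain h0 s0 where h0: "(h0, s0) \<in> W" "h0 p \<noteq> 0" by auto
    define r where "r = (s0 - (\<Sum>b\<in>F. a b * h0 b)) / h0 p"
    define a' where "a' = a(p := r)"
    have "s = (\<Sum>b\<in>insert p F. a' b * h b)" if "(h, s) \<in> W" for h s
    proof -
      define c where "c = - h p / h0 p"
      have "((\<lambda>b. h b + c * h0 b), s + c * s0) \<in> W'"
        using insert.prems(1)[OF that h0(1), of c] h0(2) by (simp add: W'_def c_def)
      then have "s + c * s0 = (\<Sum>b\<in>F. a b * (h b + c * h0 b))" by (rule a)
      also have "\<dots> = (\<Sum>b\<in>F. a b * h b) + c * (\<Sum>b\<in>F. a b * h0 b)"
        by (simp add: sum.distrib sum_distrib_left algebra_simps)
      finally have "s = (\<Sum>b\<in>F. a b * h b) - c * (s0 - (\<Sum>b\<in>F. a b * h0 b))"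
        by (simp add: algebra_simps)
      also have "\<dots> = (\<Sum>b\<in>F. a b * h b) + r * h p" by (simp add: c_def r_def)
      also have "(\<Sum>b\<in>F. a b * h b) = (\<Sum>b\<in>F. a' b * h b)"
        using insert.hyps by (intro sum.cong) (auto simp: a'_def)
      finally show ?thesis using insert.hyps by (simp add: a'_def)
    qed
    then show ?thesis by (intro exI[of _ a']) auto
  next
    case False
    have "s = (\<Sum>b\<in>insert p F. a b * h b)" if "(h, s) \<in> W" for h s
    proof -
      have "h p = 0" using False that by auto
      moreover have "(h, s) \<in> W'" using that \<open>h p = 0\<close> by (simp add: W'_def)
      ultimately show ?thesis using a[of h s] insert.hyps by simp
    qed
    then show ?thesis by (intro exI[of _ a]) auto
  qed
qed

text \<open>Adding \<open>g w\<close> costs at most one point: combinations that vanish on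
  \<open>F\<close> and have the same coefficient at \<open>w\<close> coincide everywhere, so a
  single point at which one of them is nonzero settles all.\<close>

lemma finite_family_determined:
  fixes g :: "'z \<Rightarrow> 'p \<Rightarrow> complex"
  assumes "finite Z"
  shows "\<exists>F. finite F \<and> (\<forall>c. (\<forall>x\<in>F. (\<Sum>z\<in>Z. c z * g z x) = 0) \<longrightarrow> (\<forall>x. (\<Sum>z\<in>Z. c z * g z x) = 0))"
  using assms
proof (induction Z rule: finite_induct)
  case empty
  then show ?case by auto
next
  case (insert w Z)
  then obtain F where F: "finite F"
    "\<And>c x. (\<forall>x\<in>F. (\<Sum>z\<in>Z. c z * g z x) = 0) \<Longrightarrow> (\<Sum>z\<in>Z. c z * g z x) = 0" by blast
  define S where "S = (\<lambda>c x. \<Sum>z\<in>insert w Z. c z * g z x)"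
  have S: "S c x = c w * g w x + (\<Sum>z\<in>Z. c z * g z x)" for c x
    using insert.hyps by (simp add: S_def)
  have "\<exists>F. finite F \<and> (\<forall>c. (\<forall>x\<in>F. S c x = 0) \<longrightarrow> (\<forall>x. S c x = 0))"
  proof (cases "\<exists>c p. c w = 1 \<and> (\<forall>x\<in>F. S c x = 0) \<and> S c p \<noteq> 0")
    case True
    then obtain c0 p where c0: "c0 w = 1" "\<forall>x\<in>F. S c0 x = 0" "S c0 p \<noteq> 0" by blast
    have "S c x = 0" if c: "\<forall>x\<in>insert p F. S c x = 0" for c x
    proof -
      have eq: "(\<Sum>z\<in>Z. (c z - c w * c0 z) * g z x) = S c x - c w * S c0 x" for x
        by (simp add: S c0(1) algebra_simps sum_subtractf sum_distrib_left)
      have "(\<Sum>z\<in>Z. (c z - c w * c0 z) * g z x) = 0" for x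
        by (rule F(2)) (use c c0(2) in \<open>simp add: eq\<close>)
      then have *: "S c x = c w * S c0 x" for x using eq[of x] by simp
      then have "c w = 0" using *[of p] c c0(3) by simp
      then show ?thesis using *[of x] by simp
    qed
    moreover have "finite (insert p F)" using F(1) by simp
    ultimately show ?thesis by blast
  next
    case False
    have "S c x = 0" if c: "\<forall>x\<in>F. S c x = 0" for c x
    proof (cases "c w = 0")
      case True
      then show ?thesis using F(2)[of c x] c by (simp add: S)
    next
      case w: False
      have eq: "S (\<lambda>z. c z / c w) x = S c x / c w" for x
        by (simp add: S_def sum_divide_distrib)
      have "S (\<lambda>z. c z / c w) x = 0"
        using False c w eq by (metis div_0 divide_self)
      then show ?thesis using w by (simp add: eq)
    qed
    then show ?thesis using F(1) by blast
  qed
  then show ?case unfolding S_def .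
qed

lemma zdist_ge_1: "v \<noteq> w \<Longrightarrow> 1 \<le> zdist v w"
  using zdist_pos[of v w] unfolding zdist_def
  by (metis of_int_0_less_iff of_int_1_le_iff int_one_le_iff_zero_less)

lemma zdist_add_left: "zdist (x + h) x = zdist h 0"
  by (simp add: zdist_def)

lemma zdist_axis: "zdist (axis i 1) 0 = 1"
proof -
  have "(\<Sum>j\<in>UNIV. \<bar>axis i 1 $ j - 0 $ j\<bar>) = (\<Sum>j\<in>UNIV. if j = i then 1 else (0::int))"
    by (intro sum.cong) (auto simp: axis_def)
  then show ?thesis by (simp add: zdist_def)
qed

text \<open>Distinct lattice points are at distance at least 1.\<close>

lemma bounded_lipschitz:
  assumes "\<And>x. \<bar>g x\<bar> \<le> M"
  shows "\<bar>g v - g w\<bar> \<le> 2 * M * zdist v w"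
proof (cases "v = w")
  case False
  have "0 \<le> M" using assms[of v] by linarith
  have "\<bar>g v - g w\<bar> \<le> 2 * M * 1" using assms[of v] assms[of w] by linarith
  also have "\<dots> \<le> 2 * M * zdist v w"
    using \<open>0 \<le> M\<close> zdist_ge_1[OF False] by (intro mult_left_mono) auto
  finally show ?thesis .
qed simp

lemma bounded_mem_lip0_functions:
  assumes "\<And>x. \<bar>g x\<bar> \<le> M"
  shows "(\<lambda>x. g x - g 0) \<in> lip0_functions"
  by (rule lip0_functionsI[where C = "2 * M"]) (use bounded_lipschitz[OF assms] in auto)

section \<open>Annihilators and bounded functions of an invariant space\<close>

locale invariant_lip_space =
  fixes X :: "('d::finite) lip0 set"
  assumes subspace_X: "subspace X"
    and invariant_X: "translation_invariant X"
    and closed_X: "pointwise_closed X"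
begin

definition L :: "(int ^ 'd \<Rightarrow> real) set" where "L = lip0_apply ` X"

lemma L_lip0: "f \<in> L \<Longrightarrow> f \<in> lip0_functions"
  using lip0_apply by (auto simp: L_def)

lemma Lip0_mem: "f \<in> L \<Longrightarrow> Lip0 f \<in> X"
  by (auto simp: L_def lip0_apply_inverse)

lemma L_lincomb: "f \<in> L \<Longrightarrow> g \<in> L \<Longrightarrow> (\<lambda>x. f x + c * g x) \<in> L"
proof -
  assume "f \<in> L" "g \<in> L"
  then obtain f' g' where "f' \<in> X" "g' \<in> X" "f = lip0_apply f'" "g = lip0_apply g'"
    by (auto simp: L_def)
  moreover have "f' + c *\<^sub>R g' \<in> X"
    using subspace_X calculation by (intro subspace_add subspace_scale)
  ultimately show ?thesis unfolding L_def by (intro image_eqI[of _ _ "f' + c *\<^sub>R g'"]) auto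
qed

lemma L_zero: "(\<lambda>_. 0) \<in> L"
  unfolding L_def using subspace_0[OF subspace_X] by (intro image_eqI[of _ _ 0]) auto

lemma L_translate: "f \<in> L \<Longrightarrow> (\<lambda>x. f (x + h) - f h) \<in> L"
proof -
  assume "f \<in> L"
  then obtain f' where f': "f' \<in> X" "f = lip0_apply f'" by (auto simp: L_def)
  have "translate (- h) f' \<in> X" using invariant_X f' by (auto simp: translation_invariant_def)
  then show ?thesis
    unfolding L_def using f' by (intro image_eqI[of _ _ "translate (- h) f'"]) (auto simp: translate.rep_eq)
qed

text \<open>A basic neighbourhood in the product topology constrains the values at finitely many
  points only.\<close>

lemma mem_L_if_agrees_on_finite_sets:
  assumes f: "f \<in> lip0_functions" and ag: "\<And>F. finite F \<Longrightarrow> \<exists>g\<in>L. \<forall>x\<in>F. g x = f x"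
  shows "f \<in> L"
proof (rule ccontr)
  assume "f \<notin> L"
  obtain C where C: "closed C" "L = lip0_functions \<inter> C"
    using closed_X unfolding pointwise_closed_def L_def closedin_closed by blast
  have "openin (product_topology (\<lambda>_. euclidean) UNIV) (- C)"
    using C(1) by (simp add: euclidean_product_topology open_Compl)
  moreover have "f \<in> - C" using C(2) f \<open>f \<notin> L\<close> by auto
  ultimately obtain U where U: "f \<in> (\<Pi>\<^sub>E i\<in>UNIV. U i)"
    "finite {i. U i \<noteq> topspace (euclidean :: real topology)}" "(\<Pi>\<^sub>E i\<in>UNIV. U i) \<subseteq> - C"
    using product_topology_open_contains_basis[of "\<lambda>_. euclidean" UNIV "- C" f] by blast
  have "finite {i. U i \<noteq> UNIV}" using U(2) by simp
  from ag[OF this] obtain g where g: "g \<in> L" "\<And>x. x \<in> {i. U i \<noteq> UNIV} \<Longrightarrow> g x = f x" by blast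
  have "g i \<in> U i" for i using g(2)[of i] U(1) by (cases "U i = UNIV") (auto simp: PiE_iff)
  then have "g \<in> - C" using U(3) by (auto simp: PiE_iff)
  then show False using g(1) C(2) by auto
qed

definition annihilates :: "(int ^ 'd) set \<Rightarrow> (int ^ 'd \<Rightarrow> real) \<Rightarrow> bool" where
  "annihilates F a \<longleftrightarrow> finite F \<and> (\<forall>g\<in>L. (\<Sum>x\<in>F. a x * g x) = 0)"

text \<open>The bipolar theorem for pointwise convergence, by linear algebra on one finite set. If
  no member of \<open>L\<close> agrees with \<open>f\<close> on \<open>F\<close>, then in
  \<open>g x + s * f x\<close> the number \<open>s\<close> depends only on the restriction to
  \<open>F\<close>; the combination of evaluations computing it is 0 on \<open>L\<close> and 1 at
  \<open>f\<close>.\<close>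

lemma mem_L_iff:
  "f \<in> L \<longleftrightarrow> f \<in> lip0_functions \<and> (\<forall>F a. annihilates F a \<longrightarrow> (\<Sum>x\<in>F. a x * f x) = 0)"
proof
  assume "f \<in> L"
  then show "f \<in> lip0_functions \<and> (\<forall>F a. annihilates F a \<longrightarrow> (\<Sum>x\<in>F. a x * f x) = 0)"
    using L_lip0 by (auto simp: annihilates_def)
next
  assume *: "f \<in> lip0_functions \<and> (\<forall>F a. annihilates F a \<longrightarrow> (\<Sum>x\<in>F. a x * f x) = 0)"
  show "f \<in> L"
  proof (rule mem_L_if_agrees_on_finite_sets)
    show "f \<in> lip0_functions" using * by blast
    fix F :: "(int ^ 'd) set" assume F: "finite F"
    show "\<exists>g\<in>L. \<forall>x\<in>F. g x = f x"
    proof (rule ccontr)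
      assume no: "\<not> ?thesis"
      define W where "W = {((\<lambda>x. g x + s * f x), s) | g s. g \<in> L}"
      have "\<exists>a. \<forall>(h, s)\<in>W. s = (\<Sum>b\<in>F. a b * h b)"
      proof (rule functional_combination[OF F])
        fix h s h' s' c assume "(h, s) \<in> W" "(h', s') \<in> W"
        then obtain g g' where g: "g \<in> L" "h = (\<lambda>x. g x + s * f x)" "g' \<in> L" "h' = (\<lambda>x. g' x + s' * f x)"
          by (auto simp: W_def)
        have eq: "(\<lambda>b. h b + c * h' b) = (\<lambda>x. (g x + c * g' x) + (s + c * s') * f x)"
          by (simp add: g fun_eq_iff algebra_simps)
        show "((\<lambda>b. h b + c * h' b), s + c * s') \<in> W"
          unfolding W_def eq using L_lincomb[OF g(1,3), of c]
          by (intro CollectI exI[of _ "\<lambda>x. g x + c * g' x"] exI[of _ "s + c * s'"]) simp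
      next
        fix h s assume hs: "(h, s) \<in> W" "\<forall>b\<in>F. h b = 0"
        then obtain g where g: "g \<in> L" "h = (\<lambda>x. g x + s * f x)" by (auto simp: W_def)
        show "s = 0"
        proof (rule ccontr)
          assume s: "s \<noteq> 0"
          define k where "k = (\<lambda>x. 0 + (- 1 / s) * g x)"
          have "k \<in> L" unfolding k_def by (rule L_lincomb[OF L_zero g(1)])
          moreover have "\<forall>x\<in>F. k x = f x"
          proof
            fix x assume "x \<in> F"
            then have "g x + s * f x = 0" using hs(2) g(2) by simp
            then have "g x = - (s * f x)" by linarith
            then show "k x = f x" using s by (simp add: k_def)
          qed
          ultimately show False using no by blast
        qed
      qed
      then obtain a where a: "\<And>h s. (h, s) \<in> W \<Longrightarrow> s = (\<Sum>b\<in>F. a b * h b)" by blast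
      have "0 = (\<Sum>b\<in>F. a b * (g b + 0 * f b))" if "g \<in> L" for g
        by (rule a) (use that in \<open>auto simp: W_def\<close>)
      then have "annihilates F a" using F by (simp add: annihilates_def)
      moreover have "1 = (\<Sum>b\<in>F. a b * (0 + 1 * f b))"
        by (rule a) (use L_zero in \<open>force simp: W_def\<close>)
      ultimately show False using * by auto
    qed
  qed
qed

definition Y :: "(int ^ 'd \<Rightarrow> complex) set" where
  "Y = {f. (\<exists>M. \<forall>x. cmod (f x) \<le> M) \<and> (\<lambda>x. Re (f x) - Re (f 0)) \<in> L \<and> (\<lambda>x. Im (f x) - Im (f 0)) \<in> L}"

text \<open>Annihilators are finitely supported, so their equations survive pointwise limits, and
  the uniform bound makes the limit Lipschitz.\<close>

lemma L_limit:
  assumes F: "\<And>n. (\<lambda>x. F n x - F n 0) \<in> L" and M: "\<And>n x. \<bar>F n x\<bar> \<le> M"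
    and lim: "\<And>x. (\<lambda>n. F n x) \<longlonglongrightarrow> f x"
  shows "(\<lambda>x. f x - f 0) \<in> L"
  unfolding mem_L_iff
proof (intro conjI allI impI)
  have "\<bar>f x\<bar> \<le> M" for x
    by (rule LIMSEQ_le_const2[OF tendsto_rabs[OF lim]]) (use M in auto)
  then show "(\<lambda>x. f x - f 0) \<in> lip0_functions" by (rule bounded_mem_lip0_functions)
  fix S a assume S: "annihilates S a"
  have "(\<lambda>n. \<Sum>x\<in>S. a x * (F n x - F n 0)) \<longlonglongrightarrow> (\<Sum>x\<in>S. a x * (f x - f 0))"
    by (intro tendsto_intros lim)
  moreover have "(\<Sum>x\<in>S. a x * (F n x - F n 0)) = 0" for n
    using S F[of n] by (auto simp: annihilates_def)
  ultimately show "(\<Sum>x\<in>S. a x * (f x - f 0)) = 0" by (simp add: LIMSEQ_const_iff)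
qed

lemma shift_space_Y: "shift_space Y"
proof
  show "(\<lambda>_. 0) \<in> Y" using L_zero by (auto simp: Y_def intro: exI[of _ 0])
next
  fix f g c assume "f \<in> Y" "g \<in> Y"
  then obtain M N where MN: "\<And>x. cmod (f x) \<le> M" "\<And>x. cmod (g x) \<le> N"
    and f: "(\<lambda>x. Re (f x) - Re (f 0)) \<in> L" "(\<lambda>x. Im (f x) - Im (f 0)) \<in> L"
    and g: "(\<lambda>x. Re (g x) - Re (g 0)) \<in> L" "(\<lambda>x. Im (g x) - Im (g 0)) \<in> L"
    by (auto simp: Y_def)
  have "cmod (f x + c * g x) \<le> M + cmod c * N" for x
    using norm_triangle_ineq[of "f x" "c * g x"] MN[of x] mult_left_mono[OF MN(2)[of x], of "cmod c"]
    by (simp add: norm_mult)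
  moreover have "(\<lambda>x. Re (f x + c * g x) - Re (f 0 + c * g 0)) \<in> L"
    using L_lincomb[OF L_lincomb[OF f(1) g(1), of "Re c"] g(2), of "- Im c"] by (simp add: algebra_simps)
  moreover have "(\<lambda>x. Im (f x + c * g x) - Im (f 0 + c * g 0)) \<in> L"
    using L_lincomb[OF L_lincomb[OF f(2) g(1), of "Im c"] g(2), of "Re c"] by (simp add: algebra_simps)
  ultimately show "(\<lambda>x. f x + c * g x) \<in> Y" unfolding Y_def by blast
next
  fix f h assume "f \<in> Y"
  then obtain M where M: "\<And>x. cmod (f x) \<le> M"
    and f: "(\<lambda>x. Re (f x) - Re (f 0)) \<in> L" "(\<lambda>x. Im (f x) - Im (f 0)) \<in> L"
    by (auto simp: Y_def)
  show "(\<lambda>x. f (x + h)) \<in> Y"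
    unfolding Y_def using M L_translate[OF f(1), of h] L_translate[OF f(2), of h] by auto
next
  fix f assume "f \<in> Y"
  then show "\<exists>M. \<forall>x. cmod (f x) \<le> M" by (simp add: Y_def)
next
  fix F :: "nat \<Rightarrow> int ^ 'd \<Rightarrow> complex" and M f
  assume F: "\<And>n. F n \<in> Y" "\<And>n x. cmod (F n x) \<le> M" "\<And>x. (\<lambda>n. F n x) \<longlonglongrightarrow> f x"
  have "cmod (f x) \<le> M" for x
    by (rule LIMSEQ_le_const2[OF tendsto_norm[OF F(3)]]) (use F(2) in auto)
  moreover have "(\<lambda>x. Re (f x) - Re (f 0)) \<in> L"
    by (rule L_limit[of "\<lambda>n x. Re (F n x)" M])
       (use F(1) in \<open>auto simp: Y_def intro: tendsto_Re F(3) order_trans[OF abs_Re_le_cmod F(2)]\<close>)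
  moreover have "(\<lambda>x. Im (f x) - Im (f 0)) \<in> L"
    by (rule L_limit[of "\<lambda>n x. Im (F n x)" M])
       (use F(1) in \<open>auto simp: Y_def intro: tendsto_Im F(3) order_trans[OF abs_Im_le_cmod F(2)]\<close>)
  ultimately show "f \<in> Y" unfolding Y_def by blast
qed

lemma difference_mem_Y:
  assumes "f \<in> X"
  shows "(\<lambda>x. of_real (lip0_apply f (x + h) - lip0_apply f x)) \<in> Y"
proof -
  have f: "lip0_apply f \<in> L" using assms by (simp add: L_def)
  have "cmod (of_real (lip0_apply f (x + h) - lip0_apply f x)) \<le> norm f * zdist h 0" for x
    using lip0_bound[of f "x + h" x] by (simp add: zdist_add_left del: of_real_diff)
  moreover have "(\<lambda>x. (lip0_apply f (x + h) - lip0_apply f h) + (-1) * lip0_apply f x) \<in> L"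
    by (rule L_lincomb[OF L_translate[OF f] f])
  ultimately show ?thesis using L_zero by (auto simp: Y_def algebra_simps)
qed

text \<open>Injectivity of restriction to a finite set is the form of finite-dimensionality from
  which finite spanning sets of both \<open>X\<close> and the predual are obtained.\<close>

definition determined :: bool where
  "determined \<longleftrightarrow> (\<exists>F. finite F \<and> (\<forall>f\<in>X. (\<forall>p\<in>F. lip0_apply f p = 0) \<longrightarrow> f = 0))"

lemma finite_spectrum_imp_determined:
  assumes "finite (spectrum Y)"
  shows determined
proof -
  obtain F where F: "finite F" "\<And>c x. (\<forall>x\<in>F. (\<Sum>z\<in>spectrum Y. c z * lattice_char z x) = 0) \<Longrightarrow>
      (\<Sum>z\<in>spectrum Y. c z * lattice_char z x) = 0"
    using finite_family_determined[OF assms, of lattice_char] by blast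
  \<comment> \<open>With the unit steps added, the coordinate differences of \<open>f\<close> can be
    read off on \<open>F\<close>. Once they vanish everywhere, \<open>f\<close> is constant and
    equal to its value 0 at the origin.\<close>
  define F' where "F' = F \<union> (\<lambda>(x, i). x + axis i 1) ` (F \<times> UNIV)"
  have "f = 0" if f: "f \<in> X" "\<forall>p\<in>F'. lip0_apply f p = 0" for f
  proof (rule lip0_eqI)
    fix v
    have "lip0_apply f (x + axis i 1) = lip0_apply f x" for i x
    proof -
      obtain c where c: "\<And>x. of_real (lip0_apply f (x + axis i 1) - lip0_apply f x) =
          (\<Sum>z\<in>spectrum Y. c z * lattice_char z x)"
        using finite_spectrum_spans[OF shift_space_Y assms difference_mem_Y[OF f(1)], of "axis i 1"] by blast
      have "\<forall>x\<in>F. (\<Sum>z\<in>spectrum Y. c z * lattice_char z x) = 0"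
      proof
        fix x assume x: "x \<in> F"
        have "x + axis i 1 \<in> F'" unfolding F'_def using x by (intro UnI2 image_eqI[of _ _ "(x, i)"]) auto
        moreover have "x \<in> F'" using x by (simp add: F'_def)
        ultimately show "(\<Sum>z\<in>spectrum Y. c z * lattice_char z x) = 0" using f(2) by (simp flip: c)
      qed
      from F(2)[OF this, of x] c[of x] show ?thesis by simp
    qed
    from axis_invariant_imp_const[of "lip0_apply f", OF this] show "lip0_apply f v = lip0_apply 0 v" by simp
  qed
  moreover have "finite F'" using F(1) by (auto simp: F'_def)
  ultimately show ?thesis unfolding determined_def by blast
qed

end

section \<open>The spectrum as a real algebraic set\<close>

definition complex_polynomial :: "('a::euclidean_space \<Rightarrow> complex) \<Rightarrow> bool" where
  "complex_polynomial f \<longleftrightarrow> polynomial_in Basis (\<lambda>p. Re (f p)) \<and> polynomial_in Basis (\<lambda>p. Im (f p))"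

lemma complex_polynomial_mult:
  "complex_polynomial f \<Longrightarrow> complex_polynomial g \<Longrightarrow> complex_polynomial (\<lambda>p. f p * g p)"
  by (auto simp: complex_polynomial_def intro!: polynomial_in.add polynomial_in_diff polynomial_in.mult)

lemma complex_polynomial_1: "complex_polynomial (\<lambda>_. 1)"
  by (simp add: complex_polynomial_def polynomial_in.const)

lemma complex_polynomial_power: "complex_polynomial f \<Longrightarrow> complex_polynomial (\<lambda>p. f p ^ n)"
  by (induction n) (simp_all add: complex_polynomial_1 complex_polynomial_mult)

lemma complex_polynomial_prod:
  "(\<And>i. i \<in> I \<Longrightarrow> complex_polynomial (f i)) \<Longrightarrow> complex_polynomial (\<lambda>p. \<Prod>i\<in>I. f i p)"
  by (induction I rule: infinite_finite_induct) (simp_all add: complex_polynomial_1 complex_polynomial_mult)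

lemma complex_polynomial_cnj: "complex_polynomial f \<Longrightarrow> complex_polynomial (\<lambda>p. cnj (f p))"
  using polynomial_in_diff[OF polynomial_in.const, of Basis "\<lambda>p. Im (f p)" 0]
  by (simp add: complex_polynomial_def)

lemma complex_polynomial_component: "complex_polynomial (\<lambda>z :: complex ^ 'd::finite. z $ i)"
proof -
  have "(\<lambda>z :: complex ^ 'd. Re (z $ i)) = (\<lambda>z. z \<bullet> axis i 1)" "(\<lambda>z :: complex ^ 'd. Im (z $ i)) = (\<lambda>z. z \<bullet> axis i \<i>)"
    by (simp_all add: inner_axis inner_complex_def)
  moreover have "axis i 1 \<in> (Basis :: (complex ^ 'd) set)" "axis i \<i> \<in> (Basis :: (complex ^ 'd) set)"
    by (simp_all add: Basis_complex_def)
  ultimately show ?thesis by (simp add: complex_polynomial_def polynomial_in.coord)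
qed

text \<open>Powers of the conjugate stand in for negative powers, so this is a polynomial in the
  real coordinates that agrees with the character on the torus.\<close>

definition char_monomial :: "int ^ 'd::finite \<Rightarrow> complex ^ 'd \<Rightarrow> complex" where
  "char_monomial x z = (\<Prod>i\<in>UNIV. if 0 \<le> x $ i then (z $ i) ^ nat (x $ i) else cnj (z $ i) ^ nat (- x $ i))"

lemma complex_polynomial_char_monomial:
  fixes x :: "int ^ 'd::finite"
  shows "complex_polynomial (char_monomial x)"
proof -
  have "complex_polynomial (\<lambda>z :: complex ^ 'd. if 0 \<le> x $ i then (z $ i) ^ nat (x $ i) else cnj (z $ i) ^ nat (- x $ i))" for i
    by (cases "0 \<le> x $ i") (simp_all add: complex_polynomial_power complex_polynomial_component complex_polynomial_cnj)
  then show ?thesis unfolding char_monomial_def[abs_def] by (rule complex_polynomial_prod)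
qed

lemma char_monomial_eq:
  fixes z :: "complex ^ 'd::finite"
  assumes "z \<in> unit_torus"
  shows "char_monomial x z = lattice_char z x"
  unfolding char_monomial_def lattice_char_def
proof (rule prod.cong)
  fix i
  have "cmod (z $ i) = 1" using assms by (simp add: unit_torus_def)
  then have "z $ i * cnj (z $ i) = 1" by (metis complex_norm_square of_real_1 power_one)
  then have "cnj (z $ i) = inverse (z $ i)" by (metis inverse_unique)
  then show "(if 0 \<le> x $ i then (z $ i) ^ nat (x $ i) else cnj (z $ i) ^ nat (- x $ i)) = z $ i powi x $ i"
    by (simp add: power_int_def)
qed simp

context invariant_lip_space
begin

lemma lattice_char_mem_Y_iff:
  assumes z: "z \<in> unit_torus"
  shows "lattice_char z \<in> Y \<longleftrightarrow> (\<forall>F a. annihilates F a \<longrightarrow>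
    (\<Sum>x\<in>F. a x * (Re (lattice_char z x) - 1)) = 0 \<and> (\<Sum>x\<in>F. a x * Im (lattice_char z x)) = 0)"
proof -
  have c: "cmod (lattice_char z x) = 1" for x
    using z by (intro cmod_lattice_char) (simp add: unit_torus_def)
  have re: "\<bar>Re (lattice_char z x)\<bar> \<le> 1" and im: "\<bar>Im (lattice_char z x)\<bar> \<le> 1" for x
    using abs_Re_le_cmod[of "lattice_char z x"] abs_Im_le_cmod[of "lattice_char z x"] c[of x] by simp_all
  have "(\<lambda>x. Re (lattice_char z x) - 1) \<in> lip0_functions" "(\<lambda>x. Im (lattice_char z x)) \<in> lip0_functions"
    using bounded_mem_lip0_functions[of "\<lambda>x. Re (lattice_char z x)", OF re]
      bounded_mem_lip0_functions[of "\<lambda>x. Im (lattice_char z x)", OF im] by simp_all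
  moreover have "\<exists>M. \<forall>x. cmod (lattice_char z x) \<le> M" using c by auto
  ultimately show ?thesis by (auto simp: Y_def mem_L_iff)
qed

lemma infinite_spectrum_uncountable:
  assumes "infinite (spectrum Y)"
  shows "uncountable (spectrum Y)"
proof -
  \<comment> \<open>\<open>P1\<close> cuts out the torus; \<open>P2\<close> and \<open>P3\<close>
    are the annihilator equations for the real and imaginary parts.\<close>
  define P1 where "P1 = range (\<lambda>i (z :: complex ^ 'd). (Re (z $ i) * Re (z $ i) + Im (z $ i) * Im (z $ i)) - 1)"
  define P2 where "P2 = {(\<lambda>z. \<Sum>x\<in>F. a x * (Re (char_monomial x z) - 1)) | F a. annihilates F a}"
  define P3 where "P3 = {(\<lambda>z. \<Sum>x\<in>F. a x * Im (char_monomial x z)) | F a. annihilates F a}"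
  have "polynomial_in Basis f" if "f \<in> P1 \<union> P2 \<union> P3" for f
  proof -
    have mono: "polynomial_in Basis (\<lambda>z :: complex ^ 'd. Re (char_monomial x z))"
      "polynomial_in Basis (\<lambda>z :: complex ^ 'd. Im (char_monomial x z))" for x
      using complex_polynomial_char_monomial[of x] by (simp_all add: complex_polynomial_def)
    have comp: "polynomial_in Basis (\<lambda>z :: complex ^ 'd. Re (z $ i))"
      "polynomial_in Basis (\<lambda>z :: complex ^ 'd. Im (z $ i))" for i
      using complex_polynomial_component[of i] by (simp_all add: complex_polynomial_def)
    show ?thesis
      using that unfolding P1_def P2_def P3_def
      by (auto intro!: polynomial_in_sum polynomial_in.mult polynomial_in_diff polynomial_in.add
          polynomial_in.const mono comp)
  qed
  moreover have "spectrum Y = {z. \<forall>f\<in>P1 \<union> P2 \<union> P3. f z = 0}"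
  proof (intro set_eqI iffI)
    fix z assume "z \<in> spectrum Y"
    then have z: "z \<in> unit_torus" "lattice_char z \<in> Y" by (auto simp: spectrum_def)
    have "cmod (z $ i) = 1" for i using z(1) by (simp add: unit_torus_def)
    then have "Re (z $ i) * Re (z $ i) + Im (z $ i) * Im (z $ i) = 1" for i
      by (metis cmod_power2 one_power2 power2_eq_square)
    then have "\<forall>f\<in>P1. f z = 0" by (auto simp: P1_def)
    moreover have "\<forall>f\<in>P2 \<union> P3. f z = 0"
      using z(2) unfolding lattice_char_mem_Y_iff[OF z(1)]
      by (auto simp: P2_def P3_def char_monomial_eq[OF z(1)])
    ultimately show "z \<in> {z. \<forall>f\<in>P1 \<union> P2 \<union> P3. f z = 0}" by blast
  next
    fix z assume z: "z \<in> {z. \<forall>f\<in>P1 \<union> P2 \<union> P3. f z = 0}"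
    have "cmod (z $ i) = 1" for i
    proof -
      define p where "p = (\<lambda>z :: complex ^ 'd. (Re (z $ i) * Re (z $ i) + Im (z $ i) * Im (z $ i)) - 1)"
      have "p \<in> P1" unfolding P1_def p_def by (rule rangeI)
      then have "p z = 0" using z by blast
      then have "(Re (z $ i) * Re (z $ i) + Im (z $ i) * Im (z $ i)) - 1 = 0" by (simp add: p_def)
      then have "(cmod (z $ i))\<^sup>2 = 1" unfolding cmod_power2 by (simp add: power2_eq_square)
      then show ?thesis by (rule power2_eq_imp_eq[where y = 1, simplified]) simp
    qed
    then have t: "z \<in> unit_torus" by (simp add: unit_torus_def)
    have "(\<Sum>x\<in>F. a x * (Re (char_monomial x z) - 1)) = 0 \<and> (\<Sum>x\<in>F. a x * Im (char_monomial x z)) = 0"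
      if "annihilates F a" for F a
    proof -
      have "(\<lambda>z. \<Sum>x\<in>F. a x * (Re (char_monomial x z) - 1)) \<in> P2"
        unfolding P2_def by (rule CollectI, rule exI[of _ F], rule exI[of _ a]) (simp add: that)
      moreover have "(\<lambda>z. \<Sum>x\<in>F. a x * Im (char_monomial x z)) \<in> P3"
        unfolding P3_def by (rule CollectI, rule exI[of _ F], rule exI[of _ a]) (simp add: that)
      ultimately have "(\<lambda>z. \<Sum>x\<in>F. a x * (Re (char_monomial x z) - 1)) \<in> P1 \<union> P2 \<union> P3"
        "(\<lambda>z. \<Sum>x\<in>F. a x * Im (char_monomial x z)) \<in> P1 \<union> P2 \<union> P3" by simp_all
      from this[THEN bspec[OF CollectD[OF z]]] show ?thesis by simp
    qed
    then show "z \<in> spectrum Y"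
      unfolding spectrum_def by (simp add: t lattice_char_mem_Y_iff[OF t] char_monomial_eq[OF t])
  qed
  ultimately show ?thesis using infinite_real_algebraic_set_uncountable[of "P1 \<union> P2 \<union> P3"] assms by simp
qed

end

section \<open>Separability\<close>

text \<open>If all powers stayed within \<open>1 / 2\<close> of 1, then
  \<open>\<zeta> ^ n + 1\<close> would have modulus at least \<open>3 / 2\<close>, and each squaring
  would stretch the distance to 1 by this factor, beyond every bound.\<close>

lemma unit_power_far_from_1:
  assumes "cmod \<zeta> = 1" "\<zeta> \<noteq> 1"
  shows "\<exists>n. 1 / 2 \<le> cmod (\<zeta> ^ n - 1)"
proof (rule ccontr)
  assume no: "\<nexists>n. 1 / 2 \<le> cmod (\<zeta> ^ n - 1)"
  have step: "3 / 2 * cmod (\<zeta> ^ n - 1) \<le> cmod (\<zeta> ^ (2 * n) - 1)" for n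
  proof -
    have "cmod (\<zeta> ^ n - 1) < 1 / 2" using no not_le by blast
    moreover have "cmod 2 \<le> cmod (\<zeta> ^ n + 1) + cmod (\<zeta> ^ n - 1)"
      using norm_triangle_ineq4[of "\<zeta> ^ n + 1" "\<zeta> ^ n - 1"] by simp
    ultimately have "3 / 2 \<le> cmod (\<zeta> ^ n + 1)" by simp
    then have "3 / 2 * cmod (\<zeta> ^ n - 1) \<le> cmod (\<zeta> ^ n + 1) * cmod (\<zeta> ^ n - 1)"
      by (intro mult_right_mono) auto
    also have "\<dots> = cmod (\<zeta> ^ (2 * n) - 1)"
      by (simp add: norm_mult[symmetric] algebra_simps flip: power_add mult_2)
    finally show ?thesis .
  qed
  have "(3 / 2) ^ k * cmod (\<zeta> - 1) \<le> cmod (\<zeta> ^ (2 ^ k) - 1)" for k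
  proof (induction k)
    case (Suc k)
    have "(3 / 2) ^ Suc k * cmod (\<zeta> - 1) \<le> 3 / 2 * cmod (\<zeta> ^ (2 ^ k) - 1)"
      using mult_left_mono[OF Suc, of "3 / 2"] by (simp add: mult_ac)
    also have "\<dots> \<le> cmod (\<zeta> ^ (2 * 2 ^ k) - 1)" by (rule step)
    finally show ?case by simp
  qed simp
  moreover have "cmod (\<zeta> ^ (2 ^ k) - 1) \<le> 2" for k
    using norm_triangle_ineq4[of "\<zeta> ^ (2 ^ k)" 1] assms(1) by (simp add: norm_power)
  ultimately have le: "(3 / 2) ^ k * cmod (\<zeta> - 1) \<le> 2" for k using order_trans by blast
  obtain k where "2 / cmod (\<zeta> - 1) < (3 / 2) ^ k" using real_arch_pow[of "3 / 2"] by auto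
  then have "2 < (3 / 2) ^ k * cmod (\<zeta> - 1)" using assms(2) by (simp add: divide_simps mult.commute split: if_splits)
  then show False using le[of k] by simp
qed

lemma lattice_char_axis_of_nat: "lattice_char z (axis i (int n)) = z $ i ^ n"
  by (simp add: lattice_char_axis)

context invariant_lip_space
begin

definition char_re :: "complex ^ 'd \<Rightarrow> 'd lip0" where
  "char_re z = Lip0 (\<lambda>x. Re (lattice_char z x) - 1)"

definition char_im :: "complex ^ 'd \<Rightarrow> 'd lip0" where
  "char_im z = Lip0 (\<lambda>x. Im (lattice_char z x))"

lemma spectrum_torus: "z \<in> spectrum Y \<Longrightarrow> z \<in> unit_torus"
  by (simp add: spectrum_def)

lemma spectrum_norm: "z \<in> spectrum Y \<Longrightarrow> cmod (z $ i) = 1"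
  by (simp add: spectrum_def unit_torus_def)

lemma spectrum_cmod_char: "z \<in> spectrum Y \<Longrightarrow> cmod (lattice_char z x) = 1"
  by (intro cmod_lattice_char spectrum_norm)

lemma spectrum_char_mem_L:
  assumes "z \<in> spectrum Y"
  shows "(\<lambda>x. Re (lattice_char z x) - 1) \<in> L" "(\<lambda>x. Im (lattice_char z x)) \<in> L"
  using assms by (auto simp: spectrum_def Y_def)

lemma char_mem_X:
  assumes "z \<in> spectrum Y"
  shows "char_re z \<in> X" "char_im z \<in> X"
  unfolding char_re_def char_im_def by (intro Lip0_mem spectrum_char_mem_L assms)+

lemma char_apply:
  assumes "z \<in> spectrum Y"
  shows "lip0_apply (char_re z) x = Re (lattice_char z x) - 1" "lip0_apply (char_im z) x = Im (lattice_char z x)"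
  unfolding char_re_def char_im_def by (simp_all add: Lip0_inverse L_lip0 spectrum_char_mem_L assms)

lemma norm_char_le:
  assumes z: "z \<in> spectrum Y"
  shows "norm (char_re z) \<le> 2" "norm (char_im z) \<le> 2"
proof -
  have re: "\<bar>Re (lattice_char z x)\<bar> \<le> 1" and im: "\<bar>Im (lattice_char z x)\<bar> \<le> 1" for x
    using abs_Re_le_cmod[of "lattice_char z x"] abs_Im_le_cmod[of "lattice_char z x"] spectrum_cmod_char[OF z, of x] by simp_all
  show "norm (char_re z) \<le> 2"
    by (rule lip0_norm_le) (use bounded_lipschitz[of "\<lambda>x. Re (lattice_char z x)" 1, OF re] in \<open>simp add: char_apply[OF z]\<close>)
  show "norm (char_im z) \<le> 2"
    by (rule lip0_norm_le) (use bounded_lipschitz[of "\<lambda>x. Im (lattice_char z x)" 1, OF im] in \<open>simp add: char_apply[OF z]\<close>)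
qed

lemma spectrum_char_add:
  assumes "z \<in> spectrum Y"
  shows "lattice_char z (x + y) = lattice_char z x * lattice_char z y"
  using unit_torus_nonzero[OF spectrum_torus[OF assms]] by (intro lattice_char_add)

text \<open>A step along axis \<open>i\<close> multiplies the two characters by \<open>a\<close> and
  \<open>b\<close> after taking differences, and \<open>N\<close> bounds the distance of the results
  at every point. Comparing the origin with a point on axis \<open>j\<close>, where \<open>z\<close>
  and \<open>w\<close> differ, eliminates \<open>b\<close>. Two errors \<open>N\<close> and the
  lower bound \<open>1 / 2\<close> on the distance of the powers give the constant 4.\<close>

lemma char_separation:
  assumes z: "z \<in> spectrum Y" and w: "w \<in> spectrum Y" and "z \<noteq> w"
  shows "cmod (z $ i - 1) \<le> 4 * (norm (char_re z - char_re w) + norm (char_im z - char_im w))"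
proof -
  define N where "N = norm (char_re z - char_re w) + norm (char_im z - char_im w)"
  define a b where "a = z $ i - 1" and "b = w $ i - 1"
  have v: "cmod (a * lattice_char z x - b * lattice_char w x) \<le> N" for x
  proof -
    define d where "d = (a * lattice_char z x - b * lattice_char w x)"
    have d: "d = (lattice_char z (x + axis i 1) - lattice_char w (x + axis i 1)) - (lattice_char z x - lattice_char w x)"
      by (simp add: d_def a_def b_def spectrum_char_add z w lattice_char_axis algebra_simps)
    have "\<bar>Re d\<bar> \<le> norm (char_re z - char_re w)"
      using lip0_bound[of "char_re z - char_re w" "x + axis i 1" x]
      by (simp add: d char_apply z w zdist_add_left zdist_axis)
    moreover have "\<bar>Im d\<bar> \<le> norm (char_im z - char_im w)"
      using lip0_bound[of "char_im z - char_im w" "x + axis i 1" x]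
      by (simp add: d char_apply z w zdist_add_left zdist_axis)
    ultimately show ?thesis using cmod_le[of d] by (simp add: N_def d_def)
  qed
  obtain j where j: "z $ j \<noteq> w $ j" using \<open>z \<noteq> w\<close> by (auto simp: vec_eq_iff)
  define \<zeta> where "\<zeta> = z $ j / w $ j"
  have nz: "w $ j \<noteq> 0" using unit_torus_nonzero[OF spectrum_torus[OF w]] .
  have "cmod \<zeta> = 1" "\<zeta> \<noteq> 1" using j nz by (simp_all add: \<zeta>_def norm_divide spectrum_norm z w)
  then obtain n where n: "1 / 2 \<le> cmod (\<zeta> ^ n - 1)" using unit_power_far_from_1 by blast
  have "a * (z $ j ^ n - w $ j ^ n) = (a * z $ j ^ n - b * w $ j ^ n) - w $ j ^ n * (a - b)"
    by (simp add: algebra_simps)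
  also have "cmod \<dots> \<le> cmod (a * z $ j ^ n - b * w $ j ^ n) + cmod (w $ j ^ n * (a - b))"
    by (rule norm_triangle_ineq4)
  also have "\<dots> \<le> N + N"
    using v[of "axis j (int n)"] v[of 0]
    by (simp add: lattice_char_axis_of_nat norm_mult norm_power spectrum_norm[OF w])
  finally have "cmod a * cmod (z $ j ^ n - w $ j ^ n) \<le> 2 * N" by (simp add: norm_mult)
  moreover have "z $ j ^ n - w $ j ^ n = w $ j ^ n * (\<zeta> ^ n - 1)"
    using nz by (simp add: \<zeta>_def power_divide field_simps)
  ultimately have "cmod a * cmod (\<zeta> ^ n - 1) \<le> 2 * N"
    by (simp add: norm_mult norm_power spectrum_norm[OF w])
  moreover have "cmod a * (1 / 2) \<le> cmod a * cmod (\<zeta> ^ n - 1)" using n by (intro mult_left_mono) auto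
  ultimately show ?thesis by (simp add: a_def N_def)
qed

text \<open>Only the trivial character lies in no slice. A fixed \<open>c\<close> is wanted because
  the bound of \<open>char_separation\<close> degenerates as \<open>z $ i\<close> approaches
  1.\<close>

lemma uncountable_spectrum_slice:
  assumes "uncountable (spectrum Y)"
  obtains i c where "0 < c" "uncountable {z \<in> spectrum Y. c \<le> cmod (z $ i - 1)}"
proof -
  have "countable (spectrum Y)" if cnt: "\<forall>i (m::nat). countable {z \<in> spectrum Y. 1 / real (Suc m) \<le> cmod (z $ i - 1)}"
  proof (rule countable_subset)
    show "spectrum Y \<subseteq> insert (\<chi> i. 1) (\<Union>i. \<Union>m. {z \<in> spectrum Y. 1 / real (Suc m) \<le> cmod (z $ i - 1)})"
    proof
      fix z assume z: "z \<in> spectrum Y"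
      show "z \<in> insert (\<chi> i. 1) (\<Union>i. \<Union>m. {z \<in> spectrum Y. 1 / real (Suc m) \<le> cmod (z $ i - 1)})"
      proof (cases "\<exists>i. z $ i \<noteq> 1")
        case True
        then obtain i where "z $ i \<noteq> 1" by blast
        then have "0 < cmod (z $ i - 1)" by simp
        then obtain m where "1 / real (Suc m) < cmod (z $ i - 1)" using nat_approx_posE by blast
        then have "1 / real (Suc m) \<le> cmod (z $ i - 1)" by simp
        then show ?thesis using z by blast
      next
        case False
        then have "z = (\<chi> i. 1)" by (simp add: vec_eq_iff)
        then show ?thesis by blast
      qed
    qed
    have "countable (\<Union>i. \<Union>m. {z \<in> spectrum Y. 1 / real (Suc m) \<le> cmod (z $ i - 1)})"
      by (intro countable_UN countableI_type) (use cnt in blast)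
    then show "countable (insert (\<chi> i. 1) (\<Union>i. \<Union>m. {z \<in> spectrum Y. 1 / real (Suc m) \<le> cmod (z $ i - 1)}))"
      by (rule countable_insert)
  qed
  then obtain i m where "uncountable {z \<in> spectrum Y. 1 / real (Suc m) \<le> cmod (z $ i - 1)}" using assms by blast
  then show ?thesis by (intro that[of "1 / real (Suc m)"]) auto
qed

theorem uncountable_spectrum_imp_nonseparable:
  assumes "uncountable (spectrum Y)"
  shows "\<not> separable_space (top_of_set X)"
proof
  assume "separable_space (top_of_set X)"
  then obtain C where C: "countable C" "C \<subseteq> X" "top_of_set X closure_of C = X"
    by (auto simp: separable_space_def)
  obtain i c where c: "0 < c" "uncountable {z \<in> spectrum Y. c \<le> cmod (z $ i - 1)}"
    using uncountable_spectrum_slice[OF assms] .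
  define S where "S = {z \<in> spectrum Y. c \<le> cmod (z $ i - 1)}"
  \<comment> \<open>17 exceeds 16: if two characters share their approximants, four errors are added
    and \<open>char_separation\<close> multiplies them by 4.\<close>
  have approx: "\<exists>p\<in>C. norm (f - p) < c / 17" if "f \<in> X" for f
  proof -
    have "f \<in> top_of_set X closure_of C" using C(3) that by simp
    then have *: "\<forall>T. f \<in> T \<and> openin (top_of_set X) T \<longrightarrow> (\<exists>y. y \<in> C \<and> y \<in> T)"
      unfolding in_closure_of by (rule conjunct2)
    have "openin (top_of_set X) (X \<inter> ball f (c / 17))" by (intro openin_open_Int) simp
    moreover have "f \<in> X \<inter> ball f (c / 17)" using that c(1) by simp
    ultimately obtain p where "p \<in> C" "p \<in> X \<inter> ball f (c / 17)" using *[THEN spec] by blast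
    then show ?thesis by (intro bexI[of _ p]) (auto simp: dist_norm)
  qed
  have "\<forall>z\<in>S. \<exists>pq\<in>C \<times> C. norm (char_re z - fst pq) < c / 17 \<and> norm (char_im z - snd pq) < c / 17"
  proof
    fix z assume "z \<in> S"
    then have "z \<in> spectrum Y" by (simp add: S_def)
    then obtain p q where "p \<in> C" "norm (char_re z - p) < c / 17" "q \<in> C" "norm (char_im z - q) < c / 17"
      using approx[OF char_mem_X(1)] approx[OF char_mem_X(2)] by blast
    then show "\<exists>pq\<in>C \<times> C. norm (char_re z - fst pq) < c / 17 \<and> norm (char_im z - snd pq) < c / 17"
      by (intro bexI[of _ "(p, q)"]) auto
  qed
  then obtain h where "\<forall>z\<in>S. h z \<in> C \<times> C \<and>
      (norm (char_re z - fst (h z)) < c / 17 \<and> norm (char_im z - snd (h z)) < c / 17)"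
    unfolding Bex_def by (rule bchoice[THEN exE])
  then have h: "\<And>z. z \<in> S \<Longrightarrow> h z \<in> C \<times> C"
    "\<And>z. z \<in> S \<Longrightarrow> norm (char_re z - fst (h z)) < c / 17" "\<And>z. z \<in> S \<Longrightarrow> norm (char_im z - snd (h z)) < c / 17"
    by blast+
  have "inj_on h S"
  proof (rule inj_onI, rule ccontr)
    fix z w assume zw: "z \<in> S" "w \<in> S" "h z = h w" "z \<noteq> w"
    have "norm (char_re z - char_re w) \<le> norm (char_re z - fst (h z)) + norm (char_re w - fst (h w))"
      using norm_triangle_ineq4[of "char_re z - fst (h z)" "char_re w - fst (h w)"] zw(3) by simp
    moreover have "norm (char_im z - char_im w) \<le> norm (char_im z - snd (h z)) + norm (char_im w - snd (h w))"
      using norm_triangle_ineq4[of "char_im z - snd (h z)" "char_im w - snd (h w)"] zw(3) by simp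
    moreover have "c \<le> 4 * (norm (char_re z - char_re w) + norm (char_im z - char_im w))"
      using char_separation[of z w i] zw by (auto simp: S_def)
    moreover note h(2,3)[OF zw(1)] h(2,3)[OF zw(2)]
    ultimately have "c < 4 * (c / 17 + c / 17 + (c / 17 + c / 17))" by argo
    then show False using c(1) by simp
  qed
  moreover have "h ` S \<subseteq> C \<times> C" using h(1) by blast
  then have "countable (h ` S)" using countable_SIGMA[OF C(1), of "\<lambda>_. C"] C(1) countable_subset by blast
  ultimately have "countable S" using countable_image_inj_on by blast
  then show False using c(2) by (simp add: S_def)
qed

text \<open>Boundedness gives a limit point, closure of \<open>Y\<close> under bounded limits puts
  it into the spectrum, and the pigeonhole principle makes all terms differ from it in one
  coordinate \<open>j\<close>, the axis along which means are taken later.\<close>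

lemma spectrum_accumulation:
  assumes "infinite {z \<in> spectrum Y. c \<le> cmod (z $ i - 1)}"
  obtains w :: "complex ^ 'd" and j :: 'd and z :: "nat \<Rightarrow> complex ^ 'd" where "w \<in> spectrum Y" "c \<le> cmod (w $ i - 1)"
    "\<And>n. z n \<in> spectrum Y" "\<And>n. z n $ j \<noteq> w $ j" "z \<longlonglongrightarrow> w"
proof -
  define S where "S = {z \<in> spectrum Y. c \<le> cmod (z $ i - 1)}"
  have "bounded S"
    unfolding bounded_iff
  proof (intro exI ballI)
    fix z assume "z \<in> S"
    then have "z \<in> spectrum Y" by (simp add: S_def)
    have "norm z \<le> (\<Sum>k\<in>UNIV. cmod (z $ k))" unfolding norm_vec_def by (rule L2_set_le_sum) simp
    then show "norm z \<le> real CARD('d)" using spectrum_norm[OF \<open>z \<in> spectrum Y\<close>] by simp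
  qed
  then obtain w where "w islimpt S"
    using bounded_infinite_imp_islimpt[of S S] assms by (auto simp: S_def)
  then obtain y where y: "\<And>n. y n \<in> S - {w}" "y \<longlonglongrightarrow> w"
    unfolding islimpt_sequential by blast
  have comp: "(\<lambda>n. y n $ k) \<longlonglongrightarrow> w $ k" for k by (intro tendsto_intros y)
  have "\<forall>n. \<exists>k. y n $ k \<noteq> w $ k" using y(1) by (auto simp: vec_eq_iff)
  then obtain k where k: "\<And>n. y n $ k n \<noteq> w $ k n" by metis
  have "\<exists>n0\<in>UNIV. infinite {n \<in> UNIV. k n = k n0}"
    by (rule pigeonhole_infinite) (auto intro: finite_subset[OF subset_UNIV])
  then obtain j where "infinite {n. k n = j}" by auto
  then obtain r :: "nat \<Rightarrow> nat" where r: "strict_mono r" "\<And>n. k (r n) = j"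
    using infinite_enumerate[of "{n. k n = j}"] by auto
  have y_spec: "y n \<in> spectrum Y" "c \<le> cmod (y n $ i - 1)" for n using y(1)[of n] by (auto simp: S_def)
  have "cmod (w $ k) = 1" for k
    by (rule LIMSEQ_unique[OF tendsto_norm[OF comp]]) (simp add: spectrum_norm[OF y_spec(1)])
  then have w: "w \<in> unit_torus" by (simp add: unit_torus_def)
  have "lattice_char w \<in> Y"
  proof (rule shift_space.limit[OF shift_space_Y, of "\<lambda>n. lattice_char (y n)" 1])
    show "(\<lambda>n. lattice_char (y n) x) \<longlonglongrightarrow> lattice_char w x" for x
      unfolding lattice_char_def using unit_torus_nonzero[OF w] by (intro tendsto_intros comp)
  qed (use y_spec spectrum_cmod_char in \<open>auto simp: spectrum_def\<close>)
  then have "w \<in> spectrum Y" using w by (simp add: spectrum_def)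
  moreover have "c \<le> cmod (w $ i - 1)"
    by (rule LIMSEQ_le_const[OF tendsto_norm[OF tendsto_diff[OF comp tendsto_const]]]) (use y_spec(2) in auto)
  moreover have "(\<lambda>n. y (r n)) \<longlonglongrightarrow> w" using LIMSEQ_subseq_LIMSEQ[OF y(2) r(1)] by (simp add: o_def)
  ultimately show ?thesis
    using that[of w "\<lambda>n. y (r n)" j] y_spec(1) k r(2) by metis
qed

end

section \<open>The predual\<close>

lemma subspace_closure_of_subspace:
  fixes S :: "'a::real_normed_vector set"
  assumes S: "subspace S"
  shows "subspace (closure S)"
proof (rule subspaceI)
  show "0 \<in> closure S" using subspace_0[OF S] closure_subset by blast
next
  fix x y assume "x \<in> closure S" "y \<in> closure S"
  then obtain u v where "\<And>n. u n \<in> S" "u \<longlonglongrightarrow> x" "\<And>n. v n \<in> S" "v \<longlonglongrightarrow> y"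
    unfolding closure_sequential by blast
  then have "\<forall>n. u n + v n \<in> S" "(\<lambda>n. u n + v n) \<longlonglongrightarrow> x + y"
    using subspace_add[OF S] by (auto intro: tendsto_add)
  then show "x + y \<in> closure S" unfolding closure_sequential by (intro exI[of _ "\<lambda>n. u n + v n"]) simp
next
  fix c x assume "x \<in> closure S"
  then obtain u where "\<And>n. u n \<in> S" "u \<longlonglongrightarrow> x" unfolding closure_sequential by blast
  then have "\<forall>n. c *\<^sub>R u n \<in> S" "(\<lambda>n. c *\<^sub>R u n) \<longlonglongrightarrow> c *\<^sub>R x"
    using subspace_scale[OF S] by (auto intro: tendsto_scaleR)
  then show "c *\<^sub>R x \<in> closure S" unfolding closure_sequential by (intro exI[of _ "\<lambda>n. c *\<^sub>R u n"]) simp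
qed

lemma subspace_lipschitz_free: "subspace lipschitz_free"
  unfolding lipschitz_free_def by (rule subspace_closure_of_subspace) (rule subspace_span)

lemma delta_mem_lipschitz_free: "delta v \<in> lipschitz_free"
  unfolding lipschitz_free_def by (intro subsetD[OF closure_subset] span_base) simp

text \<open>Pointwise convergence is convergence against the span of the point evaluations; for
  bounded sequences it extends to the closure by approximation in norm.\<close>

lemma lipschitz_free_weak_star_continuous:
  fixes f0 :: "'d::finite lip0" and z :: "'d lip0 \<Rightarrow>\<^sub>L real"
  assumes z: "z \<in> lipschitz_free" and K: "\<And>n. norm (f n) \<le> K" "norm f0 \<le> K"
    and lim: "\<And>x. (\<lambda>n. lip0_apply (f n) x) \<longlonglongrightarrow> lip0_apply f0 x"
  shows "(\<lambda>n. blinfun_apply z (f n)) \<longlonglongrightarrow> blinfun_apply z f0"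
proof -
  define S where "S = {s :: 'd lip0 \<Rightarrow>\<^sub>L real. (\<lambda>n. blinfun_apply s (f n)) \<longlonglongrightarrow> blinfun_apply s f0}"
  have "subspace S"
    by (rule subspaceI) (auto simp: S_def blinfun.add_left blinfun.scaleR_left intro: tendsto_intros)
  moreover have "range delta \<subseteq> S" using lim by (auto simp: S_def delta.rep_eq)
  ultimately have span: "span (range delta) \<subseteq> S" by (rule span_minimal[rotated])
  have "0 \<le> K" using K(2) norm_ge_zero order_trans by blast
  show ?thesis
  proof (rule metric_LIMSEQ_I)
    fix \<epsilon> :: real assume \<epsilon>: "0 < \<epsilon>"
    then have "0 < \<epsilon> / (3 * (K + 1))" using \<open>0 \<le> K\<close> by simp
    then obtain s where s: "s \<in> span (range delta)" "dist s z < \<epsilon> / (3 * (K + 1))"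
      using z unfolding lipschitz_free_def closure_approachable by blast
    have small: "\<bar>blinfun_apply z g - blinfun_apply s g\<bar> \<le> \<epsilon> / 3" if "norm g \<le> K" for g
    proof -
      have "\<bar>blinfun_apply (z - s) g\<bar> \<le> norm (z - s) * norm g"
        using norm_blinfun[of "z - s" g] by simp
      also have "\<dots> \<le> \<epsilon> / (3 * (K + 1)) * (K + 1)"
        using s(2) that \<open>0 \<le> K\<close> \<epsilon> by (intro mult_mono) (auto simp: dist_norm norm_minus_commute)
      also have "\<dots> = \<epsilon> / 3" using \<open>0 \<le> K\<close> by (simp add: divide_simps)
      finally show ?thesis by (simp add: blinfun.diff_left)
    qed
    have "(\<lambda>n. blinfun_apply s (f n)) \<longlonglongrightarrow> blinfun_apply s f0" using span s(1) by (auto simp: S_def)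
    then obtain n0 where n0: "\<And>n. n \<ge> n0 \<Longrightarrow> dist (blinfun_apply s (f n)) (blinfun_apply s f0) < \<epsilon> / 3"
      using metric_LIMSEQ_D[of _ _ "\<epsilon> / 3"] \<epsilon> by fastforce
    show "\<exists>n0. \<forall>n\<ge>n0. dist (blinfun_apply z (f n)) (blinfun_apply z f0) < \<epsilon>"
    proof (intro exI allI impI)
      fix n assume "n0 \<le> n"
      then have "\<bar>blinfun_apply s (f n) - blinfun_apply s f0\<bar> < \<epsilon> / 3" using n0[of n] by (simp add: dist_real_def)
      then show "dist (blinfun_apply z (f n)) (blinfun_apply z f0) < \<epsilon>"
        using small[OF K(1)[of n]] small[OF K(2)] unfolding dist_real_def by linarith
    qed
  qed
qed

text \<open>Tychonoff's theorem for a product of discs. In this form every closed condition that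
  holds eventually along \<open>A\<close> passes to the cluster point, which is how linearity,
  bounds and values are transferred.\<close>

lemma cluster_functional:
  fixes A :: "nat \<Rightarrow> 'a::real_normed_vector \<Rightarrow> complex"
  assumes "\<And>n f. cmod (A n f) \<le> norm f"
  shows "\<exists>\<Lambda>. \<forall>C. closed C \<longrightarrow> (\<forall>\<^sub>F n in sequentially. A n \<in> C) \<longrightarrow> \<Lambda> \<in> C"
proof -
  define K where "K = PiE UNIV (\<lambda>f :: 'a. cball (0 :: complex) (norm f))"
  have "compactin (product_topology (\<lambda>_ :: 'a. euclidean :: complex topology) UNIV) K"
    unfolding K_def compactin_PiE by simp
  then have "compact K" by (simp add: euclidean_product_topology)
  moreover have "\<forall>\<^sub>F x in filtermap A sequentially. x \<in> K"
    using assms by (simp add: eventually_filtermap K_def PiE_iff)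
  moreover have "filtermap A sequentially \<noteq> bot" by (simp add: filtermap_bot_iff)
  ultimately obtain \<Lambda> where \<Lambda>: "inf (nhds \<Lambda>) (filtermap A sequentially) \<noteq> bot"
    unfolding compact_filter by blast
  have "\<Lambda> \<in> C" if C: "closed C" "\<forall>\<^sub>F n in sequentially. A n \<in> C" for C
  proof (rule ccontr)
    assume "\<Lambda> \<notin> C"
    then have "\<forall>\<^sub>F x in nhds \<Lambda>. x \<in> - C" using C(1) by (intro eventually_nhds_in_open) auto
    moreover have "\<forall>\<^sub>F x in filtermap A sequentially. x \<in> C" using C(2) by (simp add: eventually_filtermap)
    ultimately have "\<forall>\<^sub>F x in inf (nhds \<Lambda>) (filtermap A sequentially). False"
      unfolding eventually_inf by blast
    then show False using \<Lambda> by (simp add: eventually_False)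
  qed
  then show ?thesis by blast
qed

lemma geometric_mean_tendsto_0:
  assumes "cmod \<zeta> = 1" "\<zeta> \<noteq> 1"
  shows "(\<lambda>N. (\<Sum>n<N. \<zeta> ^ n) / of_nat N) \<longlonglongrightarrow> 0"
proof (rule Lim_null_comparison)
  show "\<forall>\<^sub>F N in sequentially. cmod ((\<Sum>n<N. \<zeta> ^ n) / of_nat N) \<le> (2 / cmod (\<zeta> - 1)) * (1 / real N)"
  proof (intro always_eventually allI)
    fix N
    have "cmod (\<zeta> ^ N - 1) \<le> 2"
      using norm_triangle_ineq4[of "\<zeta> ^ N" 1] assms(1) by (simp add: norm_power)
    then have "cmod (\<Sum>n<N. \<zeta> ^ n) \<le> 2 / cmod (\<zeta> - 1)"
      using assms(2) by (simp add: geometric_sum norm_divide divide_right_mono)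
    then have "cmod (\<Sum>n<N. \<zeta> ^ n) * (1 / real N) \<le> 2 / cmod (\<zeta> - 1) * (1 / real N)"
      by (rule mult_right_mono) simp
    then show "cmod ((\<Sum>n<N. \<zeta> ^ n) / of_nat N) \<le> (2 / cmod (\<zeta> - 1)) * (1 / real N)"
      by (simp add: norm_divide)
  qed
  show "(\<lambda>N. (2 / cmod (\<zeta> - 1)) * (1 / real N)) \<longlonglongrightarrow> 0"
    using tendsto_mult_right_zero[OF lim_1_over_n, of "2 / cmod (\<zeta> - 1)"] by simp
qed

context invariant_lip_space
begin

text \<open>A cluster point of the averages along the \<open>j\<close>-axis of the differences in direction \<open>i\<close>, twisted
  by the inverse of the character \<open>w\<close>.\<close>

lemma mean_functional:
  fixes w :: "complex ^ 'd"
  assumes w: "w \<in> spectrum Y"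
  obtains \<Lambda> :: "'d lip0 \<Rightarrow> complex" where
    "\<And>f g. \<Lambda> (f + g) = \<Lambda> f + \<Lambda> g" "\<And>c f. \<Lambda> (c *\<^sub>R f) = of_real c * \<Lambda> f" "\<And>f. cmod (\<Lambda> f) \<le> norm f"
    "\<Lambda> (char_re w) + \<i> * \<Lambda> (char_im w) = w $ i - 1"
    "\<And>z. z \<in> spectrum Y \<Longrightarrow> z $ j \<noteq> w $ j \<Longrightarrow> \<Lambda> (char_re z) + \<i> * \<Lambda> (char_im z) = 0"
proof -
  define A where "A = (\<lambda>N (f :: 'd lip0).
    (\<Sum>n<N. of_real (lip0_apply f (axis j (int n) + axis i 1) - lip0_apply f (axis j (int n))) * cnj (w $ j) ^ n) / of_nat N)"
  have A_le: "cmod (A N f) \<le> norm f" for N f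
  proof -
    have "cmod (\<Sum>n<N. of_real (lip0_apply f (axis j (int n) + axis i 1) - lip0_apply f (axis j (int n))) * cnj (w $ j) ^ n)
        \<le> (\<Sum>n<N. norm f)"
    proof (rule sum_norm_le)
      fix n
      show "cmod (of_real (lip0_apply f (axis j (int n) + axis i 1) - lip0_apply f (axis j (int n))) * cnj (w $ j) ^ n) \<le> norm f"
        using lip0_bound[of f "axis j (int n) + axis i 1" "axis j (int n)"]
        by (simp add: norm_mult norm_power spectrum_norm[OF w] zdist_add_left zdist_axis del: of_real_diff)
    qed
    then show ?thesis by (cases "N = 0") (auto simp: A_def norm_divide divide_simps mult.commute)
  qed
  have A_add: "A N (f + g) = A N f + A N g" for N f g
    by (simp add: A_def sum.distrib algebra_simps add_divide_distrib sum_subtractf diff_divide_distrib)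
  have A_scale: "A N (c *\<^sub>R f) = of_real c * A N f" for N c f
    by (simp add: A_def sum_distrib_left algebra_simps)
  \<comment> \<open>Differences cancel the constant subtracted in \<open>char_re\<close>, real and
    imaginary parts recombine to the complex character, and the twist leaves an average of
    powers.\<close>
  have A_char: "A N (char_re z) + \<i> * A N (char_im z) = (z $ i - 1) * ((\<Sum>n<N. (z $ j * cnj (w $ j)) ^ n) / of_nat N)"
    if z: "z \<in> spectrum Y" for N z
  proof -
    have summand: "of_real (lip0_apply (char_re z) (x + axis i 1) - lip0_apply (char_re z) x) * u +
        \<i> * (of_real (lip0_apply (char_im z) (x + axis i 1) - lip0_apply (char_im z) x) * u) =
        (z $ i - 1) * (lattice_char z x * u)" for x u
    proof -
      define p q where "p = lattice_char z (x + axis i 1)" and "q = lattice_char z x"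
      have "of_real (lip0_apply (char_re z) (x + axis i 1) - lip0_apply (char_re z) x) * u +
        \<i> * (of_real (lip0_apply (char_im z) (x + axis i 1) - lip0_apply (char_im z) x) * u) =
        ((of_real (Re p) + \<i> * of_real (Im p)) - (of_real (Re q) + \<i> * of_real (Im q))) * u"
        by (simp add: char_apply[OF z] p_def q_def algebra_simps)
      also have "\<dots> = (p - q) * u" by (simp only: complex_eq[symmetric])
      also have "p = z $ i * q"
        by (simp add: p_def q_def spectrum_char_add[OF z] lattice_char_axis mult.commute)
      finally show ?thesis by (simp add: q_def algebra_simps)
    qed
    have "A N (char_re z) + \<i> * A N (char_im z) =
        (\<Sum>n<N. (z $ i - 1) * (lattice_char z (axis j (int n)) * cnj (w $ j) ^ n)) / of_nat N"
      unfolding A_def summand[symmetric] sum.distrib sum_distrib_left add_divide_distrib by (simp add: sum_distrib_left)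
    then show ?thesis by (simp add: lattice_char_axis_of_nat power_mult_distrib sum_distrib_left)
  qed
  obtain \<Lambda> where \<Lambda>: "\<And>C. closed C \<Longrightarrow> (\<forall>\<^sub>F n in sequentially. A n \<in> C) \<Longrightarrow> \<Lambda> \<in> C"
    using cluster_functional[of A, OF A_le] by blast
  have coord: "continuous_on UNIV (\<lambda>\<Lambda> :: 'd lip0 \<Rightarrow> complex. \<Lambda> f)" for f by simp
  show ?thesis
  proof (rule that[of \<Lambda>])
    fix f g
    have "\<Lambda> \<in> {\<Lambda>. \<Lambda> (f + g) = \<Lambda> f + \<Lambda> g}"
      by (rule \<Lambda>) (auto intro!: closed_Collect_eq continuous_intros coord simp: A_add)
    then show "\<Lambda> (f + g) = \<Lambda> f + \<Lambda> g" by simp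
  next
    fix c f
    have "\<Lambda> \<in> {\<Lambda>. \<Lambda> (c *\<^sub>R f) = of_real c * \<Lambda> f}"
      by (rule \<Lambda>) (auto intro!: closed_Collect_eq continuous_intros coord simp: A_scale)
    then show "\<Lambda> (c *\<^sub>R f) = of_real c * \<Lambda> f" by simp
  next
    fix f
    have "\<Lambda> \<in> {\<Lambda>. cmod (\<Lambda> f) \<le> norm f}"
      by (rule \<Lambda>) (auto intro!: closed_Collect_le continuous_intros coord simp: A_le)
    then show "cmod (\<Lambda> f) \<le> norm f" by simp
  next
    have "w $ j * cnj (w $ j) = 1"
      by (metis complex_norm_square of_real_1 power_one spectrum_norm[OF w])
    then have "A N (char_re w) + \<i> * A N (char_im w) = w $ i - 1" if "0 < N" for N
      using that by (simp add: A_char[OF w])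
    then have "\<forall>\<^sub>F N in sequentially. A N (char_re w) + \<i> * A N (char_im w) = w $ i - 1"
      by (intro eventually_mono[OF eventually_gt_at_top[of 0]])
    then have "\<Lambda> \<in> {\<Lambda>. \<Lambda> (char_re w) + \<i> * \<Lambda> (char_im w) = w $ i - 1}"
      by (intro \<Lambda>) (auto intro!: closed_Collect_eq continuous_intros coord)
    then show "\<Lambda> (char_re w) + \<i> * \<Lambda> (char_im w) = w $ i - 1" by simp
  next
    fix z assume z: "z \<in> spectrum Y" "z $ j \<noteq> w $ j"
    have "w $ j * cnj (w $ j) = 1"
      by (metis complex_norm_square of_real_1 power_one spectrum_norm[OF w])
    then have "z $ j * cnj (w $ j) \<noteq> 1"
      using z(2) by (metis mult.assoc mult.commute mult_1)
    then have "(\<lambda>N. (\<Sum>n<N. (z $ j * cnj (w $ j)) ^ n) / of_nat N) \<longlonglongrightarrow> 0"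
      by (intro geometric_mean_tendsto_0) (simp_all add: norm_mult spectrum_norm z(1) w)
    then have lim: "(\<lambda>N. A N (char_re z) + \<i> * A N (char_im z)) \<longlonglongrightarrow> 0"
      unfolding A_char[OF z(1)] by (rule tendsto_mult_right_zero)
    \<comment> \<open>The averages only converge to 0, so instead of an equation a closed bound is
      transferred, for each \<open>\<epsilon>\<close>.\<close>
    have small: "cmod (\<Lambda> (char_re z) + \<i> * \<Lambda> (char_im z)) \<le> \<epsilon>" if "0 < \<epsilon>" for \<epsilon>
    proof -
      have "\<forall>\<^sub>F N in sequentially. cmod (A N (char_re z) + \<i> * A N (char_im z)) < \<epsilon>"
        using order_tendstoD(2)[OF tendsto_norm_zero[OF lim] that] .
      then have "\<forall>\<^sub>F N in sequentially. A N \<in> {\<Lambda>. cmod (\<Lambda> (char_re z) + \<i> * \<Lambda> (char_im z)) \<le> \<epsilon>}"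
        by (rule eventually_mono) simp
      then have "\<Lambda> \<in> {\<Lambda>. cmod (\<Lambda> (char_re z) + \<i> * \<Lambda> (char_im z)) \<le> \<epsilon>}"
        by (intro \<Lambda>) (auto intro!: closed_Collect_le continuous_intros coord)
      then show ?thesis by simp
    qed
    have "cmod (\<Lambda> (char_re z) + \<i> * \<Lambda> (char_im z)) \<le> 0"
      by (rule field_le_epsilon, unfold add_0) (rule small)
    then show "\<Lambda> (char_re z) + \<i> * \<Lambda> (char_im z) = 0" by simp
  qed
qed

section \<open>Functionals on the quotient and the functions they represent\<close>

definition Q :: "('d lip0 \<Rightarrow>\<^sub>L real) set normed_structure" where
  "Q = lipschitz_free_quotient X"

definition coset :: "('d lip0 \<Rightarrow>\<^sub>L real) \<Rightarrow> ('d lip0 \<Rightarrow>\<^sub>L real) set" where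
  "coset z = {z + n | n. n \<in> preannihilator X}"

lemma subspace_preannihilator: "subspace (preannihilator X)"
  by (rule subspaceI)
     (auto simp: preannihilator_def blinfun.add_left blinfun.scaleR_left
       intro: subspace_0 subspace_add subspace_scale subspace_lipschitz_free)

lemma carrier_Q: "carrier Q = coset ` lipschitz_free"
  by (auto simp: Q_def lipschitz_free_quotient_def quotient_space_def coset_def)

lemma add_Q: "add_of Q (coset z) (coset w) = coset (z + w)"
  and scale_Q: "scale_of Q c (coset z) = coset (c *\<^sub>R z)"
  and zero_Q: "zero_of Q = coset 0"
  unfolding Q_def lipschitz_free_quotient_def coset_def
  by (rule quotient_space_coset_simps[OF subspace_preannihilator])+

lemma mem_coset: "z \<in> coset z"
  unfolding coset_def using subspace_0[OF subspace_preannihilator] by force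

lemma coset_eq: "z - w \<in> preannihilator X \<Longrightarrow> coset z = coset w"
proof -
  assume zw: "z - w \<in> preannihilator X"
  have "z + n = w + ((z - w) + n)" "w + n = z + (n - (z - w))" for n by simp_all
  then show ?thesis
    unfolding coset_def
    using subspace_add[OF subspace_preannihilator zw] subspace_diff[OF subspace_preannihilator _ zw] by blast
qed

lemma coset_apply:
  assumes "y \<in> coset z" "f \<in> X"
  shows "blinfun_apply y f = blinfun_apply z f"
  using assms by (auto simp: coset_def preannihilator_def blinfun.add_left)

lemma norm_Q: "norm_of Q (coset z) = (INF a\<in>coset z. norm a)"
  by (simp add: Q_def lipschitz_free_quotient_def quotient_space_def)

lemma norm_Q_le: "norm_of Q (coset z) \<le> norm z"
  unfolding norm_Q by (rule cINF_lower) (auto intro: bdd_belowI[of _ 0] mem_coset)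

lemma norm_Q_nonneg: "0 \<le> norm_of Q (coset z)"
  unfolding norm_Q by (rule cINF_greatest) (use mem_coset in auto)

definition functional :: "(('d lip0 \<Rightarrow>\<^sub>L real) set \<Rightarrow> real) \<Rightarrow> bool" where
  "functional \<phi> \<longleftrightarrow> \<phi> \<in> carrier (dual Q)"

lemma functional_iff:
  "functional \<phi> \<longleftrightarrow> \<phi> \<in> extensional (carrier Q) \<and>
    (\<forall>z\<in>lipschitz_free. \<forall>w\<in>lipschitz_free. \<phi> (coset (z + w)) = \<phi> (coset z) + \<phi> (coset w)) \<and>
    (\<forall>c. \<forall>z\<in>lipschitz_free. \<phi> (coset (c *\<^sub>R z)) = c * \<phi> (coset z)) \<and>
    (\<exists>C. \<forall>z\<in>lipschitz_free. \<bar>\<phi> (coset z)\<bar> \<le> C * norm_of Q (coset z))"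
  by (simp add: functional_def dual_def carrier_Q add_Q scale_Q)

lemma functional_bounded:
  "functional \<phi> \<Longrightarrow> \<exists>C. \<forall>z\<in>lipschitz_free. \<bar>\<phi> (coset z)\<bar> \<le> C * norm_of Q (coset z)"
  unfolding functional_iff by blast

lemma functionalD:
  assumes "functional \<phi>"
  shows "z \<in> lipschitz_free \<Longrightarrow> w \<in> lipschitz_free \<Longrightarrow> \<phi> (coset (z + w)) = \<phi> (coset z) + \<phi> (coset w)"
    "z \<in> lipschitz_free \<Longrightarrow> \<phi> (coset (c *\<^sub>R z)) = c * \<phi> (coset z)"
    "\<phi> \<in> extensional (carrier Q)"
  using assms by (auto simp: functional_iff)

lemma functional_diff:
  assumes "functional \<phi>" "z \<in> lipschitz_free" "w \<in> lipschitz_free"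
  shows "\<phi> (coset (z - w)) = \<phi> (coset z) - \<phi> (coset w)"
  using functionalD(1)[OF assms(1), of z "(-1) *\<^sub>R w"] functionalD(2)[OF assms(1), of w "-1"] assms(2,3)
    subspace_scale[OF subspace_lipschitz_free, of w "-1"] by simp

lemma functional_sum:
  assumes \<phi>: "functional \<phi>" and r: "\<And>i. i \<in> I \<Longrightarrow> r i \<in> lipschitz_free"
  shows "\<phi> (coset (\<Sum>i\<in>I. a i *\<^sub>R r i)) = (\<Sum>i\<in>I. a i * \<phi> (coset (r i)))"
  using r
proof (induction I rule: infinite_finite_induct)
  case (insert i I)
  have "(\<Sum>i\<in>I. a i *\<^sub>R r i) \<in> lipschitz_free"
    using insert by (intro subspace_sum subspace_scale subspace_lipschitz_free) auto
  then show ?case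
    using insert by (simp add: functionalD[OF \<phi>] subspace_scale subspace_lipschitz_free)
qed (use functionalD(2)[OF \<phi> subspace_0[OF subspace_lipschitz_free], of 0] in simp_all)

lemma dual_add: "add_of (dual Q) \<phi> \<psi> = (\<lambda>x\<in>carrier Q. \<phi> x + \<psi> x)"
  and dual_scale: "scale_of (dual Q) c \<phi> = (\<lambda>x\<in>carrier Q. c * \<phi> x)"
  by (simp_all add: dual_def)

lemma functional_add:
  assumes \<phi>: "functional \<phi>" and \<psi>: "functional \<psi>"
  shows "functional (add_of (dual Q) \<phi> \<psi>)"
proof -
  obtain C D where CD: "\<And>z. z \<in> lipschitz_free \<Longrightarrow> \<bar>\<phi> (coset z)\<bar> \<le> C * norm_of Q (coset z)"
    "\<And>z. z \<in> lipschitz_free \<Longrightarrow> \<bar>\<psi> (coset z)\<bar> \<le> D * norm_of Q (coset z)"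
    using functional_bounded[OF \<phi>] functional_bounded[OF \<psi>] by blast
  have "\<bar>\<phi> (coset z) + \<psi> (coset z)\<bar> \<le> (C + D) * norm_of Q (coset z)" if "z \<in> lipschitz_free" for z
    using CD[OF that] by (simp add: algebra_simps)
  then have "\<exists>K. \<forall>z\<in>lipschitz_free. \<bar>\<phi> (coset z) + \<psi> (coset z)\<bar> \<le> K * norm_of Q (coset z)" by blast
  then show ?thesis
    unfolding functional_iff dual_add
    by (auto simp: carrier_Q functionalD[OF \<phi>] functionalD[OF \<psi>] algebra_simps
        subspace_add[OF subspace_lipschitz_free] subspace_scale[OF subspace_lipschitz_free])
qed

lemma functional_scale:
  assumes \<phi>: "functional \<phi>"
  shows "functional (scale_of (dual Q) c \<phi>)"
proof -
  obtain C where C: "\<And>z. z \<in> lipschitz_free \<Longrightarrow> \<bar>\<phi> (coset z)\<bar> \<le> C * norm_of Q (coset z)"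
    using functional_bounded[OF \<phi>] by blast
  have "\<bar>c * \<phi> (coset z)\<bar> \<le> (\<bar>c\<bar> * C) * norm_of Q (coset z)" if "z \<in> lipschitz_free" for z
    using mult_left_mono[OF C[OF that], of "\<bar>c\<bar>"] by (simp add: abs_mult mult.assoc)
  then have "\<exists>K. \<forall>z\<in>lipschitz_free. \<bar>c * \<phi> (coset z)\<bar> \<le> K * norm_of Q (coset z)" by blast
  then show ?thesis
    unfolding functional_iff dual_scale
    by (auto simp: carrier_Q functionalD[OF \<phi>] algebra_simps
        subspace_add[OF subspace_lipschitz_free] subspace_scale[OF subspace_lipschitz_free])
qed

text \<open>A coset has norm at most that of its representative, so \<open>z\<close> can be
  normalised by its own norm, which is positive unless \<open>z = 0\<close>.\<close>

lemma dual_norm_bound: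
  assumes \<phi>: "functional \<phi>" and z: "z \<in> lipschitz_free"
  shows "\<bar>\<phi> (coset z)\<bar> \<le> norm z * norm_of (dual Q) \<phi>"
proof -
  obtain C where C: "\<And>z. z \<in> lipschitz_free \<Longrightarrow> \<bar>\<phi> (coset z)\<bar> \<le> C * norm_of Q (coset z)"
    using functional_bounded[OF \<phi>] by blast
  have bdd: "bdd_above ((\<lambda>x. \<bar>\<phi> x\<bar>) ` {x \<in> carrier Q. norm_of Q x \<le> 1})"
  proof (rule bdd_aboveI2)
    fix x assume "x \<in> {x \<in> carrier Q. norm_of Q x \<le> 1}"
    then obtain y where y: "y \<in> lipschitz_free" "x = coset y" "norm_of Q (coset y) \<le> 1" by (auto simp: carrier_Q)
    have "\<bar>\<phi> x\<bar> \<le> C * norm_of Q (coset y)" using C y by simp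
    also have "\<dots> \<le> \<bar>C\<bar> * 1" using y(3) norm_Q_nonneg[of y] by (intro mult_mono) auto
    finally show "\<bar>\<phi> x\<bar> \<le> \<bar>C\<bar>" by simp
  qed
  have unit: "\<bar>\<phi> (coset y)\<bar> \<le> norm_of (dual Q) \<phi>" if "y \<in> lipschitz_free" "norm y \<le> 1" for y
  proof -
    have "coset y \<in> {x \<in> carrier Q. norm_of Q x \<le> 1}"
      using that norm_Q_le[of y] by (auto simp: carrier_Q)
    then have "\<bar>\<phi> (coset y)\<bar> \<le> (SUP x\<in>{x \<in> carrier Q. norm_of Q x \<le> 1}. \<bar>\<phi> x\<bar>)"
      by (intro cSUP_upper bdd)
    then show ?thesis by (simp add: dual_def)
  qed
  show ?thesis
  proof (cases "z = 0")
    case True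
    then show ?thesis using functionalD(2)[OF \<phi> z, of 0] by simp
  next
    case False
    have "\<bar>\<phi> (coset ((1 / norm z) *\<^sub>R z))\<bar> \<le> norm_of (dual Q) \<phi>"
      using False by (intro unit subspace_scale subspace_lipschitz_free z) simp
    then have "\<bar>\<phi> (coset z)\<bar> / norm z \<le> norm_of (dual Q) \<phi>" by (simp add: functionalD[OF \<phi>] z)
    then show ?thesis using False by (simp add: pos_divide_le_eq mult.commute)
  qed
qed

text \<open>Together with \<open>functional_of\<close> this identifies the dual of the quotient with
  \<open>X\<close>: a functional is read off at the point evaluations.\<close>

definition function_of :: "(('d lip0 \<Rightarrow>\<^sub>L real) set \<Rightarrow> real) \<Rightarrow> 'd lip0" where
  "function_of \<phi> = Lip0 (\<lambda>v. \<phi> (coset (delta v)))"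

lemma functional_delta:
  assumes \<phi>: "functional \<phi>"
  shows "\<bar>\<phi> (coset (delta v)) - \<phi> (coset (delta w))\<bar> \<le> norm_of (dual Q) \<phi> * zdist v w"
  using dual_norm_bound[OF \<phi> subspace_diff[OF subspace_lipschitz_free delta_mem_lipschitz_free delta_mem_lipschitz_free], of v w]
    functional_diff[OF \<phi>, of "delta v" "delta w"]
  by (simp add: delta_mem_lipschitz_free delta_isometric mult.commute)

text \<open>A finitely supported annihilator of \<open>L\<close> gives an element of the
  preannihilator. Its coset is zero, so the functional vanishes there, and \<open>mem_L_iff\<close>
  applies.\<close>

lemma functional_delta_mem_L:
  assumes \<phi>: "functional \<phi>"
  shows "(\<lambda>v. \<phi> (coset (delta v))) \<in> L"
  unfolding mem_L_iff
proof (intro conjI allI impI)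
  show "(\<lambda>v. \<phi> (coset (delta v))) \<in> lip0_functions"
  proof (rule lip0_functionsI[OF _ functional_delta[OF \<phi>]])
    show "\<phi> (coset (delta 0)) = 0"
      using functionalD(2)[OF \<phi> subspace_0[OF subspace_lipschitz_free], of 0] by (simp add: delta_0)
  qed
  fix F a assume Fa: "annihilates F a"
  define z where "z = (\<Sum>v\<in>F. a v *\<^sub>R delta v)"
  have z_free: "z \<in> lipschitz_free"
    unfolding z_def by (intro subspace_sum subspace_scale subspace_lipschitz_free delta_mem_lipschitz_free)
  have "blinfun_apply z f = 0" if "f \<in> X" for f
    using Fa that by (simp add: z_def blinfun.sum_left blinfun.scaleR_left delta.rep_eq annihilates_def L_def)
  then have "coset z = coset 0" using z_free by (intro coset_eq) (simp add: preannihilator_def)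
  then have "\<phi> (coset z) = 0"
    using functionalD(2)[OF \<phi> subspace_0[OF subspace_lipschitz_free], of 0] by simp
  then show "(\<Sum>v\<in>F. a v * \<phi> (coset (delta v))) = 0"
    using functional_sum[OF \<phi>, of F delta a] by (simp add: z_def delta_mem_lipschitz_free)
qed

lemma function_of:
  assumes "functional \<phi>"
  shows "function_of \<phi> \<in> X" "lip0_apply (function_of \<phi>) v = \<phi> (coset (delta v))"
    "norm (function_of \<phi>) \<le> norm_of (dual Q) \<phi>"
proof -
  show "function_of \<phi> \<in> X" unfolding function_of_def by (intro Lip0_mem functional_delta_mem_L assms)
  show ap: "lip0_apply (function_of \<phi>) v = \<phi> (coset (delta v))" for v
    unfolding function_of_def by (simp add: Lip0_inverse L_lip0 functional_delta_mem_L assms)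
  show "norm (function_of \<phi>) \<le> norm_of (dual Q) \<phi>"
    by (rule lip0_norm_le) (simp add: ap functional_delta assms)
qed

text \<open>For \<open>f\<close> in \<open>X\<close> all members of a coset take the same value at
  \<open>f\<close>, so any choice of representative gives the same functional.\<close>

definition functional_of :: "'d lip0 \<Rightarrow> ('d lip0 \<Rightarrow>\<^sub>L real) set \<Rightarrow> real" where
  "functional_of f = (\<lambda>B\<in>carrier Q. blinfun_apply (SOME z. z \<in> B) f)"

lemma functional_of_coset:
  fixes z :: "'d lip0 \<Rightarrow>\<^sub>L real"
  assumes "f \<in> X" "z \<in> lipschitz_free"
  shows "functional_of f (coset z) = blinfun_apply z f"
proof -
  have "(SOME y. y \<in> coset z) \<in> coset z" using mem_coset by (rule someI)
  then show ?thesis using assms coset_apply by (simp add: functional_of_def carrier_Q)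
qed

lemma functional_functional_of:
  assumes f: "f \<in> X"
  shows "functional (functional_of f)"
  unfolding functional_iff
proof (intro conjI ballI allI)
  show "functional_of f \<in> extensional (carrier Q)" by (simp add: functional_of_def)
  show "\<exists>C. \<forall>z\<in>lipschitz_free. \<bar>functional_of f (coset z)\<bar> \<le> C * norm_of Q (coset z)"
  proof (intro exI ballI)
    fix z :: "'d lip0 \<Rightarrow>\<^sub>L real" assume z: "z \<in> lipschitz_free"
    show "\<bar>functional_of f (coset z)\<bar> \<le> norm f * norm_of Q (coset z)"
    proof (cases "norm f = 0")
      case True
      then show ?thesis using functional_of_coset[OF f z] by simp
    next
      case False
      have "\<bar>blinfun_apply z f\<bar> / norm f \<le> norm_of Q (coset z)"
        unfolding norm_Q
      proof (rule cINF_greatest)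
        fix y assume "y \<in> coset z"
        then have "\<bar>blinfun_apply z f\<bar> \<le> norm y * norm f"
          using norm_blinfun[of y f] coset_apply f by simp
        then show "\<bar>blinfun_apply z f\<bar> / norm f \<le> norm y" using False by (simp add: pos_divide_le_eq)
      qed (use mem_coset in auto)
      then show ?thesis using False by (simp add: functional_of_coset f z pos_divide_le_eq mult.commute)
    qed
  qed
qed (simp_all add: functional_of_coset f subspace_add subspace_scale subspace_lipschitz_free blinfun.add_left blinfun.scaleR_left)

lemma function_of_functional_of:
  assumes "f \<in> X"
  shows "function_of (functional_of f) = f"
  by (rule lip0_eqI)
     (simp add: function_of(2)[OF functional_functional_of[OF assms]] functional_of_coset assms delta_mem_lipschitz_free delta.rep_eq)

lemma function_of_add:
  assumes "functional \<phi>" "functional \<psi>"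
  shows "function_of (add_of (dual Q) \<phi> \<psi>) = function_of \<phi> + function_of \<psi>"
  by (rule lip0_eqI)
     (simp add: function_of functional_add assms, simp add: dual_add carrier_Q delta_mem_lipschitz_free)

lemma function_of_scale:
  assumes "functional \<phi>"
  shows "function_of (scale_of (dual Q) c \<phi>) = c *\<^sub>R function_of \<phi>"
  by (rule lip0_eqI)
     (simp add: function_of functional_scale assms, simp add: dual_scale carrier_Q delta_mem_lipschitz_free)

lemma mem_bidual_iff:
  "\<Psi> \<in> carrier (dual (dual Q)) \<longleftrightarrow> \<Psi> \<in> extensional (Collect functional) \<and>
    (\<forall>\<phi> \<psi>. functional \<phi> \<longrightarrow> functional \<psi> \<longrightarrow> \<Psi> (add_of (dual Q) \<phi> \<psi>) = \<Psi> \<phi> + \<Psi> \<psi>) \<and>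
    (\<forall>c \<phi>. functional \<phi> \<longrightarrow> \<Psi> (scale_of (dual Q) c \<phi>) = c * \<Psi> \<phi>) \<and>
    (\<exists>C. \<forall>\<phi>. functional \<phi> \<longrightarrow> \<bar>\<Psi> \<phi>\<bar> \<le> C * norm_of (dual Q) \<phi>)"
proof -
  have "Collect functional = carrier (dual Q)" by (auto simp: functional_def)
  then show ?thesis by (subst dual_def) (auto simp: functional_def)
qed

text \<open>Composed with \<open>function_of\<close>, the functional becomes an element of the
  bidual. Reflexivity makes it evaluation at a coset, and \<open>functional_of\<close> translates
  this back to functions in \<open>X\<close>.\<close>

lemma reflexive_imp_represented:
  fixes \<Psi> :: "'d lip0 \<Rightarrow> real"
  assumes "reflexive Q"
    and add: "\<And>f g. \<Psi> (f + g) = \<Psi> f + \<Psi> g" and scale: "\<And>c f. \<Psi> (c *\<^sub>R f) = c * \<Psi> f"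
    and bound: "\<And>f. \<bar>\<Psi> f\<bar> \<le> norm f"
  obtains z :: "'d lip0 \<Rightarrow>\<^sub>L real" where "z \<in> lipschitz_free" "\<And>f. f \<in> X \<Longrightarrow> \<Psi> f = blinfun_apply z f"
proof -
  define \<Psi>' where "\<Psi>' = (\<lambda>\<phi>\<in>Collect functional. \<Psi> (function_of \<phi>))"
  have "\<Psi>' \<in> carrier (dual (dual Q))"
    unfolding mem_bidual_iff
  proof (intro conjI allI impI)
    show "\<exists>C. \<forall>\<phi>. functional \<phi> \<longrightarrow> \<bar>\<Psi>' \<phi>\<bar> \<le> C * norm_of (dual Q) \<phi>"
      by (intro exI[of _ 1]) (auto simp: \<Psi>'_def intro: order_trans[OF bound function_of(3)])
  qed (auto simp: \<Psi>'_def functional_add functional_scale function_of_add function_of_scale add scale)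
  then have "\<Psi>' \<in> bidual_embedding Q ` carrier Q" using assms(1) by (simp add: reflexive_def)
  then obtain z :: "'d lip0 \<Rightarrow>\<^sub>L real" where z: "z \<in> lipschitz_free" "\<Psi>' = bidual_embedding Q (coset z)" by (auto simp: carrier_Q)
  have "\<Psi> f = blinfun_apply z f" if f: "f \<in> X" for f
  proof -
    have "\<Psi>' (functional_of f) = functional_of f (coset z)"
      using functional_functional_of[OF f] by (simp add: z(2) bidual_embedding_def functional_def)
    then show ?thesis
      using functional_functional_of[OF f]
      by (simp add: \<Psi>'_def function_of_functional_of f functional_of_coset z(1))
  qed
  then show ?thesis using that z(1) by blast
qed

theorem uncountable_spectrum_imp_nonreflexive:
  assumes "uncountable (spectrum Y)"
  shows "\<not> reflexive Q"
proof
  assume refl: "reflexive Q"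
  obtain i c where c: "0 < c" "uncountable {z \<in> spectrum Y. c \<le> cmod (z $ i - 1)}"
    using uncountable_spectrum_slice[OF assms] .
  have "infinite {z \<in> spectrum Y. c \<le> cmod (z $ i - 1)}" using c(2) countable_finite by blast
  then obtain w :: "complex ^ 'd" and j :: 'd and z :: "nat \<Rightarrow> complex ^ 'd" where w: "w \<in> spectrum Y" "c \<le> cmod (w $ i - 1)"
    and z: "\<And>n. z n \<in> spectrum Y" "\<And>n. z n $ j \<noteq> w $ j" "z \<longlonglongrightarrow> w"
    by (rule spectrum_accumulation) blast
  obtain \<Lambda> :: "'d lip0 \<Rightarrow> complex" where
    \<Lambda>: "\<And>f g. \<Lambda> (f + g) = \<Lambda> f + \<Lambda> g" "\<And>c f. \<Lambda> (c *\<^sub>R f) = of_real c * \<Lambda> f" "\<And>f. cmod (\<Lambda> f) \<le> norm f"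
    "\<Lambda> (char_re w) + \<i> * \<Lambda> (char_im w) = w $ i - 1"
    "\<And>z. z \<in> spectrum Y \<Longrightarrow> z $ j \<noteq> w $ j \<Longrightarrow> \<Lambda> (char_re z) + \<i> * \<Lambda> (char_im z) = 0"
    using mean_functional[OF w(1), where i = i and j = j] by blast
  \<comment> \<open>The predual is a real space, so the real and imaginary parts of the mean are
    represented separately.\<close>
  obtain r where r: "r \<in> lipschitz_free" "\<And>f. f \<in> X \<Longrightarrow> Re (\<Lambda> f) = blinfun_apply r f"
    by (rule reflexive_imp_represented[OF refl, of "\<lambda>f. Re (\<Lambda> f)"])
       (use \<Lambda>(1,2) order_trans[OF abs_Re_le_cmod \<Lambda>(3)] in auto)
  obtain s where s: "s \<in> lipschitz_free" "\<And>f. f \<in> X \<Longrightarrow> Im (\<Lambda> f) = blinfun_apply s f"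
    by (rule reflexive_imp_represented[OF refl, of "\<lambda>f. Im (\<Lambda> f)"])
       (use \<Lambda>(1,2) order_trans[OF abs_Im_le_cmod \<Lambda>(3)] in auto)
  have rep: "\<Lambda> f = of_real (blinfun_apply r f) + \<i> * of_real (blinfun_apply s f)" if "f \<in> X" for f
    using r(2)[OF that] s(2)[OF that] by (simp add: complex_eq_iff)
  have char_lim: "(\<lambda>n. lattice_char (z n) x) \<longlonglongrightarrow> lattice_char w x" for x
    unfolding lattice_char_def using unit_torus_nonzero[OF spectrum_torus[OF w(1)]]
    by (intro tendsto_intros z(3))
  have lims: "(\<lambda>n. blinfun_apply y (char_re (z n))) \<longlonglongrightarrow> blinfun_apply y (char_re w)"
    "(\<lambda>n. blinfun_apply y (char_im (z n))) \<longlonglongrightarrow> blinfun_apply y (char_im w)" if "y \<in> lipschitz_free" for y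
    using norm_char_le[OF z(1)] norm_char_le[OF w(1)]
    by (intro lipschitz_free_weak_star_continuous[OF that, where K = 2];
        simp add: char_apply z(1) w(1); intro tendsto_intros char_lim)+
  have \<Lambda>_lims: "(\<lambda>n. \<Lambda> (char_re (z n))) \<longlonglongrightarrow> \<Lambda> (char_re w)" "(\<lambda>n. \<Lambda> (char_im (z n))) \<longlonglongrightarrow> \<Lambda> (char_im w)"
    unfolding rep[OF char_mem_X(1)[OF z(1)]] rep[OF char_mem_X(1)[OF w(1)]]
      rep[OF char_mem_X(2)[OF z(1)]] rep[OF char_mem_X(2)[OF w(1)]]
    by (intro tendsto_intros lims r s)+
  \<comment> \<open>The mean is 0 at every \<open>z n\<close>, so weak-star continuity would make it
    0 at \<open>w\<close>, where its value \<open>w $ i - 1\<close> has modulus at least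
    \<open>c\<close>.\<close>
  have "(\<lambda>n. \<Lambda> (char_re (z n)) + \<i> * \<Lambda> (char_im (z n))) \<longlonglongrightarrow> \<Lambda> (char_re w) + \<i> * \<Lambda> (char_im w)"
    by (intro tendsto_intros \<Lambda>_lims)
  then have "w $ i - 1 = 0" unfolding \<Lambda>(4) \<Lambda>(5)[OF z(1,2)] by (simp add: LIMSEQ_const_iff)
  then show False using w(2) c(1) by simp
qed

text \<open>An element of the bidual depends on a functional only through its values on the finite
  spanning set \<open>B\<close>. It is therefore a combination of evaluations at points of
  \<open>B\<close>, that is, evaluation at one coset.\<close>

theorem finite_dimensional_imp_reflexive:
  assumes "finite_dimensional Q"
  shows "reflexive Q"
proof -
  obtain B where B: "finite B" "B \<subseteq> carrier Q" "subspace_of Q hull B = carrier Q"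
    using assms by (auto simp: finite_dimensional_def)
  have "bidual_embedding Q (coset z) \<in> carrier (dual (dual Q))" if z: "z \<in> lipschitz_free" for z
    unfolding mem_bidual_iff
  proof (intro conjI allI impI)
    show "\<exists>C. \<forall>\<phi>. functional \<phi> \<longrightarrow> \<bar>bidual_embedding Q (coset z) \<phi>\<bar> \<le> C * norm_of (dual Q) \<phi>"
      using dual_norm_bound[OF _ z] by (intro exI[of _ "norm z"]) (simp add: bidual_embedding_def functional_def)
  qed (use z functional_add functional_scale in
      \<open>auto simp: bidual_embedding_def functional_def extensional_def dual_add dual_scale carrier_Q\<close>)
  moreover have "\<Psi> \<in> bidual_embedding Q ` carrier Q" if \<Psi>: "\<Psi> \<in> carrier (dual (dual Q))" for \<Psi>
  proof -
    have \<Psi>_ext: "\<Psi> \<in> extensional (Collect functional)"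
      and \<Psi>_add: "\<And>\<phi> \<psi>. functional \<phi> \<Longrightarrow> functional \<psi> \<Longrightarrow> \<Psi> (add_of (dual Q) \<phi> \<psi>) = \<Psi> \<phi> + \<Psi> \<psi>"
      and \<Psi>_scale: "\<And>c \<phi>. functional \<phi> \<Longrightarrow> \<Psi> (scale_of (dual Q) c \<phi>) = c * \<Psi> \<phi>"
      using \<Psi> unfolding mem_bidual_iff by blast+
    \<comment> \<open>Functionals are \<open>undefined\<close> outside the carrier; the value 0
      there makes \<open>h\<close> compatible with pointwise sums and multiples.\<close>
    define h where "h = (\<lambda>(\<phi> :: ('d lip0 \<Rightarrow>\<^sub>L real) set \<Rightarrow> real) b. if b \<in> carrier Q then \<phi> b else 0)"
    define W where "W = {(h \<phi>, \<Psi> \<phi>) | \<phi>. functional \<phi>}"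
    have "\<exists>a. \<forall>(g, s)\<in>W. s = (\<Sum>b\<in>B. a b * g b)"
    proof (rule functional_combination[OF B(1)])
      fix g s g' s' c assume "(g, s) \<in> W" "(g', s') \<in> W"
      then obtain \<phi> \<psi> where fn: "functional \<phi>" "g = h \<phi>" "s = \<Psi> \<phi>" "functional \<psi>" "g' = h \<psi>" "s' = \<Psi> \<psi>"
        by (auto simp: W_def)
      define \<theta> where "\<theta> = add_of (dual Q) \<phi> (scale_of (dual Q) c \<psi>)"
      have "functional \<theta>" unfolding \<theta>_def by (intro functional_add functional_scale fn)
      moreover have "(\<lambda>b. g b + c * g' b) = h \<theta>"
        by (simp add: fun_eq_iff fn h_def \<theta>_def dual_add dual_scale)
      moreover have "s + c * s' = \<Psi> \<theta>" by (simp add: fn \<theta>_def \<Psi>_add \<Psi>_scale functional_scale)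
      ultimately show "((\<lambda>b. g b + c * g' b), s + c * s') \<in> W" unfolding W_def by blast
    next
      fix g s assume gs: "(g, s) \<in> W" "\<forall>b\<in>B. g b = 0"
      then obtain \<phi> where fn: "functional \<phi>" "g = h \<phi>" "s = \<Psi> \<phi>" by (auto simp: W_def)
      have "subspace_of Q {A \<in> carrier Q. \<phi> A = 0}"
        unfolding subspace_of_def
      proof (intro conjI ballI allI)
        show "zero_of Q \<in> {A \<in> carrier Q. \<phi> A = 0}"
          using functionalD(2)[OF fn(1) subspace_0[OF subspace_lipschitz_free], of 0]
          by (simp add: zero_Q carrier_Q subspace_0[OF subspace_lipschitz_free])
      qed (auto simp: carrier_Q add_Q scale_Q functionalD[OF fn(1)] subspace_add[OF subspace_lipschitz_free]
          subspace_scale[OF subspace_lipschitz_free])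
      moreover have "B \<subseteq> {A \<in> carrier Q. \<phi> A = 0}"
      proof
        fix b assume "b \<in> B"
        then have "b \<in> carrier Q" "h \<phi> b = 0" using B(2) gs(2) fn(2) by auto
        then show "b \<in> {A \<in> carrier Q. \<phi> A = 0}" by (simp add: h_def)
      qed
      ultimately have "carrier Q \<subseteq> {A \<in> carrier Q. \<phi> A = 0}" unfolding B(3)[symmetric] by (intro hull_minimal)
      \<comment> \<open>A functional that is zero on the carrier equals its own multiple by 0, so
        homogeneity gives the value 0.\<close>
      then have "scale_of (dual Q) 0 \<phi> = \<phi>"
        using functionalD(3)[OF fn(1)] by (auto simp: dual_scale fun_eq_iff extensional_def)
      then show "s = 0" using \<Psi>_scale[OF fn(1), of 0] by (simp add: fn)
    qed
    then obtain a where a: "\<And>\<phi>. functional \<phi> \<Longrightarrow> \<Psi> \<phi> = (\<Sum>b\<in>B. a b * h \<phi> b)" by (auto simp: W_def)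
    have "\<forall>b\<in>B. \<exists>z. z \<in> lipschitz_free \<and> b = coset z" using B(2) by (auto simp: carrier_Q)
    then obtain r where r: "\<And>b. b \<in> B \<Longrightarrow> r b \<in> lipschitz_free" "\<And>b. b \<in> B \<Longrightarrow> b = coset (r b)" by metis
    define z where "z = (\<Sum>b\<in>B. a b *\<^sub>R r b)"
    have z: "z \<in> lipschitz_free" unfolding z_def by (intro subspace_sum subspace_scale subspace_lipschitz_free r)
    have "\<Psi> \<phi> = \<phi> (coset z)" if "functional \<phi>" for \<phi>
    proof -
      have "\<Psi> \<phi> = (\<Sum>b\<in>B. a b * \<phi> b)" unfolding a[OF that] using B(2) by (intro sum.cong) (auto simp: h_def)
      also have "\<dots> = (\<Sum>b\<in>B. a b * \<phi> (coset (r b)))" using r(2) by (intro sum.cong) auto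
      also have "\<dots> = \<phi> (coset z)" unfolding z_def using functional_sum[OF that, of B r a] r(1) by simp
      finally show ?thesis .
    qed
    then have "\<Psi> = bidual_embedding Q (coset z)"
      using \<Psi>_ext by (auto simp: bidual_embedding_def fun_eq_iff extensional_def functional_def)
    then show ?thesis using z by (auto simp: carrier_Q)
  qed
  ultimately show ?thesis unfolding reflexive_def by (auto simp: carrier_Q)
qed

text \<open>On \<open>X\<close>, the evaluation given by \<open>z\<close> is a combination of
  evaluations at points of \<open>F\<close>; subtracting the same combination of the
  \<open>delta p\<close> leaves an element of the preannihilator.\<close>

theorem determined_imp_finite_dimensional_Q:
  assumes determined
  shows "finite_dimensional Q"
proof -
  obtain F where F: "finite F" "\<And>f. f \<in> X \<Longrightarrow> (\<forall>p\<in>F. lip0_apply f p = 0) \<Longrightarrow> f = 0"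
    using assms by (auto simp: determined_def)
  define B where "B = (\<lambda>p. coset (delta p)) ` F"
  have B: "B \<subseteq> carrier Q" by (auto simp: B_def carrier_Q delta_mem_lipschitz_free)
  have sub: "subspace_of Q (carrier Q)"
    unfolding subspace_of_def
    by (auto simp: carrier_Q add_Q scale_Q zero_Q subspace_0[OF subspace_lipschitz_free]
        subspace_add[OF subspace_lipschitz_free] subspace_scale[OF subspace_lipschitz_free])
  have "coset z \<in> S" if S: "subspace_of Q S" "B \<subseteq> S" and z: "z \<in> lipschitz_free" for S z
  proof -
    define W where "W = {(lip0_apply f, blinfun_apply z f) | f. f \<in> X}"
    have "\<exists>a. \<forall>(h, s)\<in>W. s = (\<Sum>p\<in>F. a p * h p)"
    proof (rule functional_combination[OF F(1)])
      fix h s h' s' c assume "(h, s) \<in> W" "(h', s') \<in> W"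
      then obtain f g where fg: "f \<in> X" "h = lip0_apply f" "s = blinfun_apply z f"
        "g \<in> X" "h' = lip0_apply g" "s' = blinfun_apply z g" by (auto simp: W_def)
      have "f + c *\<^sub>R g \<in> X" using subspace_X fg by (intro subspace_add subspace_scale)
      moreover have "(\<lambda>b. h b + c * h' b) = lip0_apply (f + c *\<^sub>R g)" by (simp add: fg fun_eq_iff)
      moreover have "s + c * s' = blinfun_apply z (f + c *\<^sub>R g)" by (simp add: fg blinfun.add_right blinfun.scaleR_right)
      ultimately show "((\<lambda>b. h b + c * h' b), s + c * s') \<in> W" unfolding W_def by blast
    next
      fix h s assume "(h, s) \<in> W" "\<forall>p\<in>F. h p = 0"
      then obtain f where "f \<in> X" "h = lip0_apply f" "s = blinfun_apply z f" by (auto simp: W_def)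
      moreover from this \<open>\<forall>p\<in>F. h p = 0\<close> have "f = 0" by (intro F(2)) simp_all
      ultimately show "s = 0" by simp
    qed
    then obtain a where a: "\<And>f. f \<in> X \<Longrightarrow> blinfun_apply z f = (\<Sum>p\<in>F. a p * lip0_apply f p)" by (auto simp: W_def)
    have "(\<Sum>p\<in>G. a p *\<^sub>R delta p) \<in> lipschitz_free" for G
      by (intro subspace_sum subspace_scale subspace_lipschitz_free delta_mem_lipschitz_free)
    then have "coset z = coset (\<Sum>p\<in>F. a p *\<^sub>R delta p)"
      using z a by (intro coset_eq)
        (auto simp: preannihilator_def blinfun.diff_left blinfun.sum_left blinfun.scaleR_left delta.rep_eq
          intro: subspace_diff subspace_lipschitz_free)
    moreover have "coset (\<Sum>p\<in>G. a p *\<^sub>R delta p) \<in> S" if "finite G" "G \<subseteq> F" for G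
      using that
    proof (induction G rule: finite_induct)
      case empty
      then show ?case using S(1) by (simp add: subspace_of_def zero_Q)
    next
      case (insert p G)
      have "coset (delta p) \<in> S" using insert.prems S(2) by (auto simp: B_def)
      then have "scale_of Q (a p) (coset (delta p)) \<in> S" using S(1) by (simp add: subspace_of_def)
      then have "add_of Q (coset (a p *\<^sub>R delta p)) (coset (\<Sum>p\<in>G. a p *\<^sub>R delta p)) \<in> S"
        using S(1) insert by (simp add: subspace_of_def scale_Q)
      then show ?case using insert.hyps by (simp add: add_Q)
    qed
    ultimately show ?thesis using F(1) by simp
  qed
  then have "carrier Q \<subseteq> subspace_of Q hull B" by (auto simp: carrier_Q hull_def)
  then have "subspace_of Q hull B = carrier Q" using hull_minimal[of B "carrier Q" "subspace_of Q", OF B sub] by (rule equalityI[rotated])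
  then show ?thesis unfolding finite_dimensional_def using F(1) B by (intro exI[of _ B]) (auto simp: B_def)
qed

end

section \<open>Finite-dimensional spaces and the dichotomy\<close>

lemma determined_subspace_finite_span:
  fixes X :: "'d::finite lip0 set"
  assumes "finite F" "subspace X" "\<And>f. f \<in> X \<Longrightarrow> (\<forall>p\<in>F. lip0_apply f p = 0) \<Longrightarrow> f = 0"
  shows "\<exists>B. finite B \<and> span B = X"
  using assms
proof (induction F arbitrary: X rule: finite_induct)
  case empty
  then have "X = {0}" using subspace_0 by auto
  then show ?case by (intro exI[of _ "{}"]) simp
next
  case (insert p F)
  \<comment> \<open>The kernel of evaluation at \<open>p\<close> has codimension at most one, so one
    vector \<open>f0\<close> completes a spanning set.\<close>
  define X' where "X' = {f \<in> X. lip0_apply f p = 0}"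
  have "subspace X'"
    using insert.prems(1) by (auto simp: X'_def subspace_def)
  moreover have det: "f = 0" if "f \<in> X'" "\<forall>p\<in>F. lip0_apply f p = 0" for f
    using insert.prems(2)[of f] that by (auto simp: X'_def)
  ultimately have "\<exists>B. finite B \<and> span B = X'" by (rule insert.IH)
  then obtain B where B: "finite B" "span B = X'" by blast
  show ?case
  proof (cases "X' = X")
    case True
    then show ?thesis using B by blast
  next
    case False
    then obtain f0 where f0: "f0 \<in> X" "lip0_apply f0 p \<noteq> 0" by (auto simp: X'_def)
    have "span (insert f0 B) = X"
    proof
      have "B \<subseteq> X" using B(2) span_superset by (auto simp: X'_def)
      then show "span (insert f0 B) \<subseteq> X" using f0 insert.prems(1) by (intro span_minimal) auto
      show "X \<subseteq> span (insert f0 B)"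
      proof
        fix f assume f: "f \<in> X"
        define k where "k = lip0_apply f p / lip0_apply f0 p"
        have "f - k *\<^sub>R f0 \<in> X'"
          using insert.prems(1) f f0 by (auto simp: X'_def k_def intro: subspace_diff subspace_scale)
        then show "f \<in> span (insert f0 B)" unfolding B(2)[symmetric] span_insert by blast
      qed
    qed
    then show ?thesis using B(1) by blast
  qed
qed

text \<open>Combinations with rational coefficients are dense.\<close>

lemma finite_span_separable:
  fixes B :: "'a::real_normed_vector set"
  assumes "finite B"
  shows "separable_space (top_of_set (span B))"
proof -
  define D where "D = (\<lambda>q. \<Sum>b\<in>B. q b *\<^sub>R b) ` PiE B (\<lambda>_. \<rat>)"
  have "countable D" unfolding D_def by (intro countable_image countable_PiE assms) (simp add: countable_rat)
  moreover have D: "D \<subseteq> span B" unfolding D_def by (auto intro: span_sum span_scale span_base)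
  moreover have "span B \<subseteq> closure D"
  proof
    fix f assume "f \<in> span B"
    then obtain u where u: "f = (\<Sum>b\<in>B. u b *\<^sub>R b)" using span_finite[OF assms] by auto
    have "\<exists>q\<in>\<rat>. u b < q \<and> q < u b + 1 / real (Suc n)" for b n by (rule Rats_dense_in_real) simp
    then obtain q where q: "\<And>b n. q b n \<in> \<rat>" "\<And>b n. u b < q b n" "\<And>b n. q b n < u b + 1 / real (Suc n)" by metis
    have "(\<lambda>n. q b n) \<longlonglongrightarrow> u b" for b
    proof (rule tendsto_sandwich)
      show "\<forall>\<^sub>F n in sequentially. u b \<le> q b n" "\<forall>\<^sub>F n in sequentially. q b n \<le> u b + inverse (real (Suc n))"
        using q(2,3) by (auto intro!: always_eventually less_imp_le simp: inverse_eq_divide)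
      show "(\<lambda>n. u b + inverse (real (Suc n))) \<longlonglongrightarrow> u b"
        using tendsto_add[OF tendsto_const LIMSEQ_inverse_real_of_nat, of "u b"] by simp
    qed simp
    then have "(\<lambda>n. \<Sum>b\<in>B. q b n *\<^sub>R b) \<longlonglongrightarrow> f" unfolding u by (intro tendsto_intros)
    moreover have "(\<Sum>b\<in>B. q b n *\<^sub>R b) \<in> D" for n
      unfolding D_def
      by (rule image_eqI[of _ _ "restrict (\<lambda>b. q b n) B"]) (auto intro!: sum.cong q)
    ultimately show "f \<in> closure D"
      unfolding closure_sequential by (intro exI[of _ "\<lambda>n. \<Sum>b\<in>B. q b n *\<^sub>R b"]) simp
  qed
  ultimately show ?thesis
    unfolding separable_space_def
    by (intro exI[of _ D]) (auto simp: closure_of_subtopology Int_absorb1)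
qed

theorem theorem5p6:
  fixes X :: "('d::finite) lip0 set"
  assumes "subspace X"
    and "translation_invariant X"
    and "pointwise_closed X"
  shows "((\<exists>B. finite B \<and> span B = X) \<or> \<not> separable_space (top_of_set X)) \<and>
         \<not> ((\<exists>B. finite B \<and> span B = X) \<and> \<not> separable_space (top_of_set X)) \<and>
         (finite_dimensional (lipschitz_free_quotient X) \<or>
            \<not> reflexive (lipschitz_free_quotient X)) \<and>
         \<not> (finite_dimensional (lipschitz_free_quotient X) \<and>
            \<not> reflexive (lipschitz_free_quotient X))"
proof -
  interpret invariant_lip_space X by unfold_locales (rule assms)+
  have sep: "separable_space (top_of_set X)" if "\<exists>B. finite B \<and> span B = X"
    using that finite_span_separable by blast
  have refl: "reflexive (lipschitz_free_quotient X)" if "finite_dimensional (lipschitz_free_quotient X)"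
    using finite_dimensional_imp_reflexive that by (simp add: Q_def)
  show ?thesis
  \<comment> \<open>This condition decides both dichotomies at once: it makes \<open>X\<close> and
    the predual finite-dimensional, and its failure gives an uncountable spectrum.\<close>
  proof (cases determined)
    case True
    then have "\<exists>B. finite B \<and> span B = X"
      unfolding determined_def using determined_subspace_finite_span[OF _ assms(1)] by blast
    moreover have "finite_dimensional (lipschitz_free_quotient X)"
      using determined_imp_finite_dimensional_Q[OF True] by (simp add: Q_def)
    ultimately show ?thesis using sep refl by blast
  next
    case False
    then have "uncountable (spectrum Y)"
      using finite_spectrum_imp_determined infinite_spectrum_uncountable by blast
    then have "\<not> separable_space (top_of_set X)" "\<not> reflexive (lipschitz_free_quotient X)"
      using uncountable_spectrum_imp_nonseparable uncountable_spectrum_imp_nonreflexive by (simp_all add: Q_def)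
    then show ?thesis using sep refl by blast
  qed
qed

end
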